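(* Let $(R,\mathfrak{m})$ be a catenary noetherian local ring. Then $$\mathrm{c}(R)\ \geq\ \mathrm{depth}(R)-1.$$ Moreover, suppose that $R$ satisfies Serre's condition $S_k$ for some integer $k\geq 2$. Then $R$ is connected in codimension $1$, and for every two minimal primes $\wp$ and $\wp'$ of $R$ and for each prime ideal $\mathcal{P}\supseteq\wp+\wp'$ there exists a sequence $\wp=\wp_1,\ldots,\wp_s=\wp'$ such that $\wp_j\subseteq\mathcal{P}$ is a minimal prime of $R$ for each $j=1,\ldots,s$, and $$\dim R/(\wp_i+\wp_{i+1})\ \geq\ \min\{k,\mathrm{ht}(\mathcal{P})\}-1\quad\text{for each } i=1,\ldots,s-1.$$
   Context: For a noetherian topological space $T$, the connectivity dimension is $\mathrm{c}(T):=\min\{\dim Z : Z\subseteq T \text{ closed and } T\setminus Z \text{ disconnected}\}$, with the convention that the empty set is disconnected and has dimension $-1$. For a noetherian ring $A$, $\mathrm{c}(A):=\mathrm{c}(\mathrm{Spec}\,A)$. For a positive integer $d$, $A$ is connected in codimension $d$ if $\mathrm{c}(A)\geq\dim A-d$. Serre's condition $S_k$: $\mathrm{depth}(R_{\mathfrak{p}})\geq\min\{k,\dim R_{\mathfrak{p}}\}$ for every prime $\mathfrak{p}$ of $R$. *)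

theory Defs
  imports
    "HOL-Algebra.Ring_Divisibility"
    "HOL-Analysis.Abstract_Topology"
    "HOL-Library.Extended_Real"
begin

section \<open>Dimension and connectivity dimension of a topological space\<close>

definition irreducible_space :: "'a topology \<Rightarrow> bool" where
  "irreducible_space X \<longleftrightarrow> topspace X \<noteq> {} \<and>
     (\<forall>A B. closedin X A \<and> closedin X B \<and> topspace X = A \<union> B \<longrightarrow> A = topspace X \<or> B = topspace X)"

text \<open>The list \<open>[Z\<^sub>0, \<dots>, Z\<^sub>n]\<close> is a chain of length \<open>n\<close>. Dimensions take values in
  \<open>{-1, 0, 1, \<dots>, \<infinity>}\<close>, and \<open>-1\<close> occurs only when there is no chain at all, that is, for the
  empty space.\<close>

definition irreducible_closed_chain :: "'a topology \<Rightarrow> 'a set list \<Rightarrow> bool" where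
  "irreducible_closed_chain X Zs \<longleftrightarrow> Zs \<noteq> [] \<and> sorted_wrt (\<subset>) Zs \<and>
     (\<forall>Z\<in>set Zs. closedin X Z \<and> irreducible_space (subtopology X Z))"

definition top_dim :: "'a topology \<Rightarrow> ereal" where
  "top_dim X = Sup (insert (-1) {ereal (real (length Zs - 1)) | Zs. irreducible_closed_chain X Zs})"

text \<open>In \<^const>\<open>connected_space\<close> the empty space counts as connected; here it has to be
  disconnected.\<close>

definition disconnected_space :: "'a topology \<Rightarrow> bool" where
  "disconnected_space X \<longleftrightarrow> topspace X = {} \<or> \<not> connected_space X"

text \<open>The infimum is a minimum: \<open>Z = topspace X\<close> is always admissible, and the values of
  \<^const>\<open>top_dim\<close> are well-ordered.\<close>

definition connectivity_dim :: "'a topology \<Rightarrow> ereal" where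
  "connectivity_dim X =
     Inf {top_dim (subtopology X Z) | Z.
       closedin X Z \<and> disconnected_space (subtopology X (topspace X - Z))}"


section \<open>Prime ideals\<close>

definition prime_spec :: "('a, 'b) ring_scheme \<Rightarrow> 'a set set" where
  "prime_spec R = {P. primeideal P R}"

definition zariski :: "('a, 'b) ring_scheme \<Rightarrow> 'a set topology" where
  "zariski R = topology (\<lambda>U. \<exists>E \<subseteq> carrier R. U = {P \<in> prime_spec R. \<not> E \<subseteq> P})"

lemma istopology_zariski:
  "istopology (\<lambda>U. \<exists>E \<subseteq> carrier R. U = {P \<in> prime_spec R. \<not> E \<subseteq> P})"
proof -
  have inter: "\<exists>G \<subseteq> carrier R. U \<inter> V = {P \<in> prime_spec R. \<not> G \<subseteq> P}"
    if E: "E \<subseteq> carrier R" "U = {P \<in> prime_spec R. \<not> E \<subseteq> P}"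
      and F: "F \<subseteq> carrier R" "V = {P \<in> prime_spec R. \<not> F \<subseteq> P}" for U V E F
  proof -
    define G where "G = {e \<otimes>\<^bsub>R\<^esub> f | e f. e \<in> E \<and> f \<in> F}"
    have *: "G \<subseteq> P \<longleftrightarrow> E \<subseteq> P \<or> F \<subseteq> P" if "primeideal P R" for P
    proof -
      interpret primeideal P R by fact
      show ?thesis
      proof
        assume GP: "G \<subseteq> P"
        show "E \<subseteq> P \<or> F \<subseteq> P"
        proof (rule ccontr)
          assume "\<not> (E \<subseteq> P \<or> F \<subseteq> P)"
          then obtain e f where ef: "e \<in> E" "e \<notin> P" "f \<in> F" "f \<notin> P" by blast
          then have "e \<otimes>\<^bsub>R\<^esub> f \<in> P" using GP unfolding G_def by blast
          then show False using I_prime[of e f] ef E(1) F(1) by blast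
        qed
      next
        assume or: "E \<subseteq> P \<or> F \<subseteq> P"
        have "e \<otimes>\<^bsub>R\<^esub> f \<in> P" if "e \<in> E" "f \<in> F" for e f
          using or
        proof
          assume "E \<subseteq> P"
          then show ?thesis using that F(1) by (intro I_r_closed) auto
        next
          assume "F \<subseteq> P"
          then show ?thesis using that E(1) by (intro I_l_closed) auto
        qed
        then show "G \<subseteq> P" unfolding G_def by blast
      qed
    qed
    show ?thesis
    proof (cases "prime_spec R = {}")
      case True
      then show ?thesis using E F by blast
    next
      case False
      then obtain Q where "primeideal Q R" by (auto simp: prime_spec_def)
      then interpret primeideal Q R .
      have "G \<subseteq> carrier R" unfolding G_def using E(1) F(1) by auto
      moreover have "U \<inter> V = {P \<in> prime_spec R. \<not> G \<subseteq> P}"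
        unfolding E(2) F(2) prime_spec_def using * by blast
      ultimately show ?thesis by blast
    qed
  qed
  have union: "\<exists>G \<subseteq> carrier R. \<Union>\<U> = {P \<in> prime_spec R. \<not> G \<subseteq> P}"
    if "\<forall>U\<in>\<U>. \<exists>E \<subseteq> carrier R. U = {P \<in> prime_spec R. \<not> E \<subseteq> P}" for \<U>
  proof -
    from that obtain E where E: "\<And>U. U \<in> \<U> \<Longrightarrow> E U \<subseteq> carrier R"
      "\<And>U. U \<in> \<U> \<Longrightarrow> U = {P \<in> prime_spec R. \<not> E U \<subseteq> P}" by metis
    have "\<Union>\<U> = (\<Union>U\<in>\<U>. {P \<in> prime_spec R. \<not> E U \<subseteq> P})"
      using E(2) by (metis (no_types, lifting) SUP_cong image_ident)
    also have "\<dots> = {P \<in> prime_spec R. \<not> (\<Union>U\<in>\<U>. E U) \<subseteq> P}" by blast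
    finally show ?thesis using E(1) by (intro exI[of _ "\<Union>U\<in>\<U>. E U"]) auto
  qed
  show ?thesis unfolding istopology_def
  proof (intro conjI allI impI)
    fix U V
    assume "\<exists>E \<subseteq> carrier R. U = {P \<in> prime_spec R. \<not> E \<subseteq> P}"
      and "\<exists>E \<subseteq> carrier R. V = {P \<in> prime_spec R. \<not> E \<subseteq> P}"
    then show "\<exists>E \<subseteq> carrier R. U \<inter> V = {P \<in> prime_spec R. \<not> E \<subseteq> P}"
      by (elim exE conjE) (rule inter)
  qed (rule union)
qed

lemma openin_zariski:
  "openin (zariski R) U \<longleftrightarrow> (\<exists>E \<subseteq> carrier R. U = {P \<in> prime_spec R. \<not> E \<subseteq> P})"
  unfolding zariski_def topology_inverse'[OF istopology_zariski] by (rule refl)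

lemma topspace_zariski: "topspace (zariski R) = prime_spec R"
proof -
  have "carrier R \<noteq> P \<and> P \<subseteq> carrier R" if "P \<in> prime_spec R" for P
  proof -
    interpret primeideal P R using that by (simp add: prime_spec_def)
    show ?thesis using I_notcarr a_subset by simp
  qed
  then have "openin (zariski R) (prime_spec R)"
    unfolding openin_zariski by (intro exI[of _ "carrier R"]) blast
  moreover have "U \<subseteq> prime_spec R" if "openin (zariski R) U" for U
    using that by (auto simp: openin_zariski)
  ultimately show ?thesis
    unfolding topspace_def by blast
qed

definition minimal_prime :: "('a, 'b) ring_scheme \<Rightarrow> 'a set \<Rightarrow> bool" where
  "minimal_prime R P \<longleftrightarrow> P \<in> prime_spec R \<and> \<not> (\<exists>Q \<in> prime_spec R. Q \<subset> P)"

text \<open>As above, \<open>[P\<^sub>0, \<dots>, P\<^sub>n]\<close> is a chain of length \<open>n\<close>.\<close>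

definition prime_chain :: "('a, 'b) ring_scheme \<Rightarrow> 'a set list \<Rightarrow> bool" where
  "prime_chain R Ps \<longleftrightarrow> Ps \<noteq> [] \<and> set Ps \<subseteq> prime_spec R \<and> sorted_wrt (\<subset>) Ps"

definition krull_dim :: "('a, 'b) ring_scheme \<Rightarrow> ereal" where
  "krull_dim R = Sup (insert (-1) {ereal (real (length Ps - 1)) | Ps. prime_chain R Ps})"

definition height :: "('a, 'b) ring_scheme \<Rightarrow> 'a set \<Rightarrow> ereal" where
  "height R P = Sup {ereal (real (length Ps - 1)) | Ps. prime_chain R Ps \<and> last Ps = P}"

definition saturated_prime_chain :: "('a, 'b) ring_scheme \<Rightarrow> 'a set list \<Rightarrow> bool" where
  "saturated_prime_chain R Ps \<longleftrightarrow> prime_chain R Ps \<and>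
     (\<forall>i. Suc i < length Ps \<longrightarrow> \<not> (\<exists>Q \<in> prime_spec R. Ps ! i \<subset> Q \<and> Q \<subset> Ps ! Suc i))"

definition catenary :: "('a, 'b) ring_scheme \<Rightarrow> bool" where
  "catenary R \<longleftrightarrow> (\<forall>P \<in> prime_spec R. \<forall>Q \<in> prime_spec R. P \<subseteq> Q \<longrightarrow>
     (\<exists>N. \<forall>Ps. prime_chain R Ps \<and> hd Ps = P \<and> last Ps = Q \<longrightarrow> length Ps \<le> N) \<and>
     (\<forall>Ps Ps'. saturated_prime_chain R Ps \<and> hd Ps = P \<and> last Ps = Q \<and>
        saturated_prime_chain R Ps' \<and> hd Ps' = P \<and> last Ps' = Q \<longrightarrow> length Ps = length Ps'))"

definition connected_in_codim :: "('a, 'b) ring_scheme \<Rightarrow> nat \<Rightarrow> bool" where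
  "connected_in_codim R d \<longleftrightarrow> connectivity_dim (zariski R) \<ge> krull_dim R - ereal (real d)"


section \<open>Local rings and depth\<close>

definition local_ring :: "('a, 'b) ring_scheme \<Rightarrow> 'a set \<Rightarrow> bool" where
  "local_ring R M \<longleftrightarrow> cring R \<and> {I. maximalideal I R} = {M}"

definition nonzerodivisor :: "('a, 'b) ring_scheme \<Rightarrow> 'a \<Rightarrow> bool" where
  "nonzerodivisor R x \<longleftrightarrow> x \<in> carrier R \<and>
     (\<forall>y \<in> carrier R. x \<otimes>\<^bsub>R\<^esub> y = \<zero>\<^bsub>R\<^esub> \<longrightarrow> y = \<zero>\<^bsub>R\<^esub>)"

definition regular_sequence :: "('a, 'b) ring_scheme \<Rightarrow> 'a list \<Rightarrow> bool" where
  "regular_sequence R xs \<longleftrightarrow> set xs \<subseteq> carrier R \<and> Idl\<^bsub>R\<^esub> (set xs) \<noteq> carrier R \<and>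
     (\<forall>i < length xs.
        let J = Idl\<^bsub>R\<^esub> (set (take i xs)) in nonzerodivisor (R Quot J) (J +>\<^bsub>R\<^esub> xs ! i))"

text \<open>Meaningful only for local rings, where the maximal ideal is unique.\<close>

definition depth :: "('a, 'b) ring_scheme \<Rightarrow> ereal" where
  "depth R = Sup {ereal (real (length xs)) | xs.
     regular_sequence R xs \<and> set xs \<subseteq> (THE M. maximalideal M R)}"


section \<open>Localization at a prime ideal and Serre's condition\<close>

text \<open>The fraction \<open>a/s\<close>, as the class of all pairs \<open>(b, t)\<close> with \<open>u(at - bs) = 0\<close> for some
  \<open>u\<close> outside \<open>P\<close>.\<close>

definition fraction :: "('a, 'b) ring_scheme \<Rightarrow> 'a set \<Rightarrow> 'a \<Rightarrow> 'a \<Rightarrow> ('a \<times> 'a) set" where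
  "fraction R P a s = {(b, t). b \<in> carrier R \<and> t \<in> carrier R - P \<and>
     (\<exists>u \<in> carrier R - P. u \<otimes>\<^bsub>R\<^esub> (a \<otimes>\<^bsub>R\<^esub> t) = u \<otimes>\<^bsub>R\<^esub> (b \<otimes>\<^bsub>R\<^esub> s))}"

definition localization :: "('a, 'b) ring_scheme \<Rightarrow> 'a set \<Rightarrow> ('a \<times> 'a) set ring" where
  "localization R P =
     \<lparr>carrier = {fraction R P a s | a s. a \<in> carrier R \<and> s \<in> carrier R - P},
      mult = (\<lambda>X Y. \<Union>(a, s)\<in>X. \<Union>(b, t)\<in>Y. fraction R P (a \<otimes>\<^bsub>R\<^esub> b) (s \<otimes>\<^bsub>R\<^esub> t)),
      one = fraction R P \<one>\<^bsub>R\<^esub> \<one>\<^bsub>R\<^esub>,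
      zero = fraction R P \<zero>\<^bsub>R\<^esub> \<one>\<^bsub>R\<^esub>,
      add = (\<lambda>X Y. \<Union>(a, s)\<in>X. \<Union>(b, t)\<in>Y.
        fraction R P (a \<otimes>\<^bsub>R\<^esub> t \<oplus>\<^bsub>R\<^esub> b \<otimes>\<^bsub>R\<^esub> s) (s \<otimes>\<^bsub>R\<^esub> t))\<rparr>"

definition serre_condition :: "('a, 'b) ring_scheme \<Rightarrow> nat \<Rightarrow> bool" where
  "serre_condition R k \<longleftrightarrow> (\<forall>P \<in> prime_spec R.
     depth (localization R P) \<ge> min (ereal (real k)) (krull_dim (localization R P)))"

lemma eq_singletonI: "x \<in> A \<Longrightarrow> (\<And>y. y \<in> A \<Longrightarrow> y = x) \<Longrightarrow> A = {x}"
  by blast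

lemma Union_pairs_const:
  assumes "\<And>a s b t. (a, s) \<in> X \<Longrightarrow> (b, t) \<in> Y \<Longrightarrow> f a s b t = Z" "X \<noteq> {}" "Y \<noteq> {}"
  shows "(\<Union>(a, s)\<in>X. \<Union>(b, t)\<in>Y. f a s b t) = Z"
proof -
  have "(\<Union>(a, s)\<in>X. \<Union>(b, t)\<in>Y. f a s b t) = (\<Union>x\<in>X. \<Union>y\<in>Y. Z)"
    by (intro SUP_cong refl) (auto simp: assms(1) split: prod.splits)
  then show ?thesis using assms(2,3) by simp
qed

context primeideal
begin

lemma mult_mem_iff: "a \<in> carrier R \<Longrightarrow> b \<in> carrier R \<Longrightarrow> a \<otimes> b \<in> I \<longleftrightarrow> a \<in> I \<or> b \<in> I"
  using I_prime[of a b] I_l_closed[of b a] I_r_closed[of a b] by blast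

lemma compl_mult: "s \<in> carrier R - I \<Longrightarrow> t \<in> carrier R - I \<Longrightarrow> s \<otimes> t \<in> carrier R - I"
  using I_prime[of s t] by auto

lemma compl_one: "\<one> \<in> carrier R - I"
  using I_notcarr one_imp_carrier by auto

lemma fraction_self: "a \<in> carrier R \<Longrightarrow> s \<in> carrier R - I \<Longrightarrow> (a, s) \<in> fraction R I a s"
  unfolding fraction_def using compl_one by auto

lemma fraction_cong:
  assumes a: "a \<in> carrier R" and s: "s \<in> carrier R - I"
    and b: "b \<in> carrier R" and t: "t \<in> carrier R - I"
    and u: "u \<in> carrier R - I" and eq: "u \<otimes> (a \<otimes> t) = u \<otimes> (b \<otimes> s)"
  shows "fraction R I a s = fraction R I b t"
proof -
  have sub: "fraction R I a s \<subseteq> fraction R I b t"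
    if a: "a \<in> carrier R" and s: "s \<in> carrier R - I"
      and b: "b \<in> carrier R" and t: "t \<in> carrier R - I"
      and u: "u \<in> carrier R - I" and eq: "u \<otimes> (a \<otimes> t) = u \<otimes> (b \<otimes> s)" for a s b t u
  proof (rule subsetI, clarify)
    fix c v assume "(c, v) \<in> fraction R I a s"
    then obtain w where c: "c \<in> carrier R" and v: "v \<in> carrier R - I" and w: "w \<in> carrier R - I"
      and e: "w \<otimes> (a \<otimes> v) = w \<otimes> (c \<otimes> s)" unfolding fraction_def by auto
    note cl = a b c s t u v w
    have "(u \<otimes> w \<otimes> s) \<otimes> (b \<otimes> v) = (u \<otimes> (b \<otimes> s)) \<otimes> (w \<otimes> v)"
      using cl by (simp add: m_ac)
    also have "\<dots> = (u \<otimes> (a \<otimes> t)) \<otimes> (w \<otimes> v)" using eq by simp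
    also have "\<dots> = (w \<otimes> (a \<otimes> v)) \<otimes> (u \<otimes> t)" using cl by (simp add: m_ac)
    also have "\<dots> = (w \<otimes> (c \<otimes> s)) \<otimes> (u \<otimes> t)" using e by simp
    also have "\<dots> = (u \<otimes> w \<otimes> s) \<otimes> (c \<otimes> t)" using cl by (simp add: m_ac)
    finally show "(c, v) \<in> fraction R I b t"
      unfolding fraction_def using c v compl_mult[OF compl_mult[OF u w] s] by auto
  qed
  show ?thesis using sub[OF assms] sub[OF b t a s u eq[symmetric]] by blast
qed

lemma fraction_eq_iff:
  assumes "a \<in> carrier R" "s \<in> carrier R - I" "b \<in> carrier R" "t \<in> carrier R - I"
  shows "fraction R I a s = fraction R I b t \<longleftrightarrow>
    (\<exists>u \<in> carrier R - I. u \<otimes> (a \<otimes> t) = u \<otimes> (b \<otimes> s))"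
proof
  assume "fraction R I a s = fraction R I b t"
  then have "(b, t) \<in> fraction R I a s" using fraction_self[OF assms(3,4)] by simp
  then show "\<exists>u \<in> carrier R - I. u \<otimes> (a \<otimes> t) = u \<otimes> (b \<otimes> s)" unfolding fraction_def by auto
qed (use fraction_cong assms in blast)

lemma fraction_mem_eq:
  assumes "a \<in> carrier R" "s \<in> carrier R - I" "(b, t) \<in> fraction R I a s"
  shows "b \<in> carrier R" "t \<in> carrier R - I" "fraction R I b t = fraction R I a s"
proof -
  from assms(3) obtain u where "b \<in> carrier R" "t \<in> carrier R - I" "u \<in> carrier R - I"
    "u \<otimes> (a \<otimes> t) = u \<otimes> (b \<otimes> s)" unfolding fraction_def by auto
  then show "b \<in> carrier R" "t \<in> carrier R - I" "fraction R I b t = fraction R I a s"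
    using fraction_cong[OF assms(1,2)] by auto
qed

lemma localization_mult:
  assumes a: "a \<in> carrier R" and s: "s \<in> carrier R - I"
    and b: "b \<in> carrier R" and t: "t \<in> carrier R - I"
  shows "fraction R I a s \<otimes>\<^bsub>localization R I\<^esub> fraction R I b t = fraction R I (a \<otimes> b) (s \<otimes> t)"
proof -
  have "fraction R I (a' \<otimes> b') (s' \<otimes> t') = fraction R I (a \<otimes> b) (s \<otimes> t)"
    if A: "(a', s') \<in> fraction R I a s" and B: "(b', t') \<in> fraction R I b t" for a' s' b' t'
  proof -
    note A' = fraction_mem_eq[OF a s A] and B' = fraction_mem_eq[OF b t B]
    obtain u where u: "u \<in> carrier R - I" "u \<otimes> (a' \<otimes> s) = u \<otimes> (a \<otimes> s')"
      using A' fraction_eq_iff[OF A'(1,2) a s] by blast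
    obtain v where v: "v \<in> carrier R - I" "v \<otimes> (b' \<otimes> t) = v \<otimes> (b \<otimes> t')"
      using B' fraction_eq_iff[OF B'(1,2) b t] by blast
    note cl = a b s t A'(1,2) B'(1,2) u(1) v(1)
    have "(u \<otimes> v) \<otimes> ((a' \<otimes> b') \<otimes> (s \<otimes> t)) = (u \<otimes> (a' \<otimes> s)) \<otimes> (v \<otimes> (b' \<otimes> t))"
      using cl by (simp add: m_ac)
    also have "\<dots> = (u \<otimes> (a \<otimes> s')) \<otimes> (v \<otimes> (b \<otimes> t'))" using u v by simp
    also have "\<dots> = (u \<otimes> v) \<otimes> ((a \<otimes> b) \<otimes> (s' \<otimes> t'))" using cl by (simp add: m_ac)
    finally show ?thesis using cl
      by (intro fraction_cong[OF _ _ _ _ compl_mult[OF u(1) v(1)]]) (auto simp: mult_mem_iff)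
  qed
  moreover have "fraction R I a s \<noteq> {}" "fraction R I b t \<noteq> {}"
    using fraction_self[OF a s] fraction_self[OF b t] by auto
  ultimately show ?thesis
    unfolding localization_def monoid.simps ring.simps by (rule Union_pairs_const)
qed

lemma localization_add:
  assumes a: "a \<in> carrier R" and s: "s \<in> carrier R - I"
    and b: "b \<in> carrier R" and t: "t \<in> carrier R - I"
  shows "fraction R I a s \<oplus>\<^bsub>localization R I\<^esub> fraction R I b t = fraction R I (a \<otimes> t \<oplus> b \<otimes> s) (s \<otimes> t)"
proof -
  have "fraction R I (a' \<otimes> t' \<oplus> b' \<otimes> s') (s' \<otimes> t') = fraction R I (a \<otimes> t \<oplus> b \<otimes> s) (s \<otimes> t)"
    if A: "(a', s') \<in> fraction R I a s" and B: "(b', t') \<in> fraction R I b t" for a' s' b' t'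
  proof -
    note A' = fraction_mem_eq[OF a s A] and B' = fraction_mem_eq[OF b t B]
    obtain u where u: "u \<in> carrier R - I" "u \<otimes> (a' \<otimes> s) = u \<otimes> (a \<otimes> s')"
      using A' fraction_eq_iff[OF A'(1,2) a s] by blast
    obtain v where v: "v \<in> carrier R - I" "v \<otimes> (b' \<otimes> t) = v \<otimes> (b \<otimes> t')"
      using B' fraction_eq_iff[OF B'(1,2) b t] by blast
    note cl = a b s t A'(1,2) B'(1,2) u(1) v(1)
    have "(u \<otimes> v) \<otimes> ((a' \<otimes> t' \<oplus> b' \<otimes> s') \<otimes> (s \<otimes> t))
        = (u \<otimes> (a' \<otimes> s)) \<otimes> (v \<otimes> (t \<otimes> t')) \<oplus> (v \<otimes> (b' \<otimes> t)) \<otimes> (u \<otimes> (s \<otimes> s'))"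
      using cl by (simp add: m_ac r_distr l_distr)
    also have "\<dots> = (u \<otimes> (a \<otimes> s')) \<otimes> (v \<otimes> (t \<otimes> t')) \<oplus> (v \<otimes> (b \<otimes> t')) \<otimes> (u \<otimes> (s \<otimes> s'))"
      using u v by simp
    also have "\<dots> = (u \<otimes> v) \<otimes> ((a \<otimes> t \<oplus> b \<otimes> s) \<otimes> (s' \<otimes> t'))"
      using cl by (simp add: m_ac r_distr l_distr)
    finally show ?thesis using cl
      by (intro fraction_cong[OF _ _ _ _ compl_mult[OF u(1) v(1)]]) (auto simp: mult_mem_iff)
  qed
  moreover have "fraction R I a s \<noteq> {}" "fraction R I b t \<noteq> {}"
    using fraction_self[OF a s] fraction_self[OF b t] by auto
  ultimately show ?thesis
    unfolding localization_def monoid.simps ring.simps by (rule Union_pairs_const)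
qed

lemma localization_carrier:
  "carrier (localization R I) = {fraction R I a s | a s. a \<in> carrier R \<and> s \<in> carrier R - I}"
  and localization_one: "\<one>\<^bsub>localization R I\<^esub> = fraction R I \<one> \<one>"
  and localization_zero: "\<zero>\<^bsub>localization R I\<^esub> = fraction R I \<zero> \<one>"
  by (simp_all add: localization_def)

lemma localization_cring: "cring (localization R I)"
proof -
  let ?L = "localization R I"
  have closed: "fraction R I a s \<in> carrier ?L" if "a \<in> carrier R" "s \<in> carrier R - I" for a s
    using that unfolding localization_carrier by blast
  have elim: "\<exists>a s. a \<in> carrier R \<and> s \<in> carrier R - I \<and> X = fraction R I a s"
    if "X \<in> carrier ?L" for X
    using that unfolding localization_carrier by blast
  note ops = localization_mult localization_add
  have eqI: "fraction R I a s = fraction R I b t"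
    if "a \<in> carrier R" "s \<in> carrier R - I" "b \<in> carrier R" "t \<in> carrier R - I"
      "a \<otimes> t = b \<otimes> s" for a s b t
    using that fraction_cong compl_one by metis
  have clA: "a \<otimes> t \<oplus> b \<otimes> s \<in> carrier R"
    if "a \<in> carrier R" "s \<in> carrier R - I" "b \<in> carrier R" "t \<in> carrier R - I" for a s b t
    using that by auto
  show ?thesis
  proof (rule cringI)
    show "abelian_group ?L"
    proof (rule abelian_groupI)
      fix X Y assume "X \<in> carrier ?L" "Y \<in> carrier ?L"
      then show "X \<oplus>\<^bsub>?L\<^esub> Y \<in> carrier ?L"
        by (auto dest!: elim simp: localization_add mult_mem_iff intro!: closed clA)
    next
      show "\<zero>\<^bsub>?L\<^esub> \<in> carrier ?L" unfolding localization_zero using closed compl_one by simp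
    next
      fix X Y Z assume "X \<in> carrier ?L" "Y \<in> carrier ?L" "Z \<in> carrier ?L"
      then obtain a s b t c u where cl: "a \<in> carrier R" "s \<in> carrier R - I"
        "b \<in> carrier R" "t \<in> carrier R - I" "c \<in> carrier R" "u \<in> carrier R - I"
        and X: "X = fraction R I a s" "Y = fraction R I b t" "Z = fraction R I c u" using elim by metis
      have 1: "X \<oplus>\<^bsub>?L\<^esub> Y \<oplus>\<^bsub>?L\<^esub> Z
          = fraction R I ((a \<otimes> t \<oplus> b \<otimes> s) \<otimes> u \<oplus> c \<otimes> (s \<otimes> t)) (s \<otimes> t \<otimes> u)"
        unfolding X using cl clA compl_mult by (simp only: localization_add)
      have 2: "X \<oplus>\<^bsub>?L\<^esub> (Y \<oplus>\<^bsub>?L\<^esub> Z)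
          = fraction R I (a \<otimes> (t \<otimes> u) \<oplus> (b \<otimes> u \<oplus> c \<otimes> t) \<otimes> s) (s \<otimes> (t \<otimes> u))"
        unfolding X using cl clA compl_mult by (simp only: localization_add)
      have "(a \<otimes> t \<oplus> b \<otimes> s) \<otimes> u \<oplus> c \<otimes> (s \<otimes> t)
          = a \<otimes> (t \<otimes> u) \<oplus> (b \<otimes> u \<oplus> c \<otimes> t) \<otimes> s" "s \<otimes> t \<otimes> u = s \<otimes> (t \<otimes> u)"
        using cl by (simp_all add: m_ac a_ac l_distr r_distr)
      then show "X \<oplus>\<^bsub>?L\<^esub> Y \<oplus>\<^bsub>?L\<^esub> Z = X \<oplus>\<^bsub>?L\<^esub> (Y \<oplus>\<^bsub>?L\<^esub> Z)"
        unfolding 1 2 by simp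
    next
      fix X Y assume "X \<in> carrier ?L" "Y \<in> carrier ?L"
      then obtain a s b t where cl: "a \<in> carrier R" "s \<in> carrier R - I"
        "b \<in> carrier R" "t \<in> carrier R - I"
        and X: "X = fraction R I a s" "Y = fraction R I b t" using elim by metis
      show "X \<oplus>\<^bsub>?L\<^esub> Y = Y \<oplus>\<^bsub>?L\<^esub> X"
        unfolding X using cl by (simp add: localization_add m_ac a_ac)
    next
      fix X assume "X \<in> carrier ?L"
      then obtain a s where cl: "a \<in> carrier R" "s \<in> carrier R - I"
        and X: "X = fraction R I a s" using elim by metis
      show "\<zero>\<^bsub>?L\<^esub> \<oplus>\<^bsub>?L\<^esub> X = X"
        unfolding X localization_zero using cl compl_one by (simp add: localization_add)
      have "\<ominus> a \<otimes> s \<oplus> a \<otimes> s = \<zero>" using cl by (simp add: l_minus l_neg)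
      then have "fraction R I (\<ominus> a) s \<oplus>\<^bsub>?L\<^esub> X = fraction R I \<zero> (s \<otimes> s)"
        unfolding X using cl by (simp add: localization_add)
      also have "\<dots> = \<zero>\<^bsub>?L\<^esub>"
        unfolding localization_zero using cl compl_mult[OF cl(2) cl(2)] compl_one
        by (intro eqI[OF zero_closed _ zero_closed]) simp_all
      finally show "\<exists>Y\<in>carrier ?L. Y \<oplus>\<^bsub>?L\<^esub> X = \<zero>\<^bsub>?L\<^esub>" using closed[of "\<ominus> a" s] cl by auto
    qed
  next
    show "comm_monoid ?L"
    proof (rule comm_monoidI)
      fix X Y assume "X \<in> carrier ?L" "Y \<in> carrier ?L"
      then show "X \<otimes>\<^bsub>?L\<^esub> Y \<in> carrier ?L"
        by (auto dest!: elim simp: localization_mult mult_mem_iff intro!: closed)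
    next
      show "\<one>\<^bsub>?L\<^esub> \<in> carrier ?L" unfolding localization_one using closed compl_one by simp
    next
      fix X Y Z assume "X \<in> carrier ?L" "Y \<in> carrier ?L" "Z \<in> carrier ?L"
      then obtain a s b t c u where cl: "a \<in> carrier R" "s \<in> carrier R - I"
        "b \<in> carrier R" "t \<in> carrier R - I" "c \<in> carrier R" "u \<in> carrier R - I"
        and X: "X = fraction R I a s" "Y = fraction R I b t" "Z = fraction R I c u" using elim by metis
      have "X \<otimes>\<^bsub>?L\<^esub> Y \<otimes>\<^bsub>?L\<^esub> Z = fraction R I (a \<otimes> b \<otimes> c) (s \<otimes> t \<otimes> u)"
        unfolding X using cl compl_mult m_closed by (simp only: localization_mult)
      moreover have "X \<otimes>\<^bsub>?L\<^esub> (Y \<otimes>\<^bsub>?L\<^esub> Z) = fraction R I (a \<otimes> (b \<otimes> c)) (s \<otimes> (t \<otimes> u))"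
        unfolding X using cl compl_mult m_closed by (simp only: localization_mult)
      ultimately show "X \<otimes>\<^bsub>?L\<^esub> Y \<otimes>\<^bsub>?L\<^esub> Z = X \<otimes>\<^bsub>?L\<^esub> (Y \<otimes>\<^bsub>?L\<^esub> Z)"
        using cl by (simp add: m_assoc)
    next
      fix X assume "X \<in> carrier ?L"
      then obtain a s where cl: "a \<in> carrier R" "s \<in> carrier R - I"
        and X: "X = fraction R I a s" using elim by metis
      show "\<one>\<^bsub>?L\<^esub> \<otimes>\<^bsub>?L\<^esub> X = X"
        unfolding X localization_one using cl compl_one by (simp add: localization_mult)
    next
      fix X Y assume "X \<in> carrier ?L" "Y \<in> carrier ?L"
      then obtain a s b t where cl: "a \<in> carrier R" "s \<in> carrier R - I"
        "b \<in> carrier R" "t \<in> carrier R - I"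
        and X: "X = fraction R I a s" "Y = fraction R I b t" using elim by metis
      show "X \<otimes>\<^bsub>?L\<^esub> Y = Y \<otimes>\<^bsub>?L\<^esub> X"
        unfolding X using cl by (simp add: localization_mult m_ac)
    qed
  next
    fix X Y Z assume "X \<in> carrier ?L" "Y \<in> carrier ?L" "Z \<in> carrier ?L"
    then obtain a s b t c u where cl: "a \<in> carrier R" "s \<in> carrier R - I"
      "b \<in> carrier R" "t \<in> carrier R - I" "c \<in> carrier R" "u \<in> carrier R - I"
      and X: "X = fraction R I a s" "Y = fraction R I b t" "Z = fraction R I c u" using elim by metis
    have 1: "(X \<oplus>\<^bsub>?L\<^esub> Y) \<otimes>\<^bsub>?L\<^esub> Z = fraction R I ((a \<otimes> t \<oplus> b \<otimes> s) \<otimes> c) (s \<otimes> t \<otimes> u)"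
      unfolding X using cl clA compl_mult by (simp only: localization_add localization_mult)
    have 2: "X \<otimes>\<^bsub>?L\<^esub> Z \<oplus>\<^bsub>?L\<^esub> Y \<otimes>\<^bsub>?L\<^esub> Z =
        fraction R I (a \<otimes> c \<otimes> (t \<otimes> u) \<oplus> b \<otimes> c \<otimes> (s \<otimes> u)) ((s \<otimes> u) \<otimes> (t \<otimes> u))"
      unfolding X using cl clA compl_mult m_closed
      by (simp only: localization_add localization_mult)
    show "(X \<oplus>\<^bsub>?L\<^esub> Y) \<otimes>\<^bsub>?L\<^esub> Z = X \<otimes>\<^bsub>?L\<^esub> Z \<oplus>\<^bsub>?L\<^esub> Y \<otimes>\<^bsub>?L\<^esub> Z"
      unfolding 1 2 using cl compl_mult
      by (intro eqI) (auto simp: m_ac l_distr r_distr mult_mem_iff)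
  qed
qed

lemma localization_local:
  "local_ring (localization R I) {fraction R I a s | a s. a \<in> I \<and> s \<in> carrier R - I}"
proof -
  let ?L = "localization R I" and ?M = "{fraction R I a s | a s. a \<in> I \<and> s \<in> carrier R - I}"
  interpret L: cring ?L by (rule localization_cring)
  have mem: "fraction R I a s \<in> ?M \<longleftrightarrow> a \<in> I" if a: "a \<in> carrier R" and s: "s \<in> carrier R - I" for a s
  proof
    assume "fraction R I a s \<in> ?M"
    then obtain b t where b: "b \<in> I" "t \<in> carrier R - I" and "fraction R I a s = fraction R I b t" by blast
    then obtain u where u: "u \<in> carrier R - I" "u \<otimes> (a \<otimes> t) = u \<otimes> (b \<otimes> s)"
      using fraction_eq_iff a s Icarr by metis
    have "u \<otimes> (b \<otimes> s) \<in> I" using b u s by (intro I_l_closed I_r_closed) auto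
    then have "u \<otimes> (a \<otimes> t) \<in> I" using u by simp
    then show "a \<in> I" using I_prime a b(2) u(1) by (meson DiffD1 DiffD2 m_closed)
  qed (use s in blast)
  have sub: "?M \<subseteq> carrier ?L" unfolding localization_carrier using Icarr by blast
  have inv: "J = carrier ?L" if J: "ideal J ?L" and X: "X \<in> J" "X \<notin> ?M" for J X
  proof -
    interpret J: ideal J ?L by fact
    obtain a s where a: "a \<in> carrier R" and s: "s \<in> carrier R - I" and Xe: "X = fraction R I a s"
      using J.Icarr[OF X(1)] unfolding localization_carrier by blast
    have aI: "a \<in> carrier R - I" using X(2) a s unfolding Xe by blast
    have "fraction R I s a \<otimes>\<^bsub>?L\<^esub> X = fraction R I (s \<otimes> a) (a \<otimes> s)"
      unfolding Xe using a s aI by (simp add: localization_mult)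
    also have "\<dots> = \<one>\<^bsub>?L\<^esub>"
      unfolding localization_one
      using a s aI compl_one compl_mult by (intro fraction_cong[OF _ _ _ _ compl_one]) (auto simp: m_ac)
    finally have "fraction R I s a \<otimes>\<^bsub>?L\<^esub> X = \<one>\<^bsub>?L\<^esub>" .
    moreover have "fraction R I s a \<in> carrier ?L"
      unfolding localization_carrier using s aI by blast
    ultimately have "\<one>\<^bsub>?L\<^esub> \<in> J"
      using J.I_l_closed[OF X(1), of "fraction R I s a"] by simp
    then show ?thesis by (rule J.one_imp_carrier)
  qed
  have idl: "ideal ?M ?L"
  proof (rule idealI)
    show "ring ?L" by (rule L.ring_axioms)
    show "subgroup ?M (add_monoid ?L)"
    proof (rule L.add.subgroupI)
      show "?M \<subseteq> carrier ?L" by fact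
      have "fraction R I \<zero> \<one> \<in> ?M"
        using additive_subgroup.zero_closed[OF is_additive_subgroup] compl_one by blast
      then show "?M \<noteq> {}" by blast
      fix X assume "X \<in> ?M"
      then obtain a s where a: "a \<in> I" and s: "s \<in> carrier R - I" and X: "X = fraction R I a s" by blast
      note aR = Icarr[OF a]
      have "\<ominus> a \<otimes> s \<oplus> a \<otimes> s = \<zero>" using aR s by (simp add: l_minus l_neg)
      then have "fraction R I (\<ominus> a) s \<oplus>\<^bsub>?L\<^esub> X = fraction R I \<zero> (s \<otimes> s)"
        unfolding X using aR s by (simp add: localization_add)
      also have "\<dots> = \<zero>\<^bsub>?L\<^esub>"
        unfolding localization_zero using s compl_mult[OF s s] compl_one
        by (intro fraction_cong[OF _ _ _ _ compl_one]) simp_all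
      finally have "fraction R I (\<ominus> a) s \<oplus>\<^bsub>?L\<^esub> X = \<zero>\<^bsub>?L\<^esub>" .
      moreover have c: "\<ominus> a \<in> I" using a by simp
      ultimately have "\<ominus>\<^bsub>?L\<^esub> X = fraction R I (\<ominus> a) s"
        using L.minus_equality sub s \<open>X \<in> ?M\<close> by blast
      then show "\<ominus>\<^bsub>?L\<^esub> X \<in> ?M" using c s by auto
    next
      fix X Y assume "X \<in> ?M" "Y \<in> ?M"
      then obtain a s b t where cl: "a \<in> I" "s \<in> carrier R - I" "b \<in> I" "t \<in> carrier R - I"
        and X: "X = fraction R I a s" "Y = fraction R I b t" by blast
      have "a \<otimes> t \<oplus> b \<otimes> s \<in> I" using cl
        by (intro additive_subgroup.a_closed[OF is_additive_subgroup] I_r_closed) auto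
      then show "X \<oplus>\<^bsub>?L\<^esub> Y \<in> ?M"
        unfolding X localization_add[OF Icarr[OF cl(1)] cl(2) Icarr[OF cl(3)] cl(4)]
        using compl_mult[OF cl(2,4)] by blast
    qed
    fix X Y assume "X \<in> ?M" "Y \<in> carrier ?L"
    then obtain a s b t where cl: "a \<in> I" "s \<in> carrier R - I" "b \<in> carrier R" "t \<in> carrier R - I"
      and X: "X = fraction R I a s" "Y = fraction R I b t" unfolding localization_carrier by blast
    have "b \<otimes> a \<in> I" using cl by (intro I_l_closed)
    then show "Y \<otimes>\<^bsub>?L\<^esub> X \<in> ?M"
      unfolding X localization_mult[OF cl(3,4) Icarr[OF cl(1)] cl(2)]
      using compl_mult[OF cl(4,2)] by blast
    then show "X \<otimes>\<^bsub>?L\<^esub> Y \<in> ?M"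
      using L.m_comm[OF subsetD[OF sub \<open>X \<in> ?M\<close>] \<open>Y \<in> carrier ?L\<close>] by simp
  qed
  have one: "\<one>\<^bsub>?L\<^esub> \<notin> ?M" unfolding localization_one using mem compl_one by blast
  have "maximalideal ?M ?L"
  proof (rule maximalidealI[OF idl])
    show "carrier ?L \<noteq> ?M" using one L.one_closed by metis
    show "J = ?M \<or> J = carrier ?L" if "ideal J ?L" "?M \<subseteq> J" "J \<subseteq> carrier ?L" for J
    proof (cases "J \<subseteq> ?M")
      case True
      then show ?thesis using that(2) by (intro disjI1 subset_antisym)
    next
      case False
      then obtain X where "X \<in> J" "X \<notin> ?M" by (meson subsetI)
      then show ?thesis by (intro disjI2 inv[OF that(1)])
    qed
  qed
  then have "?M \<in> {J. maximalideal J ?L}" by (rule CollectI)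
  moreover have "J = ?M" if "J \<in> {J. maximalideal J ?L}" for J
  proof -
    interpret J: maximalideal J ?L using that by (rule CollectD)
    have JM: "J \<subseteq> ?M"
    proof
      fix X assume "X \<in> J"
      show "X \<in> ?M"
      proof (rule ccontr)
        assume "X \<notin> ?M"
        from inv[OF J.is_ideal \<open>X \<in> J\<close> this] J.I_notcarr show False by simp
      qed
    qed
    have "?M \<noteq> carrier ?L" using one L.one_closed by metis
    with J.I_maximal[OF idl JM sub] show ?thesis by argo
  qed
  ultimately have "{J. maximalideal J ?L} = {?M}"
    by (rule eq_singletonI)
  then show ?thesis unfolding local_ring_def using L.cring_axioms by (intro conjI)
qed

end

end

theory Submission
  imports Defs
begin

text \<open>Regularity is expressed modulo an ideal instead of in a quotient ring: \<open>x\<close> is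
regular modulo \<open>I\<close> if \<open>x y \<in> I\<close> forces \<open>y \<in> I\<close>, and a regular sequence is a list whose entries are
regular modulo the successively enlarged ideals.

Everything rests on one fact about a noetherian local ring \<open>(R, M)\<close>, in the spirit of Hartshorne's
connectedness theorem (\<open>prime_chain_in_separating_set\<close>): if \<open>D(C)\<close> is the disjoint union of two
nonempty open sets \<open>D(A)\<close> and \<open>D(B)\<close>, and \<open>M\<close> contains a regular sequence of length \<open>n\<close>, then \<open>V(C)\<close>
contains a strict chain of \<open>n\<close> primes. There are two reasons.

First, the ideal of \<open>C\<close> cannot contain a regular sequence \<open>x, y\<close>. Otherwise suitable powers decompose
as \<open>X = a + b\<close> and \<open>Y = a' + b'\<close> with \<open>a, a'\<close> in the ideal of \<open>A\<close>, with \<open>b, b'\<close> in the ideal of \<open>B\<close>, and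
with all mixed products zero. Then \<open>Y a = a a' = X a'\<close>, so \<open>a = X r\<close>, and \<open>r\<close> is idempotent. As \<open>R\<close> is
local, \<open>r\<close> is \<open>0\<close> or \<open>1\<close>, so a power of \<open>x\<close> lies on one side. Since \<open>x\<close> is not a zero divisor, the open
set belonging to the other side is then empty.

Second, the ideal of \<open>C\<close> therefore annihilates a nonzero element of \<open>R\<close> or of \<open>R/x\<close>. By the exchange
lemma \<open>regular_seq_exchange\<close> the ring \<open>R/x\<close> still admits a regular sequence of length \<open>n - 1\<close>, and
\<open>prime_chain_over_annihilator\<close> turns a regular sequence of length \<open>m\<close> into a chain of \<open>m + 1\<close> primes
above any set that annihilates a nonzero element.

The inequality between connectivity dimension and depth follows directly
(\<open>connectivity_dim_ge_depth\<close>). For the sequences of minimal primes, suppose that some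
minimal prime of a local ring cannot be reached from \<open>p\<close> along pairs \<open>q, q'\<close> for which \<open>V(q + q')\<close>
contains a chain of \<open>n\<close> primes. The reachable minimal primes and the others cut out closed sets
that separate the spectrum, and the chain provided by the basic fact lies above one prime of
each kind, a contradiction (\<open>minimal_primes_linked\<close>). Applied to \<open>R\<^sub>P\<close>, whose depth Serre's condition
controls, this gives the required sequences.

For connectedness in codimension one, divide the minimal primes into two nonempty classes. A prime
\<open>Q\<close> minimal among those containing primes of both classes has height one: if its height were at
least two, a sequence inside \<open>Q\<close> would cross from one class to the other with a prime strictly below
\<open>Q\<close> above both (\<open>codim_one_crossing\<close>). Two minimal primes below a common prime of height one have
the same dimension because \<open>R\<close> is catenary, so all of them do (\<open>equidimensional\<close>). If a
closed set disconnects the spectrum, it either contains a minimal prime, or it contains such a \<open>Q\<close>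
for the classes given by the two pieces. Its dimension is at least \<open>dim R - 1\<close> in both cases.\<close>

section \<open>Ideals, colon ideals and regular sequences modulo an ideal\<close>

context cring
begin

lemma ideal_add: "ideal I R \<Longrightarrow> a \<in> I \<Longrightarrow> b \<in> I \<Longrightarrow> a \<oplus> b \<in> I"
  by (simp add: additive_subgroup.a_closed ideal.axioms(1))

lemma ideal_neg: "ideal I R \<Longrightarrow> a \<in> I \<Longrightarrow> \<ominus> a \<in> I"
  by (simp add: additive_subgroup.a_inv_closed ideal.axioms(1))

lemma ideal_diff: "ideal I R \<Longrightarrow> a \<in> I \<Longrightarrow> b \<in> I \<Longrightarrow> a \<ominus> b \<in> I"
  unfolding a_minus_def by (intro ideal_add ideal_neg)

lemma ideal_zero: "ideal I R \<Longrightarrow> \<zero> \<in> I"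
  by (simp add: additive_subgroup.zero_closed ideal.axioms(1))

lemma ideal_subset: "ideal I R \<Longrightarrow> I \<subseteq> carrier R"
  by (rule subsetI, rule ideal.Icarr)

lemma idealI_comm:
  assumes "I \<subseteq> carrier R" "\<zero> \<in> I" "\<And>a b. a \<in> I \<Longrightarrow> b \<in> I \<Longrightarrow> a \<oplus> b \<in> I"
    and l: "\<And>r a. r \<in> carrier R \<Longrightarrow> a \<in> I \<Longrightarrow> r \<otimes> a \<in> I"
  shows "ideal I R"
proof (rule idealI)
  have neg: "\<ominus> a \<in> I" if "a \<in> I" for a
    using l[of "\<ominus> \<one>" a] that assms(1) l_minus[of \<one> a] by auto
  show "subgroup I (add_monoid R)"
    by (rule add.subgroupI) (use assms neg in auto)
  show "r \<otimes> a \<in> I" "a \<otimes> r \<in> I" if "a \<in> I" "r \<in> carrier R" for a r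
    using l[OF that(2,1)] m_comm[of a r] that assms(1) by auto
qed (rule ring_axioms)

lemma prime_spec_iff: "P \<in> prime_spec R \<longleftrightarrow> primeideal P R"
  by (simp add: prime_spec_def)

lemma prime_ideal: "P \<in> prime_spec R \<Longrightarrow> ideal P R"
  by (simp add: prime_spec_def primeideal.axioms(1))

lemma prime_subset: "P \<in> prime_spec R \<Longrightarrow> P \<subseteq> carrier R"
  by (rule ideal_subset[OF prime_ideal])

lemma prime_mult_iff:
  "P \<in> prime_spec R \<Longrightarrow> a \<in> carrier R \<Longrightarrow> b \<in> carrier R \<Longrightarrow> a \<otimes> b \<in> P \<longleftrightarrow> a \<in> P \<or> b \<in> P"
  by (simp add: prime_spec_def primeideal.mult_mem_iff)

lemma prime_one: "P \<in> prime_spec R \<Longrightarrow> \<one> \<notin> P"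
  using primeideal.compl_one[of P R] by (auto simp: prime_spec_def)

lemma prime_pow: "P \<in> prime_spec R \<Longrightarrow> a \<in> carrier R \<Longrightarrow> a [^] (n::nat) \<in> P \<Longrightarrow> a \<in> P"
  by (induction n) (auto simp: prime_one prime_mult_iff)

lemma Idl_subset_prime:
  "P \<in> prime_spec R \<Longrightarrow> S \<subseteq> carrier R \<Longrightarrow> Idl S \<subseteq> P \<longleftrightarrow> S \<subseteq> P"
  by (rule Idl_subset_ideal[OF prime_ideal])

definition adjoin :: "'a set \<Rightarrow> 'a \<Rightarrow> 'a set" where
  "adjoin I x = {i \<oplus> r \<otimes> x | i r. i \<in> I \<and> r \<in> carrier R}"

definition colon :: "'a set \<Rightarrow> 'a \<Rightarrow> 'a set" where
  "colon I u = {r \<in> carrier R. r \<otimes> u \<in> I}"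

definition regular_mod :: "'a set \<Rightarrow> 'a \<Rightarrow> bool" where
  "regular_mod I x \<longleftrightarrow> x \<in> carrier R \<and> (\<forall>y \<in> carrier R. x \<otimes> y \<in> I \<longrightarrow> y \<in> I)"

primrec regular_seq_mod :: "'a set \<Rightarrow> 'a list \<Rightarrow> bool" where
  "regular_seq_mod I [] \<longleftrightarrow> True"
| "regular_seq_mod I (x # xs) \<longleftrightarrow> regular_mod I x \<and> regular_seq_mod (adjoin I x) xs"

lemma regular_modD: "regular_mod I x \<Longrightarrow> y \<in> carrier R \<Longrightarrow> x \<otimes> y \<in> I \<Longrightarrow> y \<in> I"
  by (simp add: regular_mod_def)

lemma regular_mod_carrier: "regular_mod I x \<Longrightarrow> x \<in> carrier R"
  by (simp add: regular_mod_def)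

lemma adjoin_eq: "adjoin I x = I <+> PIdl x"
  unfolding adjoin_def cgenideal_def set_add_def' by blast

lemma ideal_adjoin: "ideal I R \<Longrightarrow> x \<in> carrier R \<Longrightarrow> ideal (adjoin I x) R"
  unfolding adjoin_eq by (intro add_ideals cgenideal_ideal)

lemma adjoinI: "i \<in> I \<Longrightarrow> r \<in> carrier R \<Longrightarrow> i \<oplus> r \<otimes> x \<in> adjoin I x"
  unfolding adjoin_def by blast

lemma adjoinE:
  assumes "y \<in> adjoin I x" obtains i r where "i \<in> I" "r \<in> carrier R" "y = i \<oplus> r \<otimes> x"
  using assms unfolding adjoin_def by blast

lemma subset_adjoin: "ideal I R \<Longrightarrow> x \<in> carrier R \<Longrightarrow> I \<subseteq> adjoin I x"
  using adjoinI[of _ I \<zero> x] ideal_subset[of I] by (auto simp: subset_iff)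

lemma mem_adjoin: "ideal I R \<Longrightarrow> x \<in> carrier R \<Longrightarrow> x \<in> adjoin I x"
  using adjoinI[of \<zero> I \<one> x] ideal_zero[of I] by auto

lemma mult_mem_adjoin: "ideal I R \<Longrightarrow> x \<in> carrier R \<Longrightarrow> r \<in> carrier R \<Longrightarrow> r \<otimes> x \<in> adjoin I x"
  using adjoinI[of \<zero> I r x] ideal_zero[of I] by auto

lemma adjoin_minimal:
  assumes "ideal J R" "I \<subseteq> J" "x \<in> J" shows "adjoin I x \<subseteq> J"
  using assms by (auto elim!: adjoinE intro!: ideal_add ideal.I_l_closed)

lemma adjoin_commute:
  assumes I: "ideal I R" and x: "x \<in> carrier R" and z: "z \<in> carrier R"
  shows "adjoin (adjoin I x) z = adjoin (adjoin I z) x"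
proof -
  have "adjoin (adjoin I x) z \<subseteq> adjoin (adjoin I z) x" if x: "x \<in> carrier R" and z: "z \<in> carrier R" for x z
  proof (intro adjoin_minimal ideal_adjoin[OF ideal_adjoin[OF I z] x])
    have "I \<subseteq> adjoin (adjoin I z) x" "z \<in> adjoin (adjoin I z) x"
      using subset_adjoin[OF ideal_adjoin[OF I z] x] subset_adjoin[OF I z] mem_adjoin[OF I z] by auto
    then show "I \<subseteq> adjoin (adjoin I z) x" "z \<in> adjoin (adjoin I z) x" .
    show "x \<in> adjoin (adjoin I z) x" by (intro mem_adjoin ideal_adjoin I x z)
  qed
  from this[OF x z] this[OF z x] show ?thesis by blast
qed

lemma Idl_insert:
  assumes "S \<subseteq> carrier R" "x \<in> carrier R"
  shows "Idl (insert x S) = adjoin (Idl S) x"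
proof
  have S: "ideal (Idl S) R" using assms(1) by (rule genideal_ideal)
  have "insert x S \<subseteq> adjoin (Idl S) x"
    using genideal_self[OF assms(1)] subset_adjoin[OF S assms(2)] mem_adjoin[OF S assms(2)] by auto
  then show "Idl (insert x S) \<subseteq> adjoin (Idl S) x"
    by (intro genideal_minimal ideal_adjoin S assms)
  show "adjoin (Idl S) x \<subseteq> Idl (insert x S)"
    using assms genideal_self[of "insert x S"]
    by (intro adjoin_minimal genideal_ideal subset_Idl_subset) auto
qed

lemma ideal_colon:
  assumes I: "ideal I R" and u: "u \<in> carrier R"
  shows "ideal (colon I u) R"
  by (rule idealI_comm)
    (use I u in \<open>auto simp: colon_def l_distr m_assoc intro: ideal_zero ideal_add ideal.I_l_closed\<close>)

lemma colon_iff: "r \<in> colon I u \<longleftrightarrow> r \<in> carrier R \<and> r \<otimes> u \<in> I"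
  by (simp add: colon_def)

lemma colon_commute:
  "r \<in> carrier R \<Longrightarrow> u \<in> carrier R \<Longrightarrow> r \<in> colon I u \<longleftrightarrow> u \<in> colon I r"
  by (simp add: colon_def m_comm)

lemma subset_colon: "ideal I R \<Longrightarrow> u \<in> carrier R \<Longrightarrow> I \<subseteq> colon I u"
  using ideal_subset ideal.I_r_closed by (fastforce simp: colon_def)

lemma one_in_colon: "u \<in> carrier R \<Longrightarrow> \<one> \<in> colon I u \<longleftrightarrow> u \<in> I"
  by (simp add: colon_def)

text \<open>If \<open>x t = i + s z\<close>, then \<open>s\<close> is a multiple of \<open>x\<close> modulo \<open>I\<close>, since \<open>z\<close> is regular there; cancelling
\<open>x\<close> shows that \<open>t\<close> is a multiple of \<open>z\<close> modulo \<open>I\<close>. This is what allows a common element to be moved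
to the front of two regular sequences.\<close>

lemma regular_mod_swap:
  assumes I: "ideal I R" and x: "regular_mod I x" and z: "regular_mod I z"
    and zx: "regular_mod (adjoin I x) z"
  shows "regular_mod (adjoin I z) x"
  unfolding regular_mod_def
proof (intro conjI ballI impI)
  note xc = regular_mod_carrier[OF x] and zc = regular_mod_carrier[OF z]
  show "x \<in> carrier R" by (fact xc)
  fix t assume t: "t \<in> carrier R" "x \<otimes> t \<in> adjoin I z"
  from t(2) obtain i s where i: "i \<in> I" and s: "s \<in> carrier R" and xt: "x \<otimes> t = i \<oplus> s \<otimes> z"
    by (rule adjoinE)
  note ic = ideal.Icarr[OF I i]
  have "z \<otimes> s = \<ominus> i \<oplus> t \<otimes> x"
    using xt xc zc s ic t(1) by (simp add: m_comm[of t x] m_comm[of z s] a_assoc[symmetric] l_neg)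
  then have "z \<otimes> s \<in> adjoin I x" using adjoinI[OF ideal_neg[OF I i] t(1)] by simp
  then have "s \<in> adjoin I x" by (rule regular_modD[OF zx s])
  then obtain j w where j: "j \<in> I" and w: "w \<in> carrier R" and sw: "s = j \<oplus> w \<otimes> x" by (rule adjoinE)
  note jc = ideal.Icarr[OF I j]
  have "x \<otimes> (t \<ominus> w \<otimes> z) = (i \<oplus> s \<otimes> z) \<ominus> x \<otimes> (w \<otimes> z)"
    using xc zc w t(1) xt by (simp add: a_minus_def r_distr r_minus)
  also have "\<dots> = i \<oplus> j \<otimes> z"
  proof -
    have e: "x \<otimes> (w \<otimes> z) = w \<otimes> x \<otimes> z" using xc zc w by (simp add: m_ac)
    show ?thesis unfolding sw e using ic jc xc zc w
      by (simp add: l_distr a_minus_def a_assoc r_neg)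
  qed
  also have "\<dots> \<in> I" by (intro ideal_add I i ideal.I_r_closed j zc)
  finally have "t \<ominus> w \<otimes> z \<in> I"
      by (rule regular_modD[OF x, rotated]) (use x t(1) w zc in simp)
  moreover have "t = (t \<ominus> w \<otimes> z) \<oplus> w \<otimes> z"
    using t(1) w zc by (simp add: a_minus_def a_assoc l_neg)
  ultimately show "t \<in> adjoin I z" using adjoinI w by metis
qed

text \<open>Whether \<open>J\<close> annihilates a nonzero element modulo \<open>I + (x)\<close> does not depend on the element \<open>x\<close> of \<open>J\<close>
regular modulo \<open>I\<close>. The witness is found by writing \<open>y u = i + v x\<close>: the roles of \<open>x, u\<close> and \<open>y, v\<close> in
this equation are symmetric.\<close>

lemma socle_exchange:
  assumes I: "ideal I R" and x: "regular_mod I x" and y: "regular_mod I y" and yJ: "y \<in> J" and J: "J \<subseteq> carrier R"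
    and u: "u \<in> carrier R" "u \<notin> adjoin I x" "J \<subseteq> colon (adjoin I x) u"
  shows "\<exists>v \<in> carrier R. v \<notin> adjoin I y \<and> J \<subseteq> colon (adjoin I y) v"
proof -
  note xc = regular_mod_carrier[OF x] and yc = regular_mod_carrier[OF y]
  have "y \<otimes> u \<in> adjoin I x" using yJ u by (auto simp: colon_iff)
  then obtain i v where i: "i \<in> I" and v: "v \<in> carrier R" and yu: "y \<otimes> u = i \<oplus> v \<otimes> x" by (rule adjoinE)
  note ic = ideal.Icarr[OF I i]
  have "v \<notin> adjoin I y"
  proof
    assume "v \<in> adjoin I y"
    then obtain j w where j: "j \<in> I" and w: "w \<in> carrier R" and vw: "v = j \<oplus> w \<otimes> y" by (rule adjoinE)
    note jc = ideal.Icarr[OF I j]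
    have e: "w \<otimes> y \<otimes> x = y \<otimes> (w \<otimes> x)" using w xc yc by (simp add: m_ac)
    have "y \<otimes> (u \<ominus> w \<otimes> x) = (i \<oplus> v \<otimes> x) \<ominus> y \<otimes> (w \<otimes> x)"
      using xc yc w u(1) yu by (simp add: a_minus_def r_distr r_minus)
    also have "\<dots> = i \<oplus> j \<otimes> x"
      unfolding vw using ic jc xc yc w e by (simp add: l_distr a_minus_def a_assoc r_neg)
    also have "\<dots> \<in> I" by (intro ideal_add I i ideal.I_r_closed j xc)
    finally have "u \<ominus> w \<otimes> x \<in> I"
      by (rule regular_modD[OF y, rotated]) (use u(1) w xc in simp)
    moreover have "u = (u \<ominus> w \<otimes> x) \<oplus> w \<otimes> x"
      using u(1) w xc by (simp add: a_minus_def a_assoc l_neg)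
    ultimately have "u \<in> adjoin I x" using adjoinI w by metis
    with u(2) show False ..
  qed
  moreover have "r \<in> colon (adjoin I y) v" if "r \<in> J" for r
  proof -
    have rc: "r \<in> carrier R" using that J by blast
    have "r \<otimes> u \<in> adjoin I x" using that u by (auto simp: colon_iff)
    then obtain j t where j: "j \<in> I" and t: "t \<in> carrier R" and ru: "r \<otimes> u = j \<oplus> t \<otimes> x" by (rule adjoinE)
    note jc = ideal.Icarr[OF I j]
    have 1: "r \<otimes> (y \<otimes> u) = y \<otimes> (r \<otimes> u)" using rc yc u(1) by (simp add: m_ac)
    have 2: "r \<otimes> (v \<otimes> x) = x \<otimes> (r \<otimes> v)" "y \<otimes> (t \<otimes> x) = x \<otimes> (t \<otimes> y)"
      using rc yc xc v t by (simp_all add: m_ac)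
    have 3: "r \<otimes> i \<oplus> x \<otimes> (r \<otimes> v) = y \<otimes> j \<oplus> x \<otimes> (t \<otimes> y)"
      using 1 unfolding yu ru using rc ic v xc yc jc t by (simp add: r_distr 2)
    have "x \<otimes> (r \<otimes> v \<ominus> t \<otimes> y) = x \<otimes> (r \<otimes> v) \<ominus> x \<otimes> (t \<otimes> y)"
      using rc v xc yc t by (simp add: a_minus_def r_distr r_minus)
    also have "x \<otimes> (r \<otimes> v) = \<ominus> (r \<otimes> i) \<oplus> (y \<otimes> j \<oplus> x \<otimes> (t \<otimes> y))"
      unfolding 3[symmetric] using rc v xc ic by (simp add: a_assoc[symmetric] l_neg)
    also have "\<dots> \<ominus> x \<otimes> (t \<otimes> y) = \<ominus> (r \<otimes> i) \<oplus> y \<otimes> j"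
      using rc ic yc jc xc t by (simp add: a_minus_def a_assoc r_neg)
    also have "\<dots> \<in> I" by (intro ideal_add ideal_neg ideal.I_l_closed I i j rc yc)
    finally have "r \<otimes> v \<ominus> t \<otimes> y \<in> I"
      by (rule regular_modD[OF x, rotated]) (use rc v t yc in simp)
    moreover have "r \<otimes> v = (r \<otimes> v \<ominus> t \<otimes> y) \<oplus> t \<otimes> y"
      using rc v t yc by (simp add: a_minus_def a_assoc l_neg)
    ultimately have "r \<otimes> v \<in> adjoin I y" using adjoinI t by metis
    then show ?thesis using rc by (simp add: colon_iff)
  qed
  ultimately show ?thesis using v by blast
qed

end

section \<open>Prime ideals of noetherian rings\<close>

text \<open>This is what makes an ideal prime when it is maximal among those avoiding the powers of an element.\<close>

lemma (in cring) mult_mem_of_adjoin: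
  assumes I: "ideal I R" and a: "a \<in> carrier R" and b: "b \<in> carrier R" and ab: "a \<otimes> b \<in> I"
    and y: "y \<in> adjoin I a" and z: "z \<in> adjoin I b"
  shows "y \<otimes> z \<in> I"
proof -
  have zc: "z \<in> carrier R" using ideal.Icarr[OF ideal_adjoin[OF I b] z] .
  have "adjoin I b \<subseteq> colon I a"
    using a b ab by (intro adjoin_minimal ideal_colon subset_colon I) (simp_all add: colon_iff m_comm)
  then have "a \<in> colon I z" using z zc a by (auto simp: colon_commute)
  then have "adjoin I a \<subseteq> colon I z" using zc by (intro adjoin_minimal ideal_colon subset_colon I)
  then show ?thesis using y by (auto simp: colon_iff)
qed

lemma (in cring) prime_contains_factor:
  assumes P: "P \<in> prime_spec R" and "finite T" and J: "\<And>t. t \<in> T \<Longrightarrow> ideal (J t) R"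
    and sub: "{r \<in> carrier R. \<forall>t\<in>T. r \<in> J t} \<subseteq> P"
  shows "\<exists>t\<in>T. J t \<subseteq> P"
proof (rule ccontr)
  assume n: "\<not> ?thesis"
  have "\<exists>r \<in> carrier R. (\<forall>t\<in>T. r \<in> J t) \<and> r \<notin> P"
    using \<open>finite T\<close> J n
  proof (induction T rule: finite_induct)
    case empty
    then show ?case using prime_one[OF P] by auto
  next
    case (insert t T)
    then obtain r where r: "r \<in> carrier R" "\<forall>t\<in>T. r \<in> J t" "r \<notin> P" by auto
    obtain s where s: "s \<in> J t" "s \<notin> P" using insert.prems(2) by auto
    have sc: "s \<in> carrier R" using ideal.Icarr[OF insert.prems(1) s(1)] by simp
    have "r \<otimes> s \<in> J t'" if "t' \<in> insert t T" for t'
      using that r s sc insert.prems(1)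
      by (auto intro: ideal.I_l_closed ideal.I_r_closed)
    moreover have "r \<otimes> s \<notin> P" using prime_mult_iff[OF P r(1) sc] r s by simp
    ultimately show ?case using r(1) sc by (intro bexI[of _ "r \<otimes> s"]) auto
  qed
  then show False using sub by auto
qed

text \<open>Induction on the number of primes. Of two comparable primes the smaller one can be dropped. In an
antichain, an element avoiding all primes but \<open>P\<close> is corrected by an element of \<open>J\<close> and of all the
other primes that lies outside \<open>P\<close>.\<close>

lemma (in cring) prime_avoidance:
  assumes "finite F" "F \<subseteq> prime_spec R" and J: "ideal J R" and n: "\<And>P. P \<in> F \<Longrightarrow> \<not> J \<subseteq> P"
  shows "\<exists>x\<in>J. \<forall>P\<in>F. x \<notin> P"
  using assms(1,2) n
proof (induction F rule: finite_psubset_induct)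
  case (psubset F)
  show ?case
  proof (cases "\<exists>P\<in>F. \<exists>Q\<in>F. Q \<subset> P")
    case True
    then obtain P Q where PQ: "P \<in> F" "Q \<in> F" "Q \<subset> P" by blast
    have "\<exists>x\<in>J. \<forall>P\<in>F - {Q}. x \<notin> P"
      using PQ(2) psubset.prems by (intro psubset.IH) auto
    then obtain x where "x \<in> J" "\<forall>P\<in>F - {Q}. x \<notin> P" by blast
    then show ?thesis using PQ by (intro bexI[of _ x]) blast+
  next
    case anti: False
    show ?thesis
    proof (cases "F = {}")
      case True
      then show ?thesis using ideal_zero[OF J] by auto
    next
      case False
      then obtain P where P: "P \<in> F" by blast
      have "\<exists>x\<in>J. \<forall>Q\<in>F - {P}. x \<notin> Q"
        using P psubset.prems by (intro psubset.IH) auto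
      then obtain x where x: "x \<in> J" "\<And>Q. Q \<in> F - {P} \<Longrightarrow> x \<notin> Q" by blast
      have xc: "x \<in> carrier R" using ideal.Icarr[OF J x(1)] .
      show ?thesis
      proof (cases "x \<in> P")
        case False
        then show ?thesis using x by (intro bexI[of _ x]) auto
      next
        case True
        have PS: "P \<in> prime_spec R" and FS: "\<And>Q. Q \<in> F \<Longrightarrow> Q \<in> prime_spec R"
          using P psubset.prems(1) by auto
        have "\<not> {r \<in> carrier R. \<forall>t\<in>insert J (F - {P}). r \<in> t} \<subseteq> P"
        proof
          assume "{r \<in> carrier R. \<forall>t\<in>insert J (F - {P}). r \<in> t} \<subseteq> P"
          then have "\<exists>t\<in>insert J (F - {P}). t \<subseteq> P"
            using psubset.hyps FS J by (intro prime_contains_factor[OF PS]) (auto intro: prime_ideal)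
          then show False using psubset.prems(2)[OF P] anti P by blast
        qed
        then obtain y where y: "y \<in> J" "\<And>Q. Q \<in> F - {P} \<Longrightarrow> y \<in> Q" "y \<notin> P" and yc: "y \<in> carrier R"
          by auto
        have "x \<oplus> y \<notin> Q" if Q: "Q \<in> F" for Q
        proof
          assume xy: "x \<oplus> y \<in> Q"
          show False
          proof (cases "Q = P")
            case True
            have "(x \<oplus> y) \<ominus> x \<in> P" using xy True \<open>x \<in> P\<close> by (intro ideal_diff prime_ideal PS) auto
            moreover have "(x \<oplus> y) \<ominus> x = y" using xc yc by (simp add: a_minus_def a_comm[of x y] a_assoc r_neg)
            ultimately show False using y(3) by simp
          next
            case False
            have "(x \<oplus> y) \<ominus> y \<in> Q" using xy False Q y(2) by (intro ideal_diff prime_ideal FS) auto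
            moreover have "(x \<oplus> y) \<ominus> y = x" using xc yc by (simp add: a_minus_def a_assoc r_neg)
            ultimately show False using x(2) Q False by auto
          qed
        qed
        then show ?thesis using ideal_add[OF J x(1) y(1)] by blast
      qed
    qed
  qed
qed

locale noetherian_cring = noetherian_ring R + cring R for R (structure)
begin

lemma maximal_in_family:
  assumes "\<A> \<noteq> {}" and id: "\<And>I. I \<in> \<A> \<Longrightarrow> ideal I R"
  obtains I where "I \<in> \<A>" "\<forall>J\<in>\<A>. I \<subseteq> J \<longrightarrow> J = I"
proof -
  have "\<exists>I\<in>\<A>. \<forall>J\<in>\<A>. I \<subseteq> J \<longrightarrow> J = I"
  proof (rule subset_Zorn_nonempty[OF assms(1)])
    fix \<C> assume C: "\<C> \<noteq> {}" "subset.chain \<A> \<C>"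
    have sub: "\<A> \<subseteq> {I. ideal I R}" using id by (intro subsetI CollectI)
    have CA: "\<C> \<subseteq> \<A>" using C(2) unfolding pred_on.chain_def by (rule conjunct1)
    have "subset.chain {I. ideal I R} \<C>"
      using C(2) subset_trans[OF CA sub] unfolding pred_on.chain_def by argo
    from ideal_chain_is_trivial[OF C(1) this] show "\<Union>\<C> \<in> \<A>" by (rule subsetD[OF CA])
  qed
  then show thesis using that by blast
qed

text \<open>The intersection of the primes above an ideal is its radical: an ideal maximal among those that
avoid all powers of \<open>x\<close> is prime.\<close>

lemma power_mem_Idl:
  assumes x: "x \<in> carrier R" and S: "S \<subseteq> carrier R"
    and V: "\<And>P. P \<in> prime_spec R \<Longrightarrow> S \<subseteq> P \<Longrightarrow> x \<in> P"
  shows "\<exists>n::nat. x [^] n \<in> Idl S"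
proof (rule ccontr)
  assume n: "\<not> ?thesis"
  define \<A> where "\<A> = {I. ideal I R \<and> S \<subseteq> I \<and> (\<forall>n::nat. x [^] n \<notin> I)}"
  have "Idl S \<in> \<A>" using n genideal_ideal[OF S] genideal_self[OF S] by (auto simp: \<A>_def)
  then have ne: "\<A> \<noteq> {}" by blast
  have id: "ideal I R" if "I \<in> \<A>" for I using that by (simp add: \<A>_def)
  obtain P where P: "P \<in> \<A>" and max': "\<forall>J\<in>\<A>. P \<subseteq> J \<longrightarrow> J = P"
    by (rule maximal_in_family[OF ne id])
  note max = max'[rule_format]
  from P have PI: "ideal P R" and SP: "S \<subseteq> P" and xP: "\<And>n::nat. x [^] n \<notin> P" by (auto simp: \<A>_def)
  have step: "\<exists>n::nat. x [^] n \<in> adjoin P a" if a: "a \<in> carrier R" "a \<notin> P" for a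
  proof (rule ccontr)
    assume "\<not> ?thesis"
    then have "adjoin P a \<in> \<A>" using ideal_adjoin[OF PI a(1)] subset_adjoin[OF PI a(1)] SP by (auto simp: \<A>_def)
    from max[OF this subset_adjoin[OF PI a(1)]] mem_adjoin[OF PI a(1)] a(2) show False by simp
  qed
  have "primeideal P R"
  proof (rule primeidealI[OF PI])
    show "cring R" by (rule is_cring)
    show "carrier R \<noteq> P" using xP[of 0] by auto
    show "a \<in> P \<or> b \<in> P" if ab: "a \<in> carrier R" "b \<in> carrier R" "a \<otimes> b \<in> P" for a b
    proof (rule ccontr)
      assume "\<not> ?thesis"
      then obtain m n :: nat where "x [^] m \<in> adjoin P a" "x [^] n \<in> adjoin P b" using step ab by metis
      then have "x [^] m \<otimes> x [^] n \<in> P" using mult_mem_of_adjoin[OF PI ab] by blast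
      then show False using xP[of "m + n"] x by (simp add: nat_pow_mult)
    qed
  qed
  then have "x \<in> P" using V SP by (simp add: prime_spec_iff)
  then show False using xP[of 1] x by simp
qed

corollary nilpotent_if_in_all_primes:
  assumes "x \<in> carrier R" "\<And>P. P \<in> prime_spec R \<Longrightarrow> x \<in> P"
  shows "\<exists>n::nat. x [^] n = \<zero>"
proof -
  have "Idl {} = {\<zero>}"
    using genideal_minimal[OF zeroideal, of "{}"] ideal_zero[OF genideal_ideal[of "{}"]] by auto
  then show ?thesis using power_mem_Idl[OF assms(1), of "{}"] assms(2) by auto
qed

text \<open>Noetherian induction. For a maximal counterexample \<open>J\<close>, which is proper and not prime, pick
\<open>a b \<in> J\<close> with \<open>a, b \<notin> J\<close>; every prime above \<open>J\<close> lies above \<open>J + (a)\<close> or \<open>J + (b)\<close>.\<close>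

lemma finite_primes_over:
  assumes "ideal I R"
  shows "\<exists>F. finite F \<and> F \<subseteq> prime_spec R \<and> (\<forall>P\<in>F. I \<subseteq> P) \<and>
    (\<forall>Q\<in>prime_spec R. I \<subseteq> Q \<longrightarrow> (\<exists>P\<in>F. P \<subseteq> Q))" (is "?ok I")
proof (rule ccontr)
  assume "\<not> ?ok I"
  then have ne: "{J. ideal J R \<and> \<not> ?ok J} \<noteq> {}" using assms by blast
  obtain J where J: "J \<in> {J. ideal J R \<and> \<not> ?ok J}"
    and max: "\<forall>K\<in>{J. ideal J R \<and> \<not> ?ok J}. J \<subseteq> K \<longrightarrow> K = J"
    by (rule maximal_in_family[OF ne]) simp_all
  then have J: "ideal J R" and bad: "\<not> ?ok J" by simp_all
  have "\<not> primeideal J R"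
  proof
    assume "primeideal J R"
    then have "?ok J" by (intro exI[of _ "{J}"]) (auto simp: prime_spec_iff)
    with bad show False by blast
  qed
  moreover have "carrier R \<noteq> J"
  proof
    assume "carrier R = J"
    then have "?ok J" using prime_one by (intro exI[of _ "{}"]) auto
    with bad show False by blast
  qed
  ultimately obtain a b where ab: "a \<in> carrier R" "b \<in> carrier R" "a \<otimes> b \<in> J" "a \<notin> J" "b \<notin> J"
    using ideal.primeidealCD[OF J is_cring] by blast
  have ok: "?ok (adjoin J c)" if "c \<in> carrier R" "c \<notin> J" for c
  proof (rule ccontr)
    assume "\<not> ?ok (adjoin J c)"
    then have "adjoin J c \<in> {J. ideal J R \<and> \<not> ?ok J}" using ideal_adjoin[OF J that(1)] by simp
    from max[rule_format, OF this subset_adjoin[OF J that(1)]] mem_adjoin[OF J that(1)] that(2) show False by simp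
  qed
  from ok[OF ab(1,4)] obtain F where
    F: "finite F" "F \<subseteq> prime_spec R" "\<forall>P\<in>F. adjoin J a \<subseteq> P"
      "\<forall>Q\<in>prime_spec R. adjoin J a \<subseteq> Q \<longrightarrow> (\<exists>P\<in>F. P \<subseteq> Q)" by blast
  from ok[OF ab(2,5)] obtain G where
    G: "finite G" "G \<subseteq> prime_spec R" "\<forall>P\<in>G. adjoin J b \<subseteq> P"
      "\<forall>Q\<in>prime_spec R. adjoin J b \<subseteq> Q \<longrightarrow> (\<exists>P\<in>G. P \<subseteq> Q)" by blast
  have "?ok J"
  proof (intro exI[of _ "F \<union> G"] conjI ballI impI)
    show "finite (F \<union> G)" "F \<union> G \<subseteq> prime_spec R" using F G by auto
    show "J \<subseteq> P" if "P \<in> F \<union> G" for P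
      using that F(3) G(3) subset_adjoin[OF J ab(1)] subset_adjoin[OF J ab(2)] by blast
    fix Q assume Q: "Q \<in> prime_spec R" "J \<subseteq> Q"
    then have "a \<in> Q \<or> b \<in> Q" using ab prime_mult_iff[OF Q(1)] by blast
    then show "\<exists>P\<in>F \<union> G. P \<subseteq> Q"
    proof
      assume "a \<in> Q"
      then have "adjoin J a \<subseteq> Q" using Q by (intro adjoin_minimal prime_ideal)
      then show ?thesis using F(4) Q(1) by blast
    next
      assume "b \<in> Q"
      then have "adjoin J b \<subseteq> Q" using Q by (intro adjoin_minimal prime_ideal)
      then show ?thesis using G(4) Q(1) by blast
    qed
  qed
  with bad show False by blast
qed

text \<open>Only finitely many primes have to be compared, by the previous lemma: those that lie at the bottom
of the zero set of one of the ideals.\<close>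

lemma minimal_prime_over_family:
  assumes fin: "finite \<I>" and id: "\<And>I. I \<in> \<I> \<Longrightarrow> ideal I R"
    and Q: "Q \<in> prime_spec R" "I \<in> \<I>" "I \<subseteq> Q"
  obtains P J where "P \<in> prime_spec R" "P \<subseteq> Q" "J \<in> \<I>" "J \<subseteq> P"
    "\<And>P' J. P' \<in> prime_spec R \<Longrightarrow> J \<in> \<I> \<Longrightarrow> J \<subseteq> P' \<Longrightarrow> P' \<subseteq> P \<Longrightarrow> P' = P"
proof -
  have "\<forall>I\<in>\<I>. \<exists>F. finite F \<and> F \<subseteq> prime_spec R \<and> (\<forall>P\<in>F. I \<subseteq> P) \<and>
    (\<forall>Q\<in>prime_spec R. I \<subseteq> Q \<longrightarrow> (\<exists>P\<in>F. P \<subseteq> Q))"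
    by (intro ballI finite_primes_over id)
  from bchoice[OF this] obtain F where F0: "\<forall>I\<in>\<I>. finite (F I) \<and> F I \<subseteq> prime_spec R \<and>
    (\<forall>P\<in>F I. I \<subseteq> P) \<and> (\<forall>Q\<in>prime_spec R. I \<subseteq> Q \<longrightarrow> (\<exists>P\<in>F I. P \<subseteq> Q))"
    by (rule exE)
  note F' = bspec[OF F0]
  have F: "\<And>I. I \<in> \<I> \<Longrightarrow> finite (F I)" "\<And>I. I \<in> \<I> \<Longrightarrow> F I \<subseteq> prime_spec R"
    "\<And>I P. I \<in> \<I> \<Longrightarrow> P \<in> F I \<Longrightarrow> I \<subseteq> P"
    "\<And>I Q. I \<in> \<I> \<Longrightarrow> Q \<in> prime_spec R \<Longrightarrow> I \<subseteq> Q \<Longrightarrow> \<exists>P\<in>F I. P \<subseteq> Q"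
    using F' by simp_all
  obtain P0 where P0: "P0 \<in> F I" "P0 \<subseteq> Q" using F(4) Q by blast
  have "finite (\<Union>I\<in>\<I>. F I)" using fin F(1) by blast
  moreover have "P0 \<in> (\<Union>I\<in>\<I>. F I)" using P0(1) Q(2) by blast
  ultimately have "\<exists>P\<in>(\<Union>I\<in>\<I>. F I). P \<subseteq> P0 \<and> (\<forall>P'\<in>(\<Union>I\<in>\<I>. F I). P' \<subseteq> P \<longrightarrow> P = P')"
    by (rule finite_has_minimal2)
  then obtain P where P: "P \<in> (\<Union>I\<in>\<I>. F I)" "P \<subseteq> P0"
    and Pmin: "\<forall>P'\<in>(\<Union>I\<in>\<I>. F I). P' \<subseteq> P \<longrightarrow> P = P'" by (elim bexE conjE)
  obtain J where J: "J \<in> \<I>" "P \<in> F J" using P(1) by blast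
  show thesis
  proof (rule that)
    show "P \<in> prime_spec R" "P \<subseteq> Q" using P F(2) P0(2) by blast+
    from J show "J \<in> \<I>" "J \<subseteq> P" using F(3) by blast+
    fix P' J assume a: "P' \<in> prime_spec R" "J \<in> \<I>" "J \<subseteq> P'" "P' \<subseteq> P"
    then obtain P'' where P'': "P'' \<in> F J" "P'' \<subseteq> P'" using F(4) by blast
    then have "P = P''" using Pmin a by (meson UN_I order_trans)
    then show "P' = P" using P'' a by blast
  qed
qed

lemma minimal_prime_prime: "minimal_prime R P \<Longrightarrow> P \<in> prime_spec R"
  by (simp add: minimal_prime_def)

lemma minimal_primeD: "minimal_prime R P \<Longrightarrow> Q \<in> prime_spec R \<Longrightarrow> Q \<subseteq> P \<Longrightarrow> Q = P"
  by (auto simp: minimal_prime_def)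

lemma minimal_prime_below:
  assumes "Q \<in> prime_spec R"
  obtains p where "minimal_prime R p" "p \<subseteq> Q"
proof (rule minimal_prime_over_family[of "{{\<zero>}}" Q "{\<zero>}"])
  show "\<And>I. I \<in> {{\<zero>}} \<Longrightarrow> ideal I R" by (simp add: zeroideal)
  show "{\<zero>} \<subseteq> Q" using ideal_zero[OF prime_ideal[OF assms]] by simp
  fix P J assume "P \<in> prime_spec R" "P \<subseteq> Q" and
    m: "\<And>P' J. P' \<in> prime_spec R \<Longrightarrow> J \<in> {{\<zero>}} \<Longrightarrow> J \<subseteq> P' \<Longrightarrow> P' \<subseteq> P \<Longrightarrow> P' = P"
  have min: "P' = P" if "P' \<in> prime_spec R" "P' \<subseteq> P" for P'
    using m[OF that(1), of "{\<zero>}"] that(2) ideal_zero[OF prime_ideal[OF that(1)]] by simp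
  have "minimal_prime R P" using \<open>P \<in> prime_spec R\<close> min by (auto simp: minimal_prime_def)
  then show thesis using \<open>P \<subseteq> Q\<close> by (rule that)
qed (use assms in auto)

lemma finite_minimal_primes: "finite {P. minimal_prime R P}"
proof -
  obtain F where F: "finite F" "F \<subseteq> prime_spec R" "\<forall>Q\<in>prime_spec R. {\<zero>} \<subseteq> Q \<longrightarrow> (\<exists>P\<in>F. P \<subseteq> Q)"
    using finite_primes_over[OF zeroideal] by blast
  have "P \<in> F" if mp: "minimal_prime R P" for P
  proof -
    have "{\<zero>} \<subseteq> P" using ideal_zero[OF prime_ideal[OF minimal_prime_prime[OF mp]]] by simp
    then obtain P' where P': "P' \<in> F" "P' \<subseteq> P" using F(3) minimal_prime_prime[OF mp] by blast
    then have "P' = P" using F(2) by (intro minimal_primeD[OF mp]) auto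
    then show "P \<in> F" using P'(1) by simp
  qed
  then have "{P. minimal_prime R P} \<subseteq> F" by (intro subsetI) simp
  then show ?thesis using F(1) by (rule finite_subset)
qed

end

section \<open>Zero divisors and the exchange of regular sequences\<close>

context noetherian_cring
begin

text \<open>The annihilator of \<open>b v\<close> modulo \<open>I\<close> contains that of \<open>v\<close>. If the latter is maximal, the two agree
unless \<open>b\<close> annihilates \<open>v\<close>, and then \<open>a b v \<in> I\<close> gives \<open>a v \<in> I\<close>.\<close>

lemma colon_prime_above:
  assumes I: "ideal I R" and u: "u \<in> carrier R" "u \<notin> I"
  obtains v where "v \<in> carrier R" "v \<notin> I" "colon I u \<subseteq> colon I v" "colon I v \<in> prime_spec R"
    "\<And>w. w \<in> carrier R \<Longrightarrow> w \<notin> I \<Longrightarrow> colon I v \<subseteq> colon I w \<Longrightarrow> colon I w = colon I v"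
proof -
  define \<A> where "\<A> = {colon I v | v. v \<in> carrier R \<and> v \<notin> I \<and> colon I u \<subseteq> colon I v}"
  have "colon I u \<in> \<A>" using u by (auto simp: \<A>_def)
  then have ne: "\<A> \<noteq> {}" by blast
  have id: "ideal J R" if "J \<in> \<A>" for J using that ideal_colon[OF I] by (auto simp: \<A>_def)
  obtain P where P: "P \<in> \<A>" and max': "\<forall>J\<in>\<A>. P \<subseteq> J \<longrightarrow> J = P"
    by (rule maximal_in_family[OF ne id])
  note max = max'[rule_format]
  from P obtain v where v: "v \<in> carrier R" "v \<notin> I" "colon I u \<subseteq> colon I v" and Pv: "P = colon I v"
    by (auto simp: \<A>_def)
  have maxv: "colon I w = colon I v" if "w \<in> carrier R" "w \<notin> I" "colon I v \<subseteq> colon I w" for w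
    using max[of "colon I w"] that v unfolding Pv \<A>_def by blast
  have "primeideal (colon I v) R"
  proof (rule primeidealI[OF ideal_colon[OF I v(1)] is_cring])
    show "carrier R \<noteq> colon I v" using one_in_colon[OF v(1)] v(2) by auto
    show "a \<in> colon I v \<or> b \<in> colon I v"
      if ab: "a \<in> carrier R" "b \<in> carrier R" "a \<otimes> b \<in> colon I v" for a b
    proof (rule disjCI)
      assume b: "b \<notin> colon I v"
      have "colon I v \<subseteq> colon I (b \<otimes> v)"
      proof
        fix r assume r: "r \<in> colon I v"
        then have rc: "r \<in> carrier R" and rv: "r \<otimes> v \<in> I" by (auto simp: colon_iff)
        have "r \<otimes> (b \<otimes> v) = b \<otimes> (r \<otimes> v)" using rc ab v by (simp add: m_ac)
        also have "\<dots> \<in> I" using ideal.I_l_closed[OF I rv ab(2)] .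
        finally show "r \<in> colon I (b \<otimes> v)" using rc by (simp add: colon_iff)
      qed
      then have "colon I (b \<otimes> v) = colon I v"
        using b ab v by (intro maxv) (auto simp: colon_iff)
      moreover have "a \<in> colon I (b \<otimes> v)" using ab v by (simp add: colon_iff m_assoc)
      ultimately show "a \<in> colon I v" by simp
    qed
  qed
  then show thesis using that[OF v(1,2,3)] maxv by (simp add: prime_spec_iff)
qed

text \<open>Let \<open>S\<close> be the set of elements whose annihilator modulo \<open>I\<close> is a maximal one. The ideal generated by \<open>S\<close> is generated by a finite part \<open>T\<close>. If
\<open>v \<in> S\<close>, then \<open>v\<close> is annihilated by every \<open>r\<close> that annihilates all of \<open>T\<close>, so the annihilator of \<open>v\<close>
contains that of some \<open>t \<in> T\<close>, and the two agree by maximality.\<close>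

lemma zero_divisors_finite_cover:
  assumes I: "ideal I R"
  obtains F where "finite F" "F \<subseteq> prime_spec R"
    "\<And>P. P \<in> F \<Longrightarrow> \<exists>v \<in> carrier R. v \<notin> I \<and> P = colon I v"
    "\<And>u. u \<in> carrier R \<Longrightarrow> u \<notin> I \<Longrightarrow> \<exists>P\<in>F. colon I u \<subseteq> P"
proof -
  define S where "S = {v \<in> carrier R. v \<notin> I \<and> colon I v \<in> prime_spec R \<and>
    (\<forall>w \<in> carrier R. w \<notin> I \<and> colon I v \<subseteq> colon I w \<longrightarrow> colon I w = colon I v)}"
  define \<A> where "\<A> = {Idl T | T. finite T \<and> T \<subseteq> S}"
  have Sc: "S \<subseteq> carrier R" by (auto simp: S_def)
  have "Idl {} \<in> \<A>" by (auto simp: \<A>_def)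
  then have ne: "\<A> \<noteq> {}" by blast
  have idA: "ideal J R" if "J \<in> \<A>" for J
    using that genideal_ideal Sc by (auto simp: \<A>_def)
  obtain J where J: "J \<in> \<A>" and max': "\<forall>K\<in>\<A>. J \<subseteq> K \<longrightarrow> K = J"
    by (rule maximal_in_family[OF ne idA])
  note max = max'[rule_format]
  from J obtain T where T: "finite T" "T \<subseteq> S" and JT: "J = Idl T" by (auto simp: \<A>_def)
  have Tc: "T \<subseteq> carrier R" using T Sc by blast
  have SJ: "S \<subseteq> Idl T"
  proof
    fix v assume v: "v \<in> S"
    have "Idl (insert v T) \<in> \<A>" using T v by (auto simp: \<A>_def)
    moreover have "Idl T \<subseteq> Idl (insert v T)" using v Sc Tc by (intro subset_Idl_subset) auto
    ultimately have "Idl (insert v T) = Idl T" using max JT by blast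
    then show "v \<in> Idl T" using genideal_self[of "insert v T"] v Sc Tc by auto
  qed
  show thesis
  proof (rule that[of "colon I ` T"])
    show "finite (colon I ` T)" using T(1) by simp
    show "colon I ` T \<subseteq> prime_spec R" using T(2) by (auto simp: S_def)
    show "\<exists>v \<in> carrier R. v \<notin> I \<and> P = colon I v" if "P \<in> colon I ` T" for P
      using that T(2) by (auto simp: S_def)
    fix u assume u: "u \<in> carrier R" "u \<notin> I"
    obtain v where v: "v \<in> carrier R" "v \<notin> I" "colon I u \<subseteq> colon I v" "colon I v \<in> prime_spec R"
      "\<And>w. w \<in> carrier R \<Longrightarrow> w \<notin> I \<Longrightarrow> colon I v \<subseteq> colon I w \<Longrightarrow> colon I w = colon I v"
      using colon_prime_above[OF I u] by blast
    then have "v \<in> S" by (simp add: S_def)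
    then have vT: "v \<in> Idl T" using SJ by blast
    have "{r \<in> carrier R. \<forall>t\<in>T. r \<in> colon I t} \<subseteq> colon I v"
    proof safe
      fix r assume r: "r \<in> carrier R" "\<forall>t\<in>T. r \<in> colon I t"
      have "T \<subseteq> colon I r" using r(2) Tc colon_commute[OF r(1)] by blast
      then have "Idl T \<subseteq> colon I r" by (intro genideal_minimal ideal_colon I r(1))
      then show "r \<in> colon I v" using vT r(1) v(1) by (auto simp: colon_commute)
    qed
    then obtain t where t: "t \<in> T" "colon I t \<subseteq> colon I v"
      using prime_contains_factor[OF v(4) T(1), of "colon I"] ideal_colon[OF I] Tc by blast
    then have "colon I v = colon I t" using T(2) v(1,2) by (auto simp: S_def)
    then show "\<exists>P\<in>colon I ` T. colon I u \<subseteq> P" using v(3) t(1) by auto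
  qed
qed

text \<open>An ideal that annihilates no nonzero element modulo any of finitely many ideals is not contained in
any of the finitely many primes that make up the zero divisors, so prime avoidance applies.\<close>

lemma common_regular_element:
  assumes "finite \<I>" and id: "\<And>I. I \<in> \<I> \<Longrightarrow> ideal I R" and J: "ideal J R"
    and n: "\<And>I v. I \<in> \<I> \<Longrightarrow> v \<in> carrier R \<Longrightarrow> v \<notin> I \<Longrightarrow> \<not> J \<subseteq> colon I v"
  obtains z where "z \<in> J" "\<And>I. I \<in> \<I> \<Longrightarrow> regular_mod I z"
proof -
  have "\<forall>I\<in>\<I>. \<exists>F. finite F \<and> F \<subseteq> prime_spec R \<and>
    (\<forall>P\<in>F. \<exists>v \<in> carrier R. v \<notin> I \<and> P = colon I v) \<and>
    (\<forall>u \<in> carrier R. u \<notin> I \<longrightarrow> (\<exists>P\<in>F. colon I u \<subseteq> P))"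
  proof
    fix I assume "I \<in> \<I>"
    show "\<exists>F. finite F \<and> F \<subseteq> prime_spec R \<and>
      (\<forall>P\<in>F. \<exists>v \<in> carrier R. v \<notin> I \<and> P = colon I v) \<and>
      (\<forall>u \<in> carrier R. u \<notin> I \<longrightarrow> (\<exists>P\<in>F. colon I u \<subseteq> P))"
      by (rule zero_divisors_finite_cover[OF id[OF \<open>I \<in> \<I>\<close>]]) (intro exI conjI ballI impI)
  qed
  from bchoice[OF this] obtain F where F0: "\<forall>I\<in>\<I>. finite (F I) \<and> F I \<subseteq> prime_spec R \<and>
    (\<forall>P\<in>F I. \<exists>v \<in> carrier R. v \<notin> I \<and> P = colon I v) \<and>
    (\<forall>u \<in> carrier R. u \<notin> I \<longrightarrow> (\<exists>P\<in>F I. colon I u \<subseteq> P))"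
    by (rule exE)
  note F' = bspec[OF F0]
  have F: "\<And>I. I \<in> \<I> \<Longrightarrow> finite (F I)" "\<And>I. I \<in> \<I> \<Longrightarrow> F I \<subseteq> prime_spec R"
    "\<And>I P. I \<in> \<I> \<Longrightarrow> P \<in> F I \<Longrightarrow> \<exists>v \<in> carrier R. v \<notin> I \<and> P = colon I v"
    "\<And>I u. I \<in> \<I> \<Longrightarrow> u \<in> carrier R \<Longrightarrow> u \<notin> I \<Longrightarrow> \<exists>P\<in>F I. colon I u \<subseteq> P"
    using F' by simp_all
  have "\<exists>z\<in>J. \<forall>P\<in>(\<Union>I\<in>\<I>. F I). z \<notin> P"
  proof (rule prime_avoidance[OF _ _ J])
    show "finite (\<Union>I\<in>\<I>. F I)" using assms(1) F(1) by blast
    show "(\<Union>I\<in>\<I>. F I) \<subseteq> prime_spec R" using F(2) by blast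
    show "\<not> J \<subseteq> P" if P: "P \<in> (\<Union>I\<in>\<I>. F I)" for P
    proof -
      obtain I where I: "I \<in> \<I>" "P \<in> F I" using P by blast
      obtain v where "v \<in> carrier R" "v \<notin> I" "P = colon I v" using F(3)[OF I] by blast
      then show ?thesis using n[OF I(1)] by blast
    qed
  qed
  then obtain z where z: "z \<in> J" "\<And>I P. I \<in> \<I> \<Longrightarrow> P \<in> F I \<Longrightarrow> z \<notin> P" by blast
  have zc: "z \<in> carrier R" using ideal.Icarr[OF J z(1)] .
  have "regular_mod I z" if I: "I \<in> \<I>" for I
    unfolding regular_mod_def
  proof (intro conjI ballI impI zc)
    fix y assume y: "y \<in> carrier R" "z \<otimes> y \<in> I"
    show "y \<in> I"
    proof (rule ccontr)
      assume "y \<notin> I"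
      then obtain P where "P \<in> F I" "colon I y \<subseteq> P" using F(4)[OF I y(1)] by blast
      then show False using z(2)[OF I] y zc by (auto simp: colon_iff)
    qed
  qed
  then show thesis using that z(1) by blast
qed

text \<open>The length of a regular sequence that follows \<open>x\<close> does not depend on \<open>x\<close>. As both \<open>I + (x)\<close> and
\<open>I + (y)\<close> admit another regular element, there is one element \<open>z\<close> regular modulo \<open>I\<close>, \<open>I + (x)\<close> and
\<open>I + (y)\<close>. The induction hypothesis is used twice: modulo \<open>I + (x)\<close> to replace the next element of
the given sequence by \<open>z\<close>, and modulo \<open>I + (z)\<close> to replace \<open>x\<close> by \<open>y\<close>.\<close>

lemma regular_seq_exchange:
  assumes "ideal I R" "ideal J R" "x \<in> J" "y \<in> J" "regular_mod I x" "regular_mod I y"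
    and "regular_seq_mod (adjoin I x) xs" "set xs \<subseteq> J"
  shows "\<exists>ys. length ys = length xs \<and> set ys \<subseteq> J \<and> regular_seq_mod (adjoin I y) ys"
  using assms
proof (induction "length xs" arbitrary: I x y xs)
  case 0
  then show ?case by (intro exI[of _ "[]"]) auto
next
  case (Suc n)
  note I = Suc.prems(1) and J = Suc.prems(2) and xJ = Suc.prems(3) and yJ = Suc.prems(4)
    and x = Suc.prems(5) and y = Suc.prems(6)
  note xc = regular_mod_carrier[OF x] and yc = regular_mod_carrier[OF y]
  obtain w ws where xs: "xs = w # ws" using Suc.hyps(2) by (cases xs) auto
  have w: "regular_mod (adjoin I x) w" and ws: "regular_seq_mod (adjoin (adjoin I x) w) ws"
    and wJ: "w \<in> J" "set ws \<subseteq> J" and len: "n = length ws" using Suc.prems(7,8) Suc.hyps(2) xs by auto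
  have no: "\<not> J \<subseteq> colon K v" if "ideal K R" "regular_mod K z" "z \<in> J" "v \<in> carrier R" "v \<notin> K" for K v z
    using regular_modD[OF that(2,4)] that(3,5) by (auto simp: colon_iff)
  have nx: "\<not> J \<subseteq> colon (adjoin I x) v" if "v \<in> carrier R" "v \<notin> adjoin I x" for v
    using no[OF ideal_adjoin[OF I xc] w wJ(1)] that by blast
  have ny: "\<not> J \<subseteq> colon (adjoin I y) v" if "v \<in> carrier R" "v \<notin> adjoin I y" for v
    using socle_exchange[OF I y x xJ ideal_subset[OF J]] that nx by blast
  have "\<not> J \<subseteq> colon K v" if "K \<in> {I, adjoin I x, adjoin I y}" "v \<in> carrier R" "v \<notin> K" for K v
    using that nx ny no[OF I x xJ] by blast
  moreover have "ideal K R" if "K \<in> {I, adjoin I x, adjoin I y}" for K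
    using that I ideal_adjoin[OF I xc] ideal_adjoin[OF I yc] by blast
  ultimately obtain z where zJ: "z \<in> J" and z: "\<And>K. K \<in> {I, adjoin I x, adjoin I y} \<Longrightarrow> regular_mod K z"
    using common_regular_element[of "{I, adjoin I x, adjoin I y}" J] J by blast
  have zI: "regular_mod I z" and zx: "regular_mod (adjoin I x) z" and zy: "regular_mod (adjoin I y) z"
    using z by auto
  note zc = regular_mod_carrier[OF zI]
  obtain us where us: "length us = n" "set us \<subseteq> J" "regular_seq_mod (adjoin (adjoin I x) z) us"
    using Suc.hyps(1)[OF len ideal_adjoin[OF I xc] J wJ(1) zJ w zx ws wJ(2)] len by auto
  have us': "regular_seq_mod (adjoin (adjoin I z) x) us"
    using us(3) adjoin_commute[OF I xc zc] by simp
  obtain vs where vs: "length vs = n" "set vs \<subseteq> J" "regular_seq_mod (adjoin (adjoin I z) y) vs"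
    using Suc.hyps(1)[OF us(1)[symmetric] ideal_adjoin[OF I zc] J xJ yJ
        regular_mod_swap[OF I x zI zx] regular_mod_swap[OF I y zI zy] us' us(2)] us(1) by auto
  show ?case
    using vs zJ zy adjoin_commute[OF I yc zc] Suc.hyps(2) by (intro exI[of _ "z # vs"]) auto
qed

end

section \<open>Annihilators and chains of primes in a local ring\<close>

locale noetherian_local_ring = noetherian_cring +
  fixes M
  assumes unique_maximal: "{I. maximalideal I R} = {M}"
begin

lemma M_maximal: "maximalideal M R"
  using unique_maximal by blast

lemma M_prime: "M \<in> prime_spec R"
  using maximalideal_prime[OF M_maximal] by (simp add: prime_spec_iff)

lemma ideal_M: "ideal M R"
  by (rule prime_ideal[OF M_prime])

lemma proper_ideal_subset_M:
  assumes J: "ideal J R" "\<one> \<notin> J"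
  shows "J \<subseteq> M"
proof -
  define \<A> where "\<A> = {I. ideal I R \<and> J \<subseteq> I \<and> \<one> \<notin> I}"
  have ne: "\<A> \<noteq> {}" using J by (auto simp: \<A>_def)
  obtain N where N: "N \<in> \<A>" and max: "\<forall>K\<in>\<A>. N \<subseteq> K \<longrightarrow> K = N"
    by (rule maximal_in_family[OF ne]) (auto simp: \<A>_def)
  from N have NI: "ideal N R" "J \<subseteq> N" "\<one> \<notin> N" by (auto simp: \<A>_def)
  have "maximalideal N R"
  proof (rule maximalidealI[OF NI(1)])
    show "carrier R \<noteq> N" using NI(3) by auto
    fix K assume K: "ideal K R" "N \<subseteq> K" "K \<subseteq> carrier R"
    show "K = N \<or> K = carrier R"
    proof (cases "\<one> \<in> K")
      case True
      then show ?thesis using ideal.one_imp_carrier[OF K(1)] by simp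
    next
      case False
      then have "K \<in> \<A>" using K NI by (auto simp: \<A>_def)
      then show ?thesis using max K(2) by simp
    qed
  qed
  then have "N = M" using unique_maximal by blast
  then show ?thesis using NI(2) by simp
qed

lemma prime_subset_M: "P \<in> prime_spec R \<Longrightarrow> P \<subseteq> M"
  by (intro proper_ideal_subset_M prime_ideal prime_one)

lemma invertible_outside_M:
  assumes "r \<in> carrier R" "r \<notin> M"
  obtains s where "s \<in> carrier R" "s \<otimes> r = \<one>"
proof -
  have "\<not> PIdl r \<subseteq> M" using cgenideal_self[OF assms(1)] assms(2) by blast
  then have "\<one> \<in> PIdl r" using proper_ideal_subset_M[OF cgenideal_ideal[OF assms(1)]] by blast
  then show thesis using that by (auto simp: cgenideal_def)
qed

lemma mult_outside_M_mem:
  assumes I: "ideal I R" and r: "r \<in> carrier R" "r \<notin> M" and y: "y \<in> carrier R" "r \<otimes> y \<in> I"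
  shows "y \<in> I"
proof -
  obtain s where s: "s \<in> carrier R" "s \<otimes> r = \<one>" using invertible_outside_M[OF r] .
  have "y = s \<otimes> (r \<otimes> y)" using s r y by (simp add: m_assoc[symmetric])
  then show ?thesis using ideal.I_l_closed[OF I y(2) s(1)] by simp
qed

lemma one_minus_M:
  assumes "z \<in> M" "r \<in> carrier R"
  shows "\<one> \<ominus> r \<otimes> z \<in> carrier R" "\<one> \<ominus> r \<otimes> z \<notin> M"
proof -
  have zc: "z \<in> carrier R" using assms(1) ideal.Icarr[OF ideal_M] by blast
  show c: "\<one> \<ominus> r \<otimes> z \<in> carrier R" using zc assms(2) by simp
  show "\<one> \<ominus> r \<otimes> z \<notin> M"
  proof
    assume "\<one> \<ominus> r \<otimes> z \<in> M"
    then have "(\<one> \<ominus> r \<otimes> z) \<oplus> r \<otimes> z \<in> M" by (intro ideal_add ideal_M ideal.I_l_closed assms)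
    moreover have "(\<one> \<ominus> r \<otimes> z) \<oplus> r \<otimes> z = \<one>" using zc assms(2) by (simp add: a_minus_def a_assoc l_neg)
    ultimately show False using prime_one[OF M_prime] by simp
  qed
qed

text \<open>Passing from \<open>I\<close> to \<open>I + (z)\<close> does not lose annihilated elements. If all elements of \<open>R/I\<close>
annihilated by \<open>C\<close> were multiples of \<open>z\<close>, then the submodule \<open>K\<close> of these elements would satisfy \<open>K = z K\<close>
because \<open>z\<close> is regular, contrary to Nakayama's lemma. Explicitly, pick a
nonzero \<open>w\<close> in \<open>K\<close> with \<open>I + (w)\<close> maximal and write \<open>w = i + v z\<close>, so that \<open>I + (v) = I + (w)\<close>.\<close>

lemma colon_lift:
  assumes I: "ideal I R" and z: "regular_mod I z" and zM: "z \<in> M"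
    and C: "C \<subseteq> carrier R" and u: "u \<in> carrier R" "u \<notin> I" "C \<subseteq> colon I u"
  shows "\<exists>w \<in> carrier R. w \<notin> adjoin I z \<and> C \<subseteq> colon I w"
proof (rule ccontr)
  assume "\<not> ?thesis"
  then have n: "w \<in> adjoin I z" if "w \<in> carrier R" "C \<subseteq> colon I w" for w using that by blast
  note zc = regular_mod_carrier[OF z]
  define \<A> where "\<A> = {adjoin I w | w. w \<in> carrier R \<and> w \<notin> I \<and> C \<subseteq> colon I w}"
  have ne: "\<A> \<noteq> {}" using u by (auto simp: \<A>_def)
  have id: "ideal J R" if "J \<in> \<A>" for J using that ideal_adjoin[OF I] by (auto simp: \<A>_def)
  obtain J where J: "J \<in> \<A>" and max: "\<forall>K\<in>\<A>. J \<subseteq> K \<longrightarrow> K = J"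
    by (rule maximal_in_family[OF ne id])
  from J obtain w where w: "w \<in> carrier R" "w \<notin> I" "C \<subseteq> colon I w" "J = adjoin I w" by (auto simp: \<A>_def)
  \<comment> \<open>\<open>C\<close> annihilates \<open>v\<close> modulo \<open>I\<close> as well, because \<open>z\<close> can be cancelled\<close>
  from n[OF w(1,3)] obtain i v where i: "i \<in> I" and v: "v \<in> carrier R" and wv: "w = i \<oplus> v \<otimes> z"
    by (rule adjoinE)
  note ic = ideal.Icarr[OF I i]
  have vC: "C \<subseteq> colon I v"
  proof
    fix c assume c: "c \<in> C"
    then have cc: "c \<in> carrier R" and cw: "c \<otimes> w \<in> I" using C w(3) by (auto simp: colon_iff)
    have "z \<otimes> (c \<otimes> v) = c \<otimes> w \<ominus> c \<otimes> i"
    proof -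
      have "z \<otimes> (c \<otimes> v) = c \<otimes> (v \<otimes> z)" using zc cc v by (simp add: m_ac)
      moreover have "c \<otimes> w = c \<otimes> (v \<otimes> z) \<oplus> c \<otimes> i" unfolding wv using cc v zc ic
        by (simp add: r_distr a_comm)
      ultimately show ?thesis using cc v zc ic by (simp add: a_minus_def a_assoc r_neg)
    qed
    also have "\<dots> \<in> I" by (intro ideal_diff I cw ideal.I_l_closed i cc)
    finally have "c \<otimes> v \<in> I" by (rule regular_modD[OF z, rotated]) (use cc v in simp)
    then show "c \<in> colon I v" using cc by (simp add: colon_iff)
  qed
  have vI: "v \<notin> I"
  proof
    assume "v \<in> I"
    then have "w \<in> I" unfolding wv by (intro ideal_add I i ideal.I_r_closed zc)
    with w(2) show False ..
  qed
  have vA: "adjoin I v \<in> \<A>" using v vI vC by (auto simp: \<A>_def)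
  have "w \<in> adjoin I v" unfolding wv m_comm[OF v zc] by (rule adjoinI[OF i zc])
  then have "J \<subseteq> adjoin I v" unfolding w(4) by (intro adjoin_minimal ideal_adjoin subset_adjoin I v)
  then have "adjoin I v = adjoin I w" using max vA w(4) by simp
  then have "v \<in> adjoin I w" using mem_adjoin[OF I v] by simp
  then obtain j r where j: "j \<in> I" and r: "r \<in> carrier R" and vr: "v = j \<oplus> r \<otimes> w" by (rule adjoinE)
  note jc = ideal.Icarr[OF I j]
  \<comment> \<open>\<open>1 - r z\<close> is a unit, so it suffices to see that it multiplies \<open>v\<close> into \<open>I\<close>\<close>
  have "(\<one> \<ominus> r \<otimes> z) \<otimes> v = v \<ominus> r \<otimes> (v \<otimes> z)"
    using r zc v by (simp add: a_minus_def l_distr l_minus m_assoc m_comm[of z v])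
  also have "\<dots> = (j \<oplus> r \<otimes> (i \<oplus> v \<otimes> z)) \<ominus> r \<otimes> (v \<otimes> z)"
    by (rule arg_cong[where f = "\<lambda>t. t \<ominus> r \<otimes> (v \<otimes> z)"]) (fact vr[unfolded wv])
  also have "\<dots> = j \<oplus> r \<otimes> i"
    using jc r ic v zc by (simp add: a_minus_def r_distr a_assoc r_neg)
  also have "\<dots> \<in> I" by (intro ideal_add I j ideal.I_l_closed i r)
  finally have "v \<in> I" by (rule mult_outside_M_mem[OF I one_minus_M[OF zM r] v])
  with vI show False ..
qed

text \<open>A form of the inequality \<open>depth R/I \<le> dim R/p\<close> for associated primes \<open>p\<close>. Enlarge \<open>C\<close> to an
annihilator prime \<open>p\<close>. The first element \<open>z\<close> of the sequence is not in \<open>p\<close>, and \<open>p\<close> together with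
\<open>z\<close> annihilates a nonzero element modulo \<open>I + (z)\<close>, so the rest of the sequence provides the primes
strictly above \<open>p\<close>.\<close>

lemma prime_chain_over_annihilator:
  assumes "ideal I R" "C \<subseteq> carrier R" "u \<in> carrier R" "u \<notin> I" "C \<subseteq> colon I u"
    and "regular_seq_mod I xs" "set xs \<subseteq> M"
  shows "\<exists>Ps. length Ps = Suc (length xs) \<and> set Ps \<subseteq> prime_spec R \<and> sorted_wrt (\<subset>) Ps \<and>
    (\<forall>P\<in>set Ps. C \<subseteq> P)"
  using assms
proof (induction xs arbitrary: I C u)
  case Nil
  obtain v where "colon I u \<subseteq> colon I v" "colon I v \<in> prime_spec R"
    by (rule colon_prime_above[OF Nil.prems(1,3,4)]) (rule that)
  then show ?case using Nil.prems(5) by (intro exI[of _ "[colon I v]"]) auto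
next
  case (Cons z zs)
  note I = Cons.prems(1)
  have z: "regular_mod I z" and zs: "regular_seq_mod (adjoin I z) zs" and zM: "z \<in> M" "set zs \<subseteq> M"
    using Cons.prems(6,7) by auto
  note zc = regular_mod_carrier[OF z]
  obtain v where v: "v \<in> carrier R" "v \<notin> I" "colon I u \<subseteq> colon I v" "colon I v \<in> prime_spec R"
    by (rule colon_prime_above[OF I Cons.prems(3,4)]) (rule that)
  define p where "p = colon I v"
  have p: "p \<in> prime_spec R" "C \<subseteq> p" "p \<subseteq> carrier R" using v Cons.prems(5) by (auto simp: p_def colon_iff)
  obtain w where w: "w \<in> carrier R" "w \<notin> adjoin I z" "p \<subseteq> colon I w"
    using colon_lift[OF I z zM(1) p(3) v(1,2)] by (auto simp: p_def)
  have "insert z p \<subseteq> colon (adjoin I z) w"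
  proof -
    have "colon I w \<subseteq> colon (adjoin I z) w" using subset_adjoin[OF I zc] by (auto simp: colon_iff)
    moreover have "z \<in> colon (adjoin I z) w"
      using mult_mem_adjoin[OF I zc w(1)] zc w(1) by (simp add: colon_iff m_comm)
    ultimately show ?thesis using w(3) by blast
  qed
  moreover have "insert z p \<subseteq> carrier R" using zc p(3) by blast
  ultimately obtain Qs where Qs: "length Qs = Suc (length zs)" "set Qs \<subseteq> prime_spec R"
    "sorted_wrt (\<subset>) Qs" "\<forall>Q\<in>set Qs. insert z p \<subseteq> Q"
    using Cons.IH[OF ideal_adjoin[OF I zc] _ w(1,2) _ zs zM(2)] by blast
  have "z \<notin> p" using regular_modD[OF z v(1)] v(2) by (auto simp: p_def colon_iff)
  then show ?case using Qs p by (intro exI[of _ "p # Qs"]) auto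
qed

end

section \<open>Separating sets contain long chains of primes\<close>

context noetherian_cring
begin

lemma regular_mod_pow: "regular_mod I x \<Longrightarrow> regular_mod I (x [^] (n::nat))"
proof (induction n)
  case 0
  then show ?case by (simp add: regular_mod_def)
next
  case (Suc n)
  have xc: "x \<in> carrier R" using Suc.prems by (rule regular_mod_carrier)
  show ?case unfolding regular_mod_def
  proof (intro conjI ballI impI)
    show "x [^] Suc n \<in> carrier R" using xc by simp
    fix y assume y: "y \<in> carrier R" "x [^] Suc n \<otimes> y \<in> I"
    then have "x [^] n \<otimes> (x \<otimes> y) \<in> I" using xc by (simp add: m_assoc)
    then have "x \<otimes> y \<in> I" using regular_modD[OF Suc.IH[OF Suc.prems]] xc y by simp
    then show "y \<in> I" by (rule regular_modD[OF Suc.prems y(1)])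
  qed
qed

lemma adjoin_zero_iff:
  assumes x: "x \<in> carrier R"
  shows "y \<in> adjoin {\<zero>} x \<longleftrightarrow> (\<exists>r \<in> carrier R. y = x \<otimes> r)"
proof
  assume "y \<in> adjoin {\<zero>} x"
  then obtain i r where "i \<in> {\<zero>}" "r \<in> carrier R" "y = i \<oplus> r \<otimes> x" by (rule adjoinE)
  then show "\<exists>r \<in> carrier R. y = x \<otimes> r" using x by (intro bexI[of _ r]) (simp_all add: m_comm)
next
  assume "\<exists>r \<in> carrier R. y = x \<otimes> r"
  then obtain r where "r \<in> carrier R" "y = x \<otimes> r" by (rule bexE)
  then show "y \<in> adjoin {\<zero>} x" using mult_mem_adjoin[OF zeroideal x] x by (simp add: m_comm)
qed

lemma regular_mod_adjoin_pow:
  assumes x: "regular_mod {\<zero>} x" and y: "regular_mod (adjoin {\<zero>} x) y"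
  shows "regular_mod (adjoin {\<zero>} (x [^] (n::nat))) y"
proof -
  note xc = regular_mod_carrier[OF x] and yc = regular_mod_carrier[OF y]
  show ?thesis
  proof (induction n)
    case 0
    then show ?case using yc by (auto simp: regular_mod_def adjoin_zero_iff)
  next
    case (Suc n)
    show ?case unfolding regular_mod_def
    proof (intro conjI ballI impI yc)
      fix t assume t: "t \<in> carrier R" "y \<otimes> t \<in> adjoin {\<zero>} (x [^] Suc n)"
      then obtain s where s: "s \<in> carrier R" "y \<otimes> t = x [^] Suc n \<otimes> s" using xc by (auto simp: adjoin_zero_iff)
      then have e: "y \<otimes> t = x \<otimes> (x [^] n \<otimes> s)" using xc by (simp add: m_ac)
      then have "y \<otimes> t \<in> adjoin {\<zero>} x" using xc s(1) by (auto simp: adjoin_zero_iff)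
      then have "t \<in> adjoin {\<zero>} x" by (rule regular_modD[OF y t(1)])
      then obtain t' where t': "t' \<in> carrier R" "t = x \<otimes> t'" using xc by (auto simp: adjoin_zero_iff)
      have "x \<otimes> (y \<otimes> t' \<ominus> x [^] n \<otimes> s) = y \<otimes> t \<ominus> x \<otimes> (x [^] n \<otimes> s)"
        unfolding t'(2) using xc yc t' s(1) by (simp add: a_minus_def r_distr r_minus m_ac)
      also have "\<dots> \<in> {\<zero>}" unfolding e using xc s(1) by (simp add: a_minus_def r_neg)
      finally have "y \<otimes> t' \<ominus> x [^] n \<otimes> s \<in> {\<zero>}"
        by (rule regular_modD[OF x, rotated]) (use xc yc t' s(1) in simp)
      then have "y \<otimes> t' = x [^] n \<otimes> s" using xc yc t' s(1) by (simp add: r_right_minus_eq)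
      then have "y \<otimes> t' \<in> adjoin {\<zero>} (x [^] n)" using xc s(1) by (auto simp: adjoin_zero_iff)
      then have "t' \<in> adjoin {\<zero>} (x [^] n)" by (rule regular_modD[OF Suc.IH t'(1)])
      then obtain s' where "s' \<in> carrier R" "t' = x [^] n \<otimes> s'" using xc by (auto simp: adjoin_zero_iff)
      then have "t = x [^] Suc n \<otimes> s'" using t' xc by (simp add: m_ac)
      then show "t \<in> adjoin {\<zero>} (x [^] Suc n)" using xc \<open>s' \<in> carrier R\<close> by (auto simp: adjoin_zero_iff)
    qed
  qed
qed

lemma Idl_mult_mem:
  assumes I: "ideal I R" and S: "S \<subseteq> carrier R" and T: "T \<subseteq> carrier R"
    and m: "\<And>s t. s \<in> S \<Longrightarrow> t \<in> T \<Longrightarrow> s \<otimes> t \<in> I"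
    and a: "a \<in> Idl S" and b: "b \<in> Idl T"
  shows "a \<otimes> b \<in> I"
proof -
  have ac: "a \<in> carrier R" using ideal.Icarr[OF genideal_ideal[OF S] a] .
  have "T \<subseteq> colon I a"
  proof
    fix t assume t: "t \<in> T"
    then have tc: "t \<in> carrier R" using T by blast
    have "S \<subseteq> colon I t" using m t S by (auto simp: colon_iff)
    then have "Idl S \<subseteq> colon I t" by (intro genideal_minimal ideal_colon I tc)
    then show "t \<in> colon I a" using a colon_commute[OF ac tc] by blast
  qed
  then have "Idl T \<subseteq> colon I a" by (intro genideal_minimal ideal_colon I ac)
  then have "b \<otimes> a \<in> I" using b by (auto simp: colon_iff)
  then show ?thesis using ac ideal.Icarr[OF genideal_ideal[OF T] b] by (simp add: m_comm)
qed

lemma power_mem_sum: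
  assumes A: "ideal A R" and B: "ideal B R" and x: "x \<in> carrier R"
    and V: "\<And>P. P \<in> prime_spec R \<Longrightarrow> A \<subseteq> P \<Longrightarrow> B \<subseteq> P \<Longrightarrow> x \<in> P"
  obtains n :: nat and a b where "a \<in> A" "b \<in> B" "x [^] n = a \<oplus> b"
proof -
  have "A \<union> B \<subseteq> carrier R" using ideal_subset A B by blast
  then obtain n :: nat where "x [^] n \<in> Idl (A \<union> B)"
    using power_mem_Idl[OF x, of "A \<union> B"] V by auto
  then have "x [^] n \<in> A <+> B" using union_genideal[OF A B] by simp
  then show thesis using that by (auto simp: set_add_def')
qed

text \<open>The hypotheses say that the zero sets of \<open>A\<close> and \<open>B\<close> cover the spectrum and meet only where \<open>x\<close> and
\<open>y\<close> vanish. First decompose powers of \<open>x\<close> and \<open>y\<close> as sums of elements of \<open>A\<close> and \<open>B\<close>. The mixed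
products lie in all primes, so they are nilpotent, but they need not vanish. The \<open>N\<close>-th powers of
the summands generate two ideals with product zero, and \<open>x\<close> and \<open>y\<close> still vanish on the common zero
set of these, so powers of \<open>x\<close> and \<open>y\<close> can be decomposed once more.\<close>

lemma powers_split_orthogonally:
  assumes A: "ideal A R" and B: "ideal B R" and x: "x \<in> carrier R" and y: "y \<in> carrier R"
    and V: "\<And>P. P \<in> prime_spec R \<Longrightarrow> A \<subseteq> P \<Longrightarrow> B \<subseteq> P \<Longrightarrow> x \<in> P \<and> y \<in> P"
    and cover: "\<And>P. P \<in> prime_spec R \<Longrightarrow> A \<subseteq> P \<or> B \<subseteq> P"
  obtains k l :: nat and a1 a2 b1 b2 where "a1 \<in> A" "a2 \<in> A" "b1 \<in> B" "b2 \<in> B"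
    "x [^] k = a1 \<oplus> b1" "y [^] l = a2 \<oplus> b2"
    "\<forall>a\<in>{a1, a2}. \<forall>b\<in>{b1, b2}. a \<otimes> b = \<zero>"
proof -
  have Vx: "x \<in> P" and Vy: "y \<in> P" if "P \<in> prime_spec R" "A \<subseteq> P" "B \<subseteq> P" for P
    using V[OF that] by auto
  obtain m :: nat and c1 d1 where c1: "c1 \<in> A" and d1: "d1 \<in> B" and xm: "x [^] m = c1 \<oplus> d1"
    by (rule power_mem_sum[OF A B x Vx])
  obtain n :: nat and c2 d2 where c2: "c2 \<in> A" and d2: "d2 \<in> B" and yn: "y [^] n = c2 \<oplus> d2"
    by (rule power_mem_sum[OF A B y Vy])
  have cc: "c \<in> carrier R" if "c \<in> {c1, c2}" for c using that c1 c2 ideal.Icarr[OF A] by auto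
  have dc: "d \<in> carrier R" if "d \<in> {d1, d2}" for d using that d1 d2 ideal.Icarr[OF B] by auto
  have nil: "\<exists>N::nat. (c \<otimes> d) [^] N = \<zero>" if c: "c \<in> {c1, c2}" and d: "d \<in> {d1, d2}" for c d
  proof (rule nilpotent_if_in_all_primes)
    show "c \<otimes> d \<in> carrier R" using cc[OF c] dc[OF d] by simp
    fix P assume P: "P \<in> prime_spec R"
    then have "c \<in> P \<or> d \<in> P" using cover c1 c2 d1 d2 c d by blast
    then show "c \<otimes> d \<in> P" using prime_mult_iff[OF P cc[OF c] dc[OF d]] by simp
  qed
  then obtain e where e: "\<And>c d. c \<in> {c1, c2} \<Longrightarrow> d \<in> {d1, d2} \<Longrightarrow> (c \<otimes> d) [^] (e c d :: nat) = \<zero>"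
    by metis
  define N where "N = e c1 d1 + e c1 d2 + e c2 d1 + e c2 d2"
  have zero: "c [^] N \<otimes> d [^] N = \<zero>" if c: "c \<in> {c1, c2}" and d: "d \<in> {d1, d2}" for c d
  proof -
    note cdc = cc[OF c] dc[OF d]
    have "e c d \<le> N" using c d by (auto simp: N_def)
    then have "(c \<otimes> d) [^] N = (c \<otimes> d) [^] e c d \<otimes> (c \<otimes> d) [^] (N - e c d)"
      using cdc by (simp add: nat_pow_mult)
    also have "\<dots> = \<zero>" using e[OF c d] cdc by simp
    finally show ?thesis using cdc by (simp add: nat_pow_distrib)
  qed
  define S T where "S = {c1 [^] N, c2 [^] N}" and "T = {d1 [^] N, d2 [^] N}"
  have S: "S \<subseteq> carrier R" and T: "T \<subseteq> carrier R" using cc dc by (auto simp: S_def T_def)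
  have N0: "N \<noteq> 0 \<or> \<one> = \<zero>" using zero[of c1 d1] cc dc by (cases "N = 0") auto
  have c: "c1 \<in> P" "c2 \<in> P" if "P \<in> prime_spec R" "Idl S \<subseteq> P" for P
    using that Idl_subset_prime[OF that(1) S] prime_pow[OF that(1)] cc by (auto simp: S_def)
  have d: "d1 \<in> P" "d2 \<in> P" if "P \<in> prime_spec R" "Idl T \<subseteq> P" for P
    using that Idl_subset_prime[OF that(1) T] prime_pow[OF that(1)] dc by (auto simp: T_def)
  have Vx': "x \<in> P" and Vy': "y \<in> P" if P: "P \<in> prime_spec R" "Idl S \<subseteq> P" "Idl T \<subseteq> P" for P
  proof -
    have "x [^] m \<in> P" "y [^] n \<in> P" unfolding xm yn
      using c[OF P(1,2)] d[OF P(1,3)] ideal_add[OF prime_ideal[OF P(1)]] by auto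
    then show "x \<in> P" "y \<in> P" using prime_pow[OF P(1)] x y by auto
  qed
  obtain k :: nat and a1 b1 where a1: "a1 \<in> Idl S" and b1: "b1 \<in> Idl T" and xk: "x [^] k = a1 \<oplus> b1"
    by (rule power_mem_sum[OF genideal_ideal[OF S] genideal_ideal[OF T] x Vx'])
  obtain l :: nat and a2 b2 where a2: "a2 \<in> Idl S" and b2: "b2 \<in> Idl T" and yl: "y [^] l = a2 \<oplus> b2"
    by (rule power_mem_sum[OF genideal_ideal[OF S] genideal_ideal[OF T] y Vy'])
  \<comment> \<open>\<open>N = 0\<close> forces the zero ring; for \<open>N > 0\<close> the powers stay in \<open>A\<close> and \<open>B\<close>\<close>
  show thesis
  proof (cases "N = 0")
    case True
    then have "\<one> = \<zero>" using N0 by simp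
    then have all: "r = \<zero>" if "r \<in> carrier R" for r using that r_one[OF that] r_null[OF that] by metis
    show thesis
      by (rule that[of \<zero> \<zero> \<zero> \<zero> 0 0])
        (use all[of \<one>] ideal_zero[OF A] ideal_zero[OF B] in auto)
  next
    case False
    have powA: "S \<subseteq> A" using c1 c2 cc False by (cases N) (auto simp: S_def intro!: ideal.I_l_closed[OF A])
    have powB: "T \<subseteq> B" using d1 d2 dc False by (cases N) (auto simp: T_def intro!: ideal.I_l_closed[OF B])
    have "a \<otimes> b \<in> {\<zero>}" if "a \<in> {a1, a2}" "b \<in> {b1, b2}" for a b
    proof (rule Idl_mult_mem[OF zeroideal S T])
      show "a \<in> Idl S" "b \<in> Idl T" using that a1 a2 b1 b2 by auto
      show "s \<otimes> t \<in> {\<zero>}" if "s \<in> S" "t \<in> T" for s t using that zero by (auto simp: S_def T_def)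
    qed
    then show thesis
      using genideal_minimal[OF A powA] genideal_minimal[OF B powB] a1 a2 b1 b2 xk yl
      by (intro that[of a1 a2 b1 b2 k l]) auto
  qed
qed

end

context noetherian_local_ring
begin

lemma idempotent_trivial:
  assumes r: "r \<in> carrier R" "r \<otimes> r = r"
  shows "r = \<zero> \<or> r = \<one>"
proof -
  have z: "(\<one> \<ominus> r \<otimes> \<one>) \<otimes> r = \<zero>"
    using r by (simp add: a_minus_def l_distr l_minus r_neg)
  show ?thesis
  proof (cases "r \<in> M")
    case True
    have o: "\<one> \<ominus> \<one> \<otimes> r \<in> carrier R" "\<one> \<ominus> \<one> \<otimes> r \<notin> M" using one_minus_M[OF True one_closed] .
    have "(\<one> \<ominus> \<one> \<otimes> r) \<otimes> r \<in> {\<zero>}" using z r by simp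
    then have "r \<in> {\<zero>}" by (rule mult_outside_M_mem[OF zeroideal o r(1)])
    then show ?thesis by simp
  next
    case False
    have "r \<otimes> (\<one> \<ominus> r) \<in> {\<zero>}" using z r by (simp add: m_comm)
    then have "\<one> \<ominus> r \<in> {\<zero>}" by (rule mult_outside_M_mem[OF zeroideal r(1) False, rotated]) (use r in simp)
    then show ?thesis using r by (simp add: r_right_minus_eq)
  qed
qed

text \<open>If a power of \<open>x\<close> lay in the ideal of \<open>B\<close>, then \<open>a x\<close> would be nilpotent for every \<open>a \<in> A\<close>, hence so
would \<open>a\<close>, as \<open>x\<close> is not a zero divisor. Then \<open>D(A)\<close> would be empty.\<close>

lemma no_power_in_side:
  assumes A: "A \<subseteq> carrier R" and PA: "PA \<in> prime_spec R" "\<not> A \<subseteq> PA"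
    and cover: "\<And>P. P \<in> prime_spec R \<Longrightarrow> A \<subseteq> P \<or> B \<subseteq> P"
    and x: "regular_mod {\<zero>} x" and xB: "x [^] (k::nat) \<in> Idl B" and B: "B \<subseteq> carrier R"
  shows False
proof -
  note xc = regular_mod_carrier[OF x]
  obtain a where a: "a \<in> A" "a \<notin> PA" using PA(2) by blast
  then have ac: "a \<in> carrier R" using A by blast
  have "\<exists>N::nat. (a \<otimes> x) [^] N = \<zero>"
  proof (rule nilpotent_if_in_all_primes)
    show "a \<otimes> x \<in> carrier R" using ac xc by simp
    fix P assume P: "P \<in> prime_spec R"
    have "a \<in> P \<or> x [^] k \<in> P"
      using cover[OF P] a(1) xB Idl_subset_prime[OF P B] by blast
    then show "a \<otimes> x \<in> P" using prime_mult_iff[OF P ac xc] prime_pow[OF P xc] by blast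
  qed
  then obtain N :: nat where "(a \<otimes> x) [^] N = \<zero>" ..
  then have "x [^] N \<otimes> a [^] N \<in> {\<zero>}" using ac xc by (simp add: nat_pow_distrib m_comm)
  then have "a [^] N \<in> {\<zero>}" by (rule regular_modD[OF regular_mod_pow[OF x], rotated]) (use ac in simp)
  then have "a [^] N \<in> PA" using ideal_zero[OF prime_ideal[OF PA(1)]] by simp
  then show False using prime_pow[OF PA(1) ac] a(2) by blast
qed

text \<open>A closed set on which both terms of a regular sequence \<open>x, y\<close> vanish does not separate the spectrum
of a local ring. The element \<open>r\<close> below is the idempotent section of the structure sheaf that the
separation would define, extended to the whole spectrum.\<close>

lemma regular_pair_not_separating:
  assumes A: "A \<subseteq> carrier R" and B: "B \<subseteq> carrier R"
    and PA: "PA \<in> prime_spec R" "\<not> A \<subseteq> PA" and PB: "PB \<in> prime_spec R" "\<not> B \<subseteq> PB"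
    and cover: "\<And>P. P \<in> prime_spec R \<Longrightarrow> A \<subseteq> P \<or> B \<subseteq> P"
    and x: "regular_mod {\<zero>} x" and y: "regular_mod (adjoin {\<zero>} x) y"
    and V: "\<And>P. P \<in> prime_spec R \<Longrightarrow> A \<subseteq> P \<Longrightarrow> B \<subseteq> P \<Longrightarrow> x \<in> P \<and> y \<in> P"
  shows False
proof -
  note xc = regular_mod_carrier[OF x] and yc = regular_mod_carrier[OF y]
  have A': "ideal (Idl A) R" and B': "ideal (Idl B) R" using genideal_ideal A B by auto
  have V': "x \<in> P \<and> y \<in> P" if "P \<in> prime_spec R" "Idl A \<subseteq> P" "Idl B \<subseteq> P" for P
    using V[OF that(1)] that Idl_subset_prime[OF that(1)] A B by simp
  have cover': "Idl A \<subseteq> P \<or> Idl B \<subseteq> P" if "P \<in> prime_spec R" for P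
    using cover[OF that] Idl_subset_prime[OF that] A B by simp
  obtain k l :: nat and a1 a2 b1 b2 where ab: "a1 \<in> Idl A" "a2 \<in> Idl A" "b1 \<in> Idl B" "b2 \<in> Idl B"
    and xk: "x [^] k = a1 \<oplus> b1" and yl: "y [^] l = a2 \<oplus> b2"
    and "\<forall>a\<in>{a1, a2}. \<forall>b\<in>{b1, b2}. a \<otimes> b = \<zero>"
    by (rule powers_split_orthogonally[OF A' B' xc yc V' cover']) (assumption | rule that)+
  then have z: "a1 \<otimes> b1 = \<zero>" "a1 \<otimes> b2 = \<zero>" "a2 \<otimes> b1 = \<zero>" "a2 \<otimes> b2 = \<zero>" by auto
  have c: "a1 \<in> carrier R" "a2 \<in> carrier R" "b1 \<in> carrier R" "b2 \<in> carrier R"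
    using ab ideal.Icarr[OF A'] ideal.Icarr[OF B'] by auto
  define X Y where "X = x [^] k" and "Y = y [^] l"
  have X: "regular_mod {\<zero>} X" unfolding X_def by (rule regular_mod_pow[OF x])
  have Y: "regular_mod (adjoin {\<zero>} X) Y"
    unfolding X_def Y_def by (intro regular_mod_pow regular_mod_adjoin_pow x y)
  note Xc = regular_mod_carrier[OF X] and Yc = regular_mod_carrier[OF Y]
  \<comment> \<open>both sides are \<open>a1 a2\<close>, since the mixed products vanish\<close>
  have "Y \<otimes> a1 = X \<otimes> a2"
    unfolding X_def Y_def xk yl using c z
    by (simp add: l_distr m_comm[of b2 a1] m_comm[of b1 a2] m_comm[of a2 a1])
  then have "Y \<otimes> a1 \<in> adjoin {\<zero>} X" using Xc c by (auto simp: adjoin_zero_iff)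
  then have "a1 \<in> adjoin {\<zero>} X" by (rule regular_modD[OF Y c(1)])
  then obtain r where r: "r \<in> carrier R" "a1 = X \<otimes> r" using Xc by (auto simp: adjoin_zero_iff)
  have aX: "a1 \<otimes> a1 = X \<otimes> a1"
    unfolding X_def xk using c z by (simp add: l_distr m_comm[of b1 a1])
  \<comment> \<open>\<open>a1\<^sup>2 = X a1\<close> makes \<open>r\<close> idempotent once \<open>X\<close> is cancelled twice\<close>
  have "X \<otimes> (X \<otimes> (r \<otimes> r \<ominus> r)) = a1 \<otimes> a1 \<ominus> X \<otimes> a1"
    unfolding r(2) using Xc r(1) by (simp add: a_minus_def r_distr r_minus m_ac)
  also have "\<dots> \<in> {\<zero>}" unfolding aX using Xc c by (simp add: a_minus_def r_neg)
  finally have "X \<otimes> (r \<otimes> r \<ominus> r) \<in> {\<zero>}"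
    by (rule regular_modD[OF X, rotated]) (use Xc r in simp)
  then have "r \<otimes> r \<ominus> r \<in> {\<zero>}" by (rule regular_modD[OF X, rotated]) (use r in simp)
  then have "r \<otimes> r = r" using r(1) by (simp add: r_right_minus_eq)
  then consider "r = \<zero>" | "r = \<one>" using idempotent_trivial[OF r(1)] by blast
  then show False
  proof cases
    case 1
    then have "X = b1" using r Xc c xk X_def by simp
    then have "x [^] k \<in> Idl B" using ab X_def by simp
    then show False using no_power_in_side[OF A PA cover x _ B] by blast
  next
    case 2
    then have "X = a1" using r Xc by simp
    then have "x [^] k \<in> Idl A" using ab X_def by simp
    moreover have "B \<subseteq> P \<or> A \<subseteq> P" if "P \<in> prime_spec R" for P using cover[OF that] by blast
    ultimately show False using no_power_in_side[OF B PB _ x _ A] by blast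
  qed
qed

text \<open>This is the inequality \<open>dim R/C \<ge> depth R - 1\<close>, with the dimension witnessed by a chain, for
every \<open>C\<close> whose zero set separates the spectrum. By the previous lemma a maximal regular
sequence in the ideal of \<open>C\<close> is either empty or consists of one element \<open>x\<close>. In both cases \<open>C\<close>
annihilates a nonzero element, of \<open>R\<close> or of \<open>R/x\<close>.\<close>

lemma prime_chain_in_separating_set:
  assumes xs: "regular_seq_mod {\<zero>} xs" "set xs \<subseteq> M"
    and A: "A \<subseteq> carrier R" and B: "B \<subseteq> carrier R" and C: "C \<subseteq> carrier R"
    and PA: "PA \<in> prime_spec R" "\<not> A \<subseteq> PA" and PB: "PB \<in> prime_spec R" "\<not> B \<subseteq> PB"
    and cover: "\<And>P. P \<in> prime_spec R \<Longrightarrow> A \<subseteq> P \<or> B \<subseteq> P"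
    and V: "\<And>P. P \<in> prime_spec R \<Longrightarrow> A \<subseteq> P \<Longrightarrow> B \<subseteq> P \<Longrightarrow> C \<subseteq> P"
  shows "\<exists>Ps. length xs \<le> length Ps \<and> set Ps \<subseteq> prime_spec R \<and> sorted_wrt (\<subset>) Ps \<and> (\<forall>P\<in>set Ps. C \<subseteq> P)"
proof -
  have AM: "A \<subseteq> M"
  proof (rule ccontr)
    assume "\<not> A \<subseteq> M"
    then have "\<not> A \<subseteq> PB" using prime_subset_M[OF PB(1)] by blast
    then show False using cover[OF PB(1)] PB(2) by blast
  qed
  have BM: "B \<subseteq> M"
  proof (rule ccontr)
    assume "\<not> B \<subseteq> M"
    then have "\<not> B \<subseteq> PA" using prime_subset_M[OF PA(1)] by blast
    then show False using cover[OF PA(1)] PA(2) by blast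
  qed
  have CM: "C \<subseteq> M" using V[OF M_prime AM BM] .
  have J: "ideal (Idl C) R" by (rule genideal_ideal[OF C])
  have CJ: "C \<subseteq> Idl C" by (rule genideal_self[OF C])
  have JM: "Idl C \<subseteq> M" by (rule genideal_minimal[OF ideal_M CM])
  note Z = zeroideal
  show ?thesis
  proof (cases "\<exists>u \<in> carrier R. u \<notin> {\<zero>} \<and> Idl C \<subseteq> colon {\<zero>} u")
    case True
    then obtain u where u: "u \<in> carrier R" "u \<notin> {\<zero>}" "C \<subseteq> colon {\<zero>} u" using CJ by blast
    from prime_chain_over_annihilator[OF Z C u xs] show ?thesis
      by (elim exE) (rule exI, auto)
  next
    case no0: False
    have "\<exists>x\<in>Idl C. regular_mod {\<zero>} x"
      by (rule common_regular_element[of "{{\<zero>}}" "Idl C"]) (use no0 Z J in auto)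
    then obtain x where xJ: "x \<in> Idl C" and x: "regular_mod {\<zero>} x" by blast
    note xc = regular_mod_carrier[OF x]
    note adjx = ideal_adjoin[OF Z xc]
    show ?thesis
    proof (cases "\<exists>u \<in> carrier R. u \<notin> adjoin {\<zero>} x \<and> Idl C \<subseteq> colon (adjoin {\<zero>} x) u")
      case True
      then obtain u where u: "u \<in> carrier R" "u \<notin> adjoin {\<zero>} x" "C \<subseteq> colon (adjoin {\<zero>} x) u" using CJ by blast
      show ?thesis
      \<comment> \<open>put \<open>x\<close> in the place of the first element of the given regular sequence\<close>
      proof (cases xs)
        case Nil
        then show ?thesis by (intro exI[of _ "[]"]) auto
      next
        case (Cons w ws)
        then have "regular_mod {\<zero>} w" "regular_seq_mod (adjoin {\<zero>} w) ws" "w \<in> M" "set ws \<subseteq> M"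
          using xs by auto
        then obtain ys where ys: "length ys = length ws" "set ys \<subseteq> M" "regular_seq_mod (adjoin {\<zero>} x) ys"
          using regular_seq_exchange[OF Z ideal_M, of w x ws] xJ JM x by blast
        from prime_chain_over_annihilator[OF adjx C u ys(3,2)] show ?thesis
          using ys(1) Cons by (elim exE) (rule exI, auto)
      qed
    next
      case nox: False
      have "\<exists>y\<in>Idl C. regular_mod (adjoin {\<zero>} x) y"
        by (rule common_regular_element[of "{adjoin {\<zero>} x}" "Idl C"]) (use nox adjx J in auto)
      then obtain y where yJ: "y \<in> Idl C" and y: "regular_mod (adjoin {\<zero>} x) y" by blast
      have "x \<in> P \<and> y \<in> P" if "P \<in> prime_spec R" "A \<subseteq> P" "B \<subseteq> P" for P
        using V[OF that] Idl_subset_prime[OF that(1) C] xJ yJ by blast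
      from regular_pair_not_separating[OF A B PA PB cover x y this] show ?thesis by blast
    qed
  qed
qed

end

section \<open>Prime chains, Krull dimension and the Zariski topology\<close>

lemma ereal_minus_one_le_iff: "(a::ereal) - 1 \<le> b \<longleftrightarrow> a \<le> b + 1"
  by (cases a; cases b) (auto simp: one_ereal_def)

lemma closedin_zariski:
  "closedin (zariski R) Z \<longleftrightarrow> (\<exists>E \<subseteq> carrier R. Z = {P \<in> prime_spec R. E \<subseteq> P})"
proof
  assume Z: "closedin (zariski R) Z"
  then obtain E where "E \<subseteq> carrier R" "prime_spec R - Z = {P \<in> prime_spec R. \<not> E \<subseteq> P}"
    unfolding closedin_def openin_zariski topspace_zariski by blast
  moreover have "Z \<subseteq> prime_spec R" using closedin_subset[OF Z] by (simp add: topspace_zariski)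
  ultimately have "E \<subseteq> carrier R" "Z = {P \<in> prime_spec R. E \<subseteq> P}" by blast+
  then show "\<exists>E \<subseteq> carrier R. Z = {P \<in> prime_spec R. E \<subseteq> P}" by blast
next
  assume "\<exists>E \<subseteq> carrier R. Z = {P \<in> prime_spec R. E \<subseteq> P}"
  then obtain E where E: "E \<subseteq> carrier R" "Z = {P \<in> prime_spec R. E \<subseteq> P}" by blast
  then have "prime_spec R - Z = {P \<in> prime_spec R. \<not> E \<subseteq> P}" by blast
  then have "openin (zariski R) (prime_spec R - Z)" unfolding openin_zariski using E(1) by blast
  then show "closedin (zariski R) Z" unfolding closedin_def topspace_zariski using E(2) by blast
qed

context cring
begin

definition primes_over :: "'a set \<Rightarrow> 'a set set" where
  "primes_over P = {Q \<in> prime_spec R. P \<subseteq> Q}"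

text \<open>A closed subset of the zero set of \<open>P\<close> that contains its generic point \<open>P\<close> is everything.\<close>

lemma irreducible_closure:
  assumes P: "P \<in> prime_spec R"
  shows "irreducible_space (subtopology (zariski R) (primes_over P))"
proof -
  have ts: "topspace (subtopology (zariski R) (primes_over P)) = primes_over P"
    by (auto simp: topspace_zariski primes_over_def)
  have PP: "P \<in> primes_over P" using P by (simp add: primes_over_def)
  have all: "A = primes_over P" if A: "closedin (subtopology (zariski R) (primes_over P)) A" "P \<in> A" for A
  proof -
    obtain T where T: "closedin (zariski R) T" "A = T \<inter> primes_over P"
      using A(1) unfolding closedin_subtopology by blast
    obtain E where "T = {Q \<in> prime_spec R. E \<subseteq> Q}" using T(1) unfolding closedin_zariski by blast
    then show ?thesis using A(2) T(2) by (auto simp: primes_over_def)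
  qed
  show ?thesis unfolding irreducible_space_def ts using PP all by blast
qed

text \<open>The list is allowed to be empty, which corresponds to dimension \<open>-1\<close>. This keeps a regular sequence
of length zero from being a special case later.\<close>

lemma top_dim_ge_prime_chain:
  assumes C: "C \<subseteq> carrier R" and Ps: "set Ps \<subseteq> prime_spec R" "sorted_wrt (\<subset>) Ps" "\<forall>P\<in>set Ps. C \<subseteq> P"
  shows "ereal (real (length Ps)) - 1 \<le> top_dim (subtopology (zariski R) {P \<in> prime_spec R. C \<subseteq> P})"
    (is "_ \<le> top_dim ?X")
proof (cases "Ps = []")
  case True
  have "- 1 \<le> top_dim ?X" unfolding top_dim_def by (rule Sup_upper) simp
  then show ?thesis using True by (simp add: one_ereal_def)
next
  case False
  define Zs where "Zs = rev (map primes_over Ps)"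
  have anti: "primes_over P' \<subset> primes_over P" if "P \<in> set Ps" "P' \<in> set Ps" "P \<subset> P'" for P P'
  proof -
    have "P \<in> primes_over P" "P \<notin> primes_over P'" using that Ps(1) by (auto simp: primes_over_def)
    moreover have "primes_over P' \<subseteq> primes_over P" using that(3) by (auto simp: primes_over_def)
    ultimately show ?thesis by blast
  qed
  have "irreducible_closed_chain ?X Zs"
    unfolding irreducible_closed_chain_def
  proof (intro conjI ballI)
    show "Zs \<noteq> []" using False by (simp add: Zs_def)
    show "sorted_wrt (\<subset>) Zs"
      unfolding Zs_def sorted_wrt_rev sorted_wrt_map
      by (rule sorted_wrt_mono_rel[OF _ Ps(2)]) (rule anti)
    fix Z assume "Z \<in> set Zs"
    then obtain P where P: "P \<in> set Ps" "Z = primes_over P" by (auto simp: Zs_def)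
    then have PS: "P \<in> prime_spec R" and CP: "C \<subseteq> P" using Ps by auto
    have sub: "Z \<subseteq> {P \<in> prime_spec R. C \<subseteq> P}" using CP P(2) by (auto simp: primes_over_def)
    have "closedin (zariski R) Z"
      unfolding closedin_zariski P(2) primes_over_def using prime_subset[OF PS] by blast
    then show "closedin ?X Z" using sub by (intro closedin_subset_topspace)
    show "irreducible_space (subtopology ?X Z)"
      using irreducible_closure[OF PS] sub P(2) by (simp add: subtopology_subtopology Int_absorb1)
  qed
  then have "ereal (real (length Zs - 1)) \<le> top_dim ?X"
    unfolding top_dim_def by (intro Sup_upper) blast
  moreover have "real (length Zs - 1) = real (length Ps) - 1"
    using False by (cases Ps) (auto simp: Zs_def)
  ultimately show ?thesis by (simp add: one_ereal_def)
qed

text \<open>Translates a separation of the open set \<open>D(C)\<close> into the language of ideals.\<close>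

lemma separation_of_complement:
  assumes C: "C \<subseteq> carrier R"
    and d: "disconnected_space (subtopology (zariski R) (topspace (zariski R) - {P \<in> prime_spec R. C \<subseteq> P}))"
    and n: "P0 \<in> prime_spec R" "\<not> C \<subseteq> P0"
  obtains A B PA PB where "A \<subseteq> carrier R" "B \<subseteq> carrier R"
    "PA \<in> prime_spec R" "\<not> A \<subseteq> PA" "PB \<in> prime_spec R" "\<not> B \<subseteq> PB"
    "\<forall>P\<in>prime_spec R. A \<subseteq> P \<or> B \<subseteq> P"
    "\<forall>P\<in>prime_spec R. A \<subseteq> P \<and> B \<subseteq> P \<longrightarrow> C \<subseteq> P"
proof -
  define U where "U = topspace (zariski R) - {P \<in> prime_spec R. C \<subseteq> P}"
  have U: "U = {P \<in> prime_spec R. \<not> C \<subseteq> P}" by (auto simp: U_def topspace_zariski)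
  have Uo: "openin (zariski R) U" unfolding U openin_zariski using C by blast
  have ts: "topspace (subtopology (zariski R) U) = U"
    using openin_subset[OF Uo] by auto
  have "U \<noteq> {}" using n U by blast
  then have "\<not> connected_space (subtopology (zariski R) U)"
    using d ts unfolding disconnected_space_def U_def[symmetric] by simp
  then obtain E1 E2 where E: "openin (subtopology (zariski R) U) E1" "openin (subtopology (zariski R) U) E2"
    "U \<subseteq> E1 \<union> E2" "E1 \<inter> E2 = {}" "E1 \<noteq> {}" "E2 \<noteq> {}"
    unfolding connected_space_def ts by blast
  then have o: "openin (zariski R) E1" "E1 \<subseteq> U" "openin (zariski R) E2" "E2 \<subseteq> U"
    using openin_open_subtopology[OF Uo] by auto
  obtain A where A: "A \<subseteq> carrier R" "E1 = {P \<in> prime_spec R. \<not> A \<subseteq> P}" using o(1) unfolding openin_zariski by (elim exE conjE)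
  obtain B where B: "B \<subseteq> carrier R" "E2 = {P \<in> prime_spec R. \<not> B \<subseteq> P}" using o(3) unfolding openin_zariski by (elim exE conjE)
  obtain PA where PA: "PA \<in> E1" using E(5) by blast
  obtain PB where PB: "PB \<in> E2" using E(6) by blast
  show thesis
  proof (rule that[OF A(1) B(1), of PA PB])
    show "PA \<in> prime_spec R" "\<not> A \<subseteq> PA" using PA A(2) by auto
    show "PB \<in> prime_spec R" "\<not> B \<subseteq> PB" using PB B(2) by auto
    show "\<forall>P\<in>prime_spec R. A \<subseteq> P \<or> B \<subseteq> P" using E(4) A(2) B(2) by blast
    show "\<forall>P\<in>prime_spec R. A \<subseteq> P \<and> B \<subseteq> P \<longrightarrow> C \<subseteq> P" using E(3) A(2) B(2) U by blast
  qed
qed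

lemma prime_quotient_image:
  assumes I: "ideal I R" and P: "P \<in> prime_spec R" and IP: "I \<subseteq> P"
  shows "(+>) I ` P \<in> prime_spec (R Quot I)" and "\<Union> ((+>) I ` P) = P"
proof -
  interpret I: ideal I R by (rule I)
  interpret Q: cring "R Quot I" by (rule I.quotient_is_cring[OF is_cring])
  show U: "\<Union> ((+>) I ` P) = P"
    using ideal_incl_iff[OF I prime_ideal[OF P]] IP by auto
  have idQ: "ideal ((+>) I ` P) (R Quot I)" by (rule ring_ideal_imp_quot_ideal[OF I prime_ideal[OF P]])
  have mem: "I +> a \<in> (+>) I ` P \<longleftrightarrow> a \<in> P" if "a \<in> carrier R" for a
    using canonical_proj_vimage_mem_iff[OF I ideal.Icarr[OF idQ, THEN subsetI] that] U by blast
  have rep: "\<exists>a\<in>carrier R. X = I +> a" if "X \<in> carrier (R Quot I)" for X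
    using that unfolding FactRing_def A_RCOSETS_def'[of R I] by auto
  have "primeideal ((+>) I ` P) (R Quot I)"
  proof (rule primeidealI[OF idQ Q.is_cring])
    have "I +> \<one> \<notin> (+>) I ` P" using mem[OF one_closed] prime_one[OF P] by simp
    moreover have "I +> \<one> \<in> carrier (R Quot I)" using ring_hom_closed[OF I.rcos_ring_hom one_closed] .
    ultimately show "carrier (R Quot I) \<noteq> (+>) I ` P" by blast
    fix X Y assume X: "X \<in> carrier (R Quot I)" and Y: "Y \<in> carrier (R Quot I)"
      and XY: "X \<otimes>\<^bsub>R Quot I\<^esub> Y \<in> (+>) I ` P"
    obtain a b where a: "a \<in> carrier R" "X = I +> a" and b: "b \<in> carrier R" "Y = I +> b"
      using rep[OF X] rep[OF Y] by blast
    have "I +> (a \<otimes> b) \<in> (+>) I ` P" using XY ring_hom_mult[OF I.rcos_ring_hom a(1) b(1)] a b by simp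
    then have "a \<otimes> b \<in> P" using mem a b by simp
    then show "X \<in> (+>) I ` P \<or> Y \<in> (+>) I ` P"
      using prime_mult_iff[OF P a(1) b(1)] mem a b by blast
  qed
  then show "(+>) I ` P \<in> prime_spec (R Quot I)" by (simp add: prime_spec_def)
qed

lemma krull_dim_quotient_ge:
  assumes I: "ideal I R" and Ps: "set Ps \<subseteq> prime_spec R" "sorted_wrt (\<subset>) Ps" "\<forall>P\<in>set Ps. I \<subseteq> P"
  shows "ereal (real (length Ps)) - 1 \<le> krull_dim (R Quot I)"
proof (cases "Ps = []")
  case True
  have "- 1 \<le> krull_dim (R Quot I)" unfolding krull_dim_def by (rule Sup_upper) simp
  then show ?thesis using True by (simp add: one_ereal_def)
next
  case False
  define Qs where "Qs = map ((`) ((+>) I)) Ps"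
  have sub: "(+>) I ` P \<subset> (+>) I ` P'" if "P \<in> set Ps" "P' \<in> set Ps" "P \<subset> P'" for P P'
  proof -
    have "\<Union> ((+>) I ` X) = X" if "X \<in> set Ps" for X
      using prime_quotient_image(2)[OF I subsetD[OF Ps(1) that] bspec[OF Ps(3) that]] .
    then have "(+>) I ` P \<noteq> (+>) I ` P'" using that by (metis less_irrefl)
    moreover have "(+>) I ` P \<subseteq> (+>) I ` P'" using that(3) by (intro image_mono) simp
    ultimately show ?thesis by simp
  qed
  have "prime_chain (R Quot I) Qs"
    unfolding prime_chain_def
  proof (intro conjI)
    show "Qs \<noteq> []" using False by (simp add: Qs_def)
    show "set Qs \<subseteq> prime_spec (R Quot I)" using prime_quotient_image(1)[OF I] Ps by (auto simp: Qs_def)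
    show "sorted_wrt (\<subset>) Qs" unfolding Qs_def sorted_wrt_map
      by (rule sorted_wrt_mono_rel[OF _ Ps(2)]) (rule sub)
  qed
  then have "ereal (real (length Qs - 1)) \<le> krull_dim (R Quot I)"
    unfolding krull_dim_def by (intro Sup_upper) blast
  moreover have "real (length Qs - 1) = real (length Ps) - 1"
    using False by (cases Ps) (auto simp: Qs_def)
  ultimately show ?thesis by (simp add: one_ereal_def)
qed

end

section \<open>Depth bounds the connectivity dimension\<close>

text \<open>A supremum of natural numbers that is only tested against a bounded value \<open>t\<close> behaves like a
maximum. This extracts one long regular sequence from a lower bound on the depth.\<close>

lemma Sup_of_lengths_attained:
  fixes f :: "'c \<Rightarrow> nat"
  assumes "t \<le> Sup {ereal (real (f x)) | x. Q x}" and t: "t \<le> ereal (real k)" and Q: "Q y"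
  shows "\<exists>x. Q x \<and> t \<le> ereal (real (f x))"
proof (rule ccontr)
  assume n: "\<not> ?thesis"
  then have lt: "ereal (real (f x)) < t" if "Q x" for x using that by (meson not_le)
  have bd: "f x < k" if "Q x" for x using less_le_trans[OF lt[OF that] t] by simp
  have "f ` Collect Q \<subseteq> {..<k}" using bd by auto
  then have "finite (f ` Collect Q)" by (rule finite_subset) simp
  moreover have "f ` Collect Q \<noteq> {}" using Q by auto
  ultimately have "Max (f ` Collect Q) \<in> f ` Collect Q" and le: "\<And>x. Q x \<Longrightarrow> f x \<le> Max (f ` Collect Q)"
    using Max_in Max_ge by auto
  then obtain x where x: "Q x" "Max (f ` Collect Q) = f x" by auto
  have "Sup {ereal (real (f x)) | x. Q x} \<le> ereal (real (f x))"
    using le x by (intro Sup_least) auto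
  then show False using assms(1) lt[OF x(1)] by simp
qed

context cring
begin

lemma nonzerodivisor_quotient:
  assumes J: "ideal J R" and x: "x \<in> carrier R" and nz: "nonzerodivisor (R Quot J) (J +> x)"
  shows "regular_mod J x"
  unfolding regular_mod_def
proof (intro conjI ballI impI x)
  fix y assume y: "y \<in> carrier R" "x \<otimes> y \<in> J"
  interpret J: ideal J R by (rule J)
  have yq: "J +> y \<in> carrier (R Quot J)"
    using y(1) ring_hom_closed[OF J.rcos_ring_hom] by blast
  have "(J +> x) \<otimes>\<^bsub>R Quot J\<^esub> (J +> y) = J +> (x \<otimes> y)"
    using ring_hom_mult[OF J.rcos_ring_hom x y(1)] by simp
  also have "\<dots> = J" using y(2) J.a_rcos_const by simp
  also have "\<dots> = \<zero>\<^bsub>R Quot J\<^esub>" by (simp add: FactRing_def)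
  finally have "J +> y = \<zero>\<^bsub>R Quot J\<^esub>" using nz yq unfolding nonzerodivisor_def by blast
  then have "J +> y = J" by (simp add: FactRing_def)
  then show "y \<in> J" using J.a_rcos_self[OF y(1)] by simp
qed

lemma regular_sequence_imp_mod:
  assumes "regular_sequence R xs"
  shows "regular_seq_mod {\<zero>} xs"
proof -
  have xc: "set xs \<subseteq> carrier R" using assms by (simp add: regular_sequence_def)
  have Idl_empty: "Idl {} = {\<zero>}"
    using genideal_minimal[OF zeroideal, of "{}"] ideal_zero[OF genideal_ideal[of "{}"]] by auto
  have reg: "regular_mod (Idl (set (take i xs))) (xs ! i)" if i: "i < length xs" for i
  proof (rule nonzerodivisor_quotient)
    show "ideal (Idl (set (take i xs))) R"
      using xc set_take_subset[of i xs] by (intro genideal_ideal) blast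
    show "xs ! i \<in> carrier R" using xc i nth_mem by blast
    show "nonzerodivisor (R Quot Idl (set (take i xs))) (Idl (set (take i xs)) +> xs ! i)"
      using assms i by (auto simp: regular_sequence_def Let_def)
  qed
  have "regular_seq_mod (Idl (set (take i xs))) (drop i xs)" if "i \<le> length xs" for i
    using that
  proof (induction i rule: inc_induct)
    case base
    then show ?case by simp
  next
    case (step i)
    have d: "drop i xs = xs ! i # drop (Suc i) xs" using step.hyps by (simp add: Cons_nth_drop_Suc)
    have t: "set (take (Suc i) xs) = insert (xs ! i) (set (take i xs))"
      using step.hyps by (simp add: take_Suc_conv_app_nth)
    have c: "set (take i xs) \<subseteq> carrier R" "xs ! i \<in> carrier R"
      using xc set_take_subset[of i xs] step.hyps nth_mem by blast+
    show ?case using reg[of i] step.hyps step.IH unfolding d t Idl_insert[OF c] by simp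
  qed
  from this[of 0] show ?thesis using Idl_empty by simp
qed

end

context noetherian_local_ring
begin

lemma depth_eq:
  "depth R = Sup {ereal (real (length xs)) | xs. regular_sequence R xs \<and> set xs \<subseteq> M}"
proof -
  have "(THE N. maximalideal N R) = M"
    using unique_maximal by (intro the_equality) blast+
  then show ?thesis by (simp add: depth_def)
qed

lemma depth_geD:
  assumes "t \<le> depth R" "t \<le> ereal (real k)"
  obtains xs where "regular_seq_mod {\<zero>} xs" "set xs \<subseteq> M" "t \<le> ereal (real (length xs))"
proof -
  have "regular_sequence R []"
  proof -
    have "Idl {} \<subseteq> M" by (rule genideal_minimal[OF ideal_M]) simp
    then have "Idl {} \<noteq> carrier R" using prime_one[OF M_prime] by blast
    then show ?thesis by (simp add: regular_sequence_def)
  qed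
  then have "\<exists>xs. (regular_sequence R xs \<and> set xs \<subseteq> M) \<and> t \<le> ereal (real (length xs))"
    using assms unfolding depth_eq by (intro Sup_of_lengths_attained[where y = "[]"]) auto
  then obtain xs where "regular_sequence R xs" "set xs \<subseteq> M" "t \<le> ereal (real (length xs))"
    by (elim exE conjE)
  then show thesis by (intro that regular_sequence_imp_mod)
qed

lemma one_not_zero: "\<one> \<notin> {\<zero>}"
  using prime_one[OF M_prime] ideal_zero[OF ideal_M] by auto

theorem connectivity_dim_ge_depth: "depth R - 1 \<le> connectivity_dim (zariski R)"
  unfolding connectivity_dim_def
proof (rule Inf_greatest, safe)
  fix Z assume Z: "closedin (zariski R) Z"
    and d: "disconnected_space (subtopology (zariski R) (topspace (zariski R) - Z))"
  obtain C where C: "C \<subseteq> carrier R" "Z = {P \<in> prime_spec R. C \<subseteq> P}" using Z unfolding closedin_zariski by (elim exE conjE)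
  have step: "ereal (real (length xs)) \<le> top_dim (subtopology (zariski R) Z) + 1"
    if xs: "regular_sequence R xs" "set xs \<subseteq> M" for xs
  proof -
    note reg = regular_sequence_imp_mod[OF xs(1)]
    have "\<exists>Ps. length xs \<le> length Ps \<and> set Ps \<subseteq> prime_spec R \<and> sorted_wrt (\<subset>) Ps \<and> (\<forall>P\<in>set Ps. C \<subseteq> P)"
    proof (cases "\<forall>P\<in>prime_spec R. C \<subseteq> P")
      case True
      have "\<exists>Ps. length Ps = Suc (length xs) \<and> set Ps \<subseteq> prime_spec R \<and> sorted_wrt (\<subset>) Ps \<and>
          (\<forall>P\<in>set Ps. {} \<subseteq> P)"
        by (rule prime_chain_over_annihilator[OF zeroideal _ one_closed one_not_zero _ reg xs(2)]) auto
      then show ?thesis using True by (elim exE) (rule exI, auto)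
    next
      case False
      then obtain P0 where P0: "P0 \<in> prime_spec R" "\<not> C \<subseteq> P0" by blast
      obtain A B PA PB where AB: "A \<subseteq> carrier R" "B \<subseteq> carrier R"
        "PA \<in> prime_spec R" "\<not> A \<subseteq> PA" "PB \<in> prime_spec R" "\<not> B \<subseteq> PB"
        and cover: "\<forall>P\<in>prime_spec R. A \<subseteq> P \<or> B \<subseteq> P"
        and V: "\<forall>P\<in>prime_spec R. A \<subseteq> P \<and> B \<subseteq> P \<longrightarrow> C \<subseteq> P"
        by (rule separation_of_complement[OF C(1) d[unfolded C(2)] P0]) (rule that)
      show ?thesis
        by (rule prime_chain_in_separating_set[OF reg xs(2) AB(1,2) C(1) AB(3-6)]) (use cover V in auto)
    qed
    then obtain Ps where Ps: "length xs \<le> length Ps" "set Ps \<subseteq> prime_spec R" "sorted_wrt (\<subset>) Ps"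
      "\<forall>P\<in>set Ps. C \<subseteq> P" by (elim exE conjE)
    have "ereal (real (length Ps)) - 1 \<le> top_dim (subtopology (zariski R) Z)"
      unfolding C(2) by (rule top_dim_ge_prime_chain[OF C(1) Ps(2-4)])
    then have "ereal (real (length Ps)) \<le> top_dim (subtopology (zariski R) Z) + 1"
      by (simp only: ereal_minus_one_le_iff)
    then show ?thesis using Ps(1) by (meson ereal_less_eq(3) of_nat_le_iff order_trans)
  qed
  have "depth R \<le> top_dim (subtopology (zariski R) Z) + 1"
    unfolding depth_eq by (rule Sup_least) (use step in blast)
  then show "depth R - 1 \<le> top_dim (subtopology (zariski R) Z)"
    by (simp only: ereal_minus_one_le_iff)
qed

end

section \<open>Linking the minimal primes of a local ring\<close>

lemma rtrancl_imp_list: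
  assumes "(x, y) \<in> r\<^sup>*" "x \<in> S" "r \<subseteq> S \<times> S"
  shows "\<exists>ps. ps \<noteq> [] \<and> hd ps = x \<and> last ps = y \<and> set ps \<subseteq> S \<and>
    (\<forall>i. Suc i < length ps \<longrightarrow> (ps ! i, ps ! Suc i) \<in> r)"
  using assms(1)
proof (induction rule: rtrancl_induct)
  case base
  then show ?case using assms(2) by (intro exI[of _ "[x]"]) auto
next
  case (step y z)
  then obtain ps where ps: "ps \<noteq> []" "hd ps = x" "last ps = y" "set ps \<subseteq> S"
    "\<forall>i. Suc i < length ps \<longrightarrow> (ps ! i, ps ! Suc i) \<in> r" by blast
  have "((ps @ [z]) ! i, (ps @ [z]) ! Suc i) \<in> r" if i: "Suc i < length (ps @ [z])" for i
  proof (cases "Suc i < length ps")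
    case True
    then show ?thesis using ps(5) by (simp add: nth_append)
  next
    case False
    then have "i = length ps - 1" using i ps(1) by auto
    then show ?thesis using ps(1,3) step.hyps(2) by (simp add: nth_append last_conv_nth)
  qed
  then show ?case using ps step.hyps(2) assms(3) by (intro exI[of _ "ps @ [z]"]) auto
qed

context noetherian_local_ring
begin

text \<open>Let \<open>\<A>\<close> be the minimal primes reachable from \<open>p\<close> and \<open>\<B>\<close> the others. If both are nonempty, the
intersections of the two classes have zero sets that cover the spectrum, and neither covers it
alone. The chain of primes in the common zero set begins with a prime above some \<open>q \<in> \<A>\<close> and some
\<open>q' \<in> \<B>\<close>, so \<open>q'\<close> would be reachable after all.\<close>

theorem minimal_primes_linked:
  assumes xs: "regular_seq_mod {\<zero>} xs" "set xs \<subseteq> M"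
    and p: "minimal_prime R p" and p': "minimal_prime R p'"
  shows "\<exists>ps. ps \<noteq> [] \<and> hd ps = p \<and> last ps = p' \<and> (\<forall>q\<in>set ps. minimal_prime R q) \<and>
    (\<forall>i. Suc i < length ps \<longrightarrow> (\<exists>Qs. length xs \<le> length Qs \<and> set Qs \<subseteq> prime_spec R \<and>
       sorted_wrt (\<subset>) Qs \<and> (\<forall>Q\<in>set Qs. ps ! i \<subseteq> Q \<and> ps ! Suc i \<subseteq> Q)))"
proof -
  define link where "link q q' \<longleftrightarrow> (\<exists>Qs. length xs \<le> length Qs \<and> set Qs \<subseteq> prime_spec R \<and>
       sorted_wrt (\<subset>) Qs \<and> (\<forall>Q\<in>set Qs. q \<subseteq> Q \<and> q' \<subseteq> Q))" for q q'
  define r where "r = {(q, q'). minimal_prime R q \<and> minimal_prime R q' \<and> link q q'}"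
  have "(p, p') \<in> r\<^sup>*"
  proof (rule ccontr)
    assume notin: "(p, p') \<notin> r\<^sup>*"
    define \<A> \<B> where "\<A> = {q. minimal_prime R q \<and> (p, q) \<in> r\<^sup>*}"
      and "\<B> = {q. minimal_prime R q \<and> (p, q) \<notin> r\<^sup>*}"
    have nlink: "\<not> link q q'" if "q \<in> \<A>" "q' \<in> \<B>" for q q'
    proof
      assume "link q q'"
      then have "(q, q') \<in> r" using that by (auto simp: r_def \<A>_def \<B>_def)
      then have "(p, q') \<in> r\<^sup>*" using that by (auto simp: \<A>_def intro: rtrancl_into_rtrancl)
      then show False using that by (simp add: \<B>_def)
    qed
    have pA: "p \<in> \<A>" using p by (simp add: \<A>_def)
    have pB: "p' \<in> \<B>" using p' notin by (simp add: \<B>_def)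
    have fin: "finite \<A>" "finite \<B>" unfolding \<A>_def \<B>_def
      by (rule finite_subset[OF _ finite_minimal_primes], blast)+
    have idl: "ideal q R" if "q \<in> \<A> \<or> q \<in> \<B>" for q
      using that prime_ideal[OF minimal_prime_prime] by (auto simp: \<A>_def \<B>_def)
    define A B where "A = {x \<in> carrier R. \<forall>q\<in>\<A>. x \<in> q}" and "B = {x \<in> carrier R. \<forall>q\<in>\<B>. x \<in> q}"
    have inA: "\<exists>q\<in>\<A>. q \<subseteq> P" if "P \<in> prime_spec R" "A \<subseteq> P" for P
      using prime_contains_factor[OF that(1) fin(1), of "\<lambda>q. q"] that(2) idl by (auto simp: A_def)
    have inB: "\<exists>q\<in>\<B>. q \<subseteq> P" if "P \<in> prime_spec R" "B \<subseteq> P" for P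
      using prime_contains_factor[OF that(1) fin(2), of "\<lambda>q. q"] that(2) idl by (auto simp: B_def)
    have nA: "\<not> A \<subseteq> p'"
    proof
      assume "A \<subseteq> p'"
      then obtain q where q: "q \<in> \<A>" "q \<subseteq> p'" using inA minimal_prime_prime[OF p'] by blast
      then have "q = p'" using minimal_primeD[OF p'] minimal_prime_prime by (auto simp: \<A>_def)
      then show False using q(1) notin by (simp add: \<A>_def)
    qed
    have nB: "\<not> B \<subseteq> p"
    proof
      assume "B \<subseteq> p"
      then obtain q where q: "q \<in> \<B>" "q \<subseteq> p" using inB minimal_prime_prime[OF p] by blast
      then have "q = p" using minimal_primeD[OF p] minimal_prime_prime by (auto simp: \<B>_def)
      then show False using q(1) by (simp add: \<B>_def)
    qed
    have cover: "A \<subseteq> P \<or> B \<subseteq> P" if P: "P \<in> prime_spec R" for P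
    proof -
      obtain q where q: "minimal_prime R q" "q \<subseteq> P" using minimal_prime_below[OF P] .
      then have "q \<in> \<A> \<or> q \<in> \<B>" by (simp add: \<A>_def \<B>_def)
      then show ?thesis using q(2) by (auto simp: A_def B_def)
    qed
    have AB: "A \<subseteq> carrier R" "B \<subseteq> carrier R" "A \<union> B \<subseteq> carrier R" by (auto simp: A_def B_def)
    have "\<exists>Qs. length xs \<le> length Qs \<and> set Qs \<subseteq> prime_spec R \<and> sorted_wrt (\<subset>) Qs \<and>
        (\<forall>P\<in>set Qs. A \<union> B \<subseteq> P)"
      by (rule prime_chain_in_separating_set[OF xs AB minimal_prime_prime[OF p'] nA
            minimal_prime_prime[OF p] nB cover]) auto
    then obtain Qs where Qs: "length xs \<le> length Qs" "set Qs \<subseteq> prime_spec R" "sorted_wrt (\<subset>) Qs"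
      "\<forall>P\<in>set Qs. A \<union> B \<subseteq> P" by (elim exE conjE)
    show False
    proof (cases Qs)
      case Nil
      then have "link p p'" using Qs(1) unfolding link_def by (intro exI[of _ "[]"]) simp
      then show False using nlink pA pB by blast
    next
      case (Cons Q0 Qs')
      then have Q0: "Q0 \<in> prime_spec R" "A \<subseteq> Q0" "B \<subseteq> Q0" and least: "\<forall>Q\<in>set Qs. Q0 \<subseteq> Q"
        using Qs by auto
      obtain q where q: "q \<in> \<A>" "q \<subseteq> Q0" using inA Q0 by blast
      obtain q' where q': "q' \<in> \<B>" "q' \<subseteq> Q0" using inB Q0 by blast
      have "link q q'" unfolding link_def using Qs least q(2) q'(2) by (intro exI[of _ Qs]) blast
      then show False using nlink q(1) q'(1) by blast
    qed
  qed
  moreover have "p \<in> {q. minimal_prime R q}" using p by simp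
  moreover have "r \<subseteq> {q. minimal_prime R q} \<times> {q. minimal_prime R q}" by (auto simp: r_def)
  ultimately obtain ps where "ps \<noteq> []" "hd ps = p" "last ps = p'" "set ps \<subseteq> {q. minimal_prime R q}"
    "\<forall>i. Suc i < length ps \<longrightarrow> (ps ! i, ps ! Suc i) \<in> r" using rtrancl_imp_list by metis
  then show ?thesis by (intro exI[of _ ps]) (auto simp: r_def link_def)
qed

end

section \<open>Passing to a localization\<close>

context noetherian_cring
begin

definition contraction :: "'a set \<Rightarrow> ('a \<times> 'a) set set \<Rightarrow> 'a set" where
  "contraction P q = {a \<in> carrier R. fraction R P a \<one> \<in> q}"

definition extension :: "'a set \<Rightarrow> 'a set \<Rightarrow> ('a \<times> 'a) set set" where
  "extension P Q = {fraction R P a s | a s. a \<in> Q \<and> s \<in> carrier R - P}"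

context
  fixes P
  assumes P: "primeideal P R"
begin

interpretation P: primeideal P R by (rule P)
interpretation L: cring "localization R P" by (rule P.localization_cring)

lemma fraction_closed: "a \<in> carrier R \<Longrightarrow> s \<in> carrier R - P \<Longrightarrow> fraction R P a s \<in> carrier (localization R P)"
  unfolding P.localization_carrier by blast

lemma localization_elim:
  assumes "X \<in> carrier (localization R P)"
  obtains a s where "a \<in> carrier R" "s \<in> carrier R - P" "X = fraction R P a s"
  using assms unfolding P.localization_carrier by blast

lemma fraction_eq_mult:
  assumes "a \<in> carrier R" "s \<in> carrier R - P"
  shows "fraction R P a s = fraction R P \<one> s \<otimes>\<^bsub>localization R P\<^esub> fraction R P a \<one>"
  using assms P.compl_one by (simp add: P.localization_mult)

lemma fraction_one_eq_mult:
  assumes "a \<in> carrier R" "s \<in> carrier R - P"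
  shows "fraction R P a \<one> = fraction R P s \<one> \<otimes>\<^bsub>localization R P\<^esub> fraction R P a s"
proof -
  have "fraction R P s \<one> \<otimes>\<^bsub>localization R P\<^esub> fraction R P a s = fraction R P (s \<otimes> a) (\<one> \<otimes> s)"
    using assms P.compl_one by (intro P.localization_mult) auto
  also have "\<dots> = fraction R P a \<one>"
    using assms P.compl_one by (intro P.fraction_cong[OF _ _ _ _ P.compl_one]) (auto simp: m_comm)
  finally show ?thesis by simp
qed

lemma hom_localization: "ring_hom_ring R (localization R P) (\<lambda>a. fraction R P a \<one>)"
proof (rule ring_hom_ringI)
  show "ring R" "ring (localization R P)" by (rule ring_axioms, rule L.ring_axioms)
  show "fraction R P a \<one> \<in> carrier (localization R P)" if "a \<in> carrier R" for a
    by (rule fraction_closed[OF that P.compl_one])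
  show "fraction R P (a \<otimes> b) \<one> = fraction R P a \<one> \<otimes>\<^bsub>localization R P\<^esub> fraction R P b \<one>"
    if "a \<in> carrier R" "b \<in> carrier R" for a b
    using that P.compl_one by (simp add: P.localization_mult)
  show "fraction R P (a \<oplus> b) \<one> = fraction R P a \<one> \<oplus>\<^bsub>localization R P\<^esub> fraction R P b \<one>"
    if "a \<in> carrier R" "b \<in> carrier R" for a b
    using that P.compl_one by (simp add: P.localization_add)
  show "fraction R P \<one> \<one> = \<one>\<^bsub>localization R P\<^esub>" by (simp add: P.localization_one)
qed

lemma ideal_contraction: "ideal q (localization R P) \<Longrightarrow> ideal (contraction P q) R"
  unfolding contraction_def by (rule ring_hom_ring.ideal_vimage[OF hom_localization])

lemma fraction_mem_iff:
  assumes q: "ideal q (localization R P)" and a: "a \<in> carrier R" "s \<in> carrier R - P"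
  shows "fraction R P a s \<in> q \<longleftrightarrow> a \<in> contraction P q"
proof
  have sc: "s \<in> carrier R" using a(2) by blast
  show "a \<in> contraction P q" if "fraction R P a s \<in> q"
    using a(1) ideal.I_l_closed[OF q that fraction_closed[OF sc P.compl_one]]
    by (simp add: contraction_def fraction_one_eq_mult[OF a, symmetric])
  show "fraction R P a s \<in> q" if "a \<in> contraction P q"
    using that ideal.I_l_closed[OF q _ fraction_closed[OF one_closed a(2)]]
    by (subst fraction_eq_mult[OF a]) (simp add: contraction_def)
qed

text \<open>An ideal of the localization is determined by its contraction, because denominators are units.\<close>

lemma ideal_subset_by_contraction:
  assumes q: "ideal q (localization R P)" and q': "ideal q' (localization R P)"
    and e: "contraction P q \<subseteq> contraction P q'"
  shows "q \<subseteq> q'"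
proof
  fix X assume X: "X \<in> q"
  obtain a s where a: "a \<in> carrier R" "s \<in> carrier R - P" "X = fraction R P a s"
    using localization_elim[OF ideal.Icarr[OF q X]] .
  then show "X \<in> q'" using X e fraction_mem_iff[OF q a(1,2)] fraction_mem_iff[OF q' a(1,2)] by blast
qed

lemma noetherian_localization: "noetherian_cring (localization R P)"
proof -
  have "noetherian_ring (localization R P)"
  proof (rule L.noetherian_ringI)
    fix q assume q: "ideal q (localization R P)"
    obtain S where S: "S \<subseteq> carrier R" "finite S" "contraction P q = Idl S"
      using finetely_gen[OF ideal_contraction[OF q]] by blast
    define T where "T = (\<lambda>a. fraction R P a \<one>) ` S"
    have T: "T \<subseteq> carrier (localization R P)"
      using S(1) fraction_closed[OF _ P.compl_one] by (auto simp: T_def)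
    have idT: "ideal (Idl\<^bsub>localization R P\<^esub> T) (localization R P)" by (rule L.genideal_ideal[OF T])
    have "S \<subseteq> contraction P (Idl\<^bsub>localization R P\<^esub> T)"
      using L.genideal_self[OF T] S(1) by (auto simp: contraction_def T_def)
    then have "Idl S \<subseteq> contraction P (Idl\<^bsub>localization R P\<^esub> T)"
      by (intro genideal_minimal ideal_contraction idT)
    then have "q \<subseteq> Idl\<^bsub>localization R P\<^esub> T" using S(3) by (intro ideal_subset_by_contraction q idT) simp
    moreover have "T \<subseteq> q" using genideal_self[OF S(1)] S(3) by (auto simp: T_def contraction_def)
    then have "Idl\<^bsub>localization R P\<^esub> T \<subseteq> q" by (rule L.genideal_minimal[OF q])
    ultimately have "q = Idl\<^bsub>localization R P\<^esub> T" by blast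
    moreover have "finite T" using S(2) by (simp add: T_def)
    ultimately show "\<exists>A\<subseteq>carrier (localization R P). finite A \<and> q = Idl\<^bsub>localization R P\<^esub> A"
      using T by blast
  qed
  then show ?thesis unfolding noetherian_cring_def using L.cring_axioms by (rule conjI)
qed

lemma noetherian_local_localization:
  "\<exists>N. noetherian_local_ring (localization R P) N"
proof -
  have "noetherian_local_ring (localization R P) {fraction R P a s | a s. a \<in> P \<and> s \<in> carrier R - P}"
    unfolding noetherian_local_ring_def noetherian_local_ring_axioms_def
    using noetherian_localization P.localization_local unfolding local_ring_def by blast
  then show ?thesis by blast
qed

lemma prime_contraction:
  assumes q: "q \<in> prime_spec (localization R P)"
  shows "contraction P q \<in> prime_spec R" "contraction P q \<subseteq> P"
proof -
  show "contraction P q \<in> prime_spec R"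
    using ring_hom_ring.primeideal_vimage[OF hom_localization is_cring] q
    unfolding contraction_def prime_spec_def by simp
  show "contraction P q \<subseteq> P"
  proof (rule ccontr)
    assume "\<not> contraction P q \<subseteq> P"
    then obtain s where s: "s \<in> carrier R - P" "s \<in> contraction P q" by (auto simp: contraction_def)
    have "fraction R P s s \<in> q" using fraction_mem_iff[OF L.prime_ideal[OF q], of s s] s by blast
    moreover have "fraction R P s s = \<one>\<^bsub>localization R P\<^esub>" unfolding P.localization_one
      using s P.compl_one by (intro P.fraction_cong[OF _ _ _ _ P.compl_one]) (auto simp: m_comm)
    ultimately show False using L.prime_one[OF q] by simp
  qed
qed

lemma mem_extension_iff:
  assumes Q: "Q \<in> prime_spec R" "Q \<subseteq> P" and a: "a \<in> carrier R" "s \<in> carrier R - P"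
  shows "fraction R P a s \<in> extension P Q \<longleftrightarrow> a \<in> Q"
proof
  assume "fraction R P a s \<in> extension P Q"
  then obtain b t where b: "b \<in> Q" "t \<in> carrier R - P" "fraction R P a s = fraction R P b t"
    unfolding extension_def by blast
  have bc: "b \<in> carrier R" using b(1) prime_subset[OF Q(1)] by blast
  obtain u where u: "u \<in> carrier R - P" "u \<otimes> (a \<otimes> t) = u \<otimes> (b \<otimes> s)"
    using P.fraction_eq_iff[OF a bc b(2)] b(3) by blast
  have "u \<otimes> (b \<otimes> s) \<in> Q" using u(1) a(2) b(1) bc by (simp add: prime_mult_iff[OF Q(1)])
  then have "u \<otimes> (a \<otimes> t) \<in> Q" using u(2) by simp
  then show "a \<in> Q" using u(1) a b(2) Q(2) by (auto simp: prime_mult_iff[OF Q(1)])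
next
  show "a \<in> Q \<Longrightarrow> fraction R P a s \<in> extension P Q" using a unfolding extension_def by blast
qed

lemma prime_extension:
  assumes Q: "Q \<in> prime_spec R" "Q \<subseteq> P"
  shows "extension P Q \<in> prime_spec (localization R P)" "contraction P (extension P Q) = Q"
proof -
  note mem = mem_extension_iff[OF Q]
  have Qc: "Q \<subseteq> carrier R" by (rule prime_subset[OF Q(1)])
  have "primeideal (extension P Q) (localization R P)"
  proof (rule primeidealI)
    show "cring (localization R P)" by (rule L.is_cring)
    show "ideal (extension P Q) (localization R P)"
    proof (rule L.idealI_comm)
      show "extension P Q \<subseteq> carrier (localization R P)"
        unfolding extension_def using Qc fraction_closed by blast
      show "\<zero>\<^bsub>localization R P\<^esub> \<in> extension P Q"
        unfolding P.localization_zero mem[OF zero_closed P.compl_one]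
        by (rule ideal_zero[OF prime_ideal[OF Q(1)]])
      show "X \<oplus>\<^bsub>localization R P\<^esub> Y \<in> extension P Q" if X: "X \<in> extension P Q" and Y: "Y \<in> extension P Q" for X Y
      proof -
        obtain a s where a: "a \<in> Q" "s \<in> carrier R - P" "X = fraction R P a s"
          using X unfolding extension_def by blast
        obtain b t where b: "b \<in> Q" "t \<in> carrier R - P" "Y = fraction R P b t"
          using Y unfolding extension_def by blast
        have c: "a \<in> carrier R" "b \<in> carrier R" "s \<in> carrier R" "t \<in> carrier R" using a b Qc by auto
        have "a \<otimes> t \<oplus> b \<otimes> s \<in> Q"
          by (intro ideal_add ideal.I_r_closed prime_ideal Q(1) a(1) b(1) c)
        moreover have "X \<oplus>\<^bsub>localization R P\<^esub> Y = fraction R P (a \<otimes> t \<oplus> b \<otimes> s) (s \<otimes> t)"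
          unfolding a(3) b(3) by (rule P.localization_add[OF c(1) a(2) c(2) b(2)])
        ultimately show ?thesis using mem[OF _ P.compl_mult[OF a(2) b(2)]] c by simp
      qed
      show "Y \<otimes>\<^bsub>localization R P\<^esub> X \<in> extension P Q"
        if Y: "Y \<in> carrier (localization R P)" and X: "X \<in> extension P Q" for X Y
      proof -
        obtain a s where a: "a \<in> Q" "s \<in> carrier R - P" "X = fraction R P a s"
          using X unfolding extension_def by blast
        obtain b t where b: "b \<in> carrier R" "t \<in> carrier R - P" "Y = fraction R P b t"
          by (rule localization_elim[OF Y])
        have c: "a \<in> carrier R" using a Qc by auto
        have "b \<otimes> a \<in> Q" by (rule ideal.I_l_closed[OF prime_ideal[OF Q(1)] a(1) b(1)])
        moreover have "Y \<otimes>\<^bsub>localization R P\<^esub> X = fraction R P (b \<otimes> a) (t \<otimes> s)"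
          unfolding a(3) b(3) by (rule P.localization_mult[OF b(1,2) c a(2)])
        ultimately show ?thesis using mem[OF _ P.compl_mult[OF b(2) a(2)]] c b(1) by simp
      qed
    qed
    have "\<one>\<^bsub>localization R P\<^esub> \<notin> extension P Q"
      unfolding P.localization_one mem[OF one_closed P.compl_one] by (rule prime_one[OF Q(1)])
    then show "carrier (localization R P) \<noteq> extension P Q" using L.one_closed by metis
    fix X Y assume X: "X \<in> carrier (localization R P)" and Y: "Y \<in> carrier (localization R P)"
      and XY: "X \<otimes>\<^bsub>localization R P\<^esub> Y \<in> extension P Q"
    obtain a s where a: "a \<in> carrier R" "s \<in> carrier R - P" "X = fraction R P a s"
      by (rule localization_elim[OF X])
    obtain b t where b: "b \<in> carrier R" "t \<in> carrier R - P" "Y = fraction R P b t"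
      by (rule localization_elim[OF Y])
    have "fraction R P (a \<otimes> b) (s \<otimes> t) \<in> extension P Q"
      using XY unfolding a(3) b(3) P.localization_mult[OF a(1,2) b(1,2)] .
    then have "a \<otimes> b \<in> Q" using mem[OF _ P.compl_mult[OF a(2) b(2)]] a b by simp
    then have "a \<in> Q \<or> b \<in> Q" using prime_mult_iff[OF Q(1) a(1) b(1)] by simp
    then show "X \<in> extension P Q \<or> Y \<in> extension P Q"
      unfolding a(3) b(3) mem[OF a(1,2)] mem[OF b(1,2)] .
  qed
  then show "extension P Q \<in> prime_spec (localization R P)" by (simp add: prime_spec_def)
  show "contraction P (extension P Q) = Q"
    unfolding contraction_def using mem[OF _ P.compl_one] Qc by blast
qed

lemma contraction_strict_mono:
  assumes "q \<in> prime_spec (localization R P)" "q' \<in> prime_spec (localization R P)" "q \<subset> q'"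
  shows "contraction P q \<subset> contraction P q'"
proof -
  have "contraction P q \<subseteq> contraction P q'" using assms(3) by (auto simp: contraction_def)
  moreover have "\<not> contraction P q' \<subseteq> contraction P q"
    using ideal_subset_by_contraction[OF L.prime_ideal[OF assms(2)] L.prime_ideal[OF assms(1)]] assms(3) by blast
  ultimately show ?thesis by blast
qed

lemma minimal_prime_extension:
  assumes Q: "minimal_prime R Q" "Q \<subseteq> P"
  shows "minimal_prime (localization R P) (extension P Q)"
  unfolding minimal_prime_def
proof (intro conjI notI)
  note QS = minimal_prime_prime[OF Q(1)]
  show "extension P Q \<in> prime_spec (localization R P)" by (rule prime_extension(1)[OF QS Q(2)])
  assume "\<exists>q\<in>prime_spec (localization R P). q \<subset> extension P Q"
  then obtain q where q: "q \<in> prime_spec (localization R P)" "q \<subset> extension P Q" by blast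
  have "contraction P q \<subset> Q"
    using contraction_strict_mono[OF q(1) prime_extension(1)[OF QS Q(2)] q(2)]
    unfolding prime_extension(2)[OF QS Q(2)] .
  then show False using Q(1) prime_contraction(1)[OF q(1)] by (auto simp: minimal_prime_def)
qed

lemma minimal_prime_contraction:
  assumes q: "minimal_prime (localization R P) q"
  shows "minimal_prime R (contraction P q)"
  unfolding minimal_prime_def
proof (intro conjI notI)
  have qS: "q \<in> prime_spec (localization R P)" using q by (simp add: minimal_prime_def)
  show "contraction P q \<in> prime_spec R" by (rule prime_contraction(1)[OF qS])
  assume "\<exists>Q\<in>prime_spec R. Q \<subset> contraction P q"
  then obtain Q where Q: "Q \<in> prime_spec R" "Q \<subset> contraction P q" by blast
  have QP: "Q \<subseteq> P" using Q(2) prime_contraction(2)[OF qS] by blast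
  note E = prime_extension[OF Q(1) QP]
  have "extension P Q \<subseteq> q"
    using E(2) Q(2) by (intro ideal_subset_by_contraction L.prime_ideal E(1) qS) simp
  moreover have "extension P Q \<noteq> q" using E(2) Q(2) by auto
  ultimately show False using q E(1) by (auto simp: minimal_prime_def)
qed

lemma height_le_krull_dim_localization: "height R P \<le> krull_dim (localization R P)"
  unfolding height_def
proof (rule Sup_least)
  fix y assume "y \<in> {ereal (real (length Ps - 1)) | Ps. prime_chain R Ps \<and> last Ps = P}"
  then obtain Ps where y: "y = ereal (real (length Ps - 1))" and Ps: "prime_chain R Ps" "last Ps = P"
    by blast
  have ne: "Ps \<noteq> []" and S: "set Ps \<subseteq> prime_spec R" and so: "sorted_wrt (\<subset>) Ps"
    using Ps(1) by (auto simp: prime_chain_def)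
  have le: "Q \<subseteq> P" if "Q \<in> set Ps" for Q
  proof -
    have "sorted_wrt (\<subset>) (butlast Ps @ [last Ps])" using so ne by simp
    moreover have "Q \<in> set (butlast Ps @ [last Ps])" using that ne by simp
    ultimately show ?thesis unfolding Ps(2) sorted_wrt_append by auto
  qed
  have "prime_chain (localization R P) (map (extension P) Ps)"
    unfolding prime_chain_def
  proof (intro conjI)
    show "map (extension P) Ps \<noteq> []" using ne by simp
    show "set (map (extension P) Ps) \<subseteq> prime_spec (localization R P)"
      using prime_extension(1)[OF subsetD[OF S] le] by auto
    show "sorted_wrt (\<subset>) (map (extension P) Ps)" unfolding sorted_wrt_map
    proof (rule sorted_wrt_mono_rel[OF _ so])
      fix Q Q' assume Q: "Q \<in> set Ps" "Q' \<in> set Ps" "Q \<subset> Q'"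
      have "contraction P (extension P Q) = Q" "contraction P (extension P Q') = Q'"
        by (rule prime_extension(2)[OF subsetD[OF S] le]; fact Q)+
      then have "extension P Q \<noteq> extension P Q'" using Q(3) by (metis less_irrefl)
      moreover have "extension P Q \<subseteq> extension P Q'" using Q(3) by (auto simp: extension_def)
      ultimately show "extension P Q \<subset> extension P Q'" by blast
    qed
  qed
  then have "ereal (real (length (map (extension P) Ps) - 1)) \<le> krull_dim (localization R P)"
    unfolding krull_dim_def by (intro Sup_upper) blast
  then show "y \<le> krull_dim (localization R P)" by (simp add: y)
qed

text \<open>The previous linking result in the localization at \<open>P\<close>, contracted to \<open>R\<close>. The links stay below
\<open>P\<close>, which is needed to contradict the minimality of \<open>P\<close> in \<open>codim_one_crossing\<close>.\<close>

lemma minimal_primes_linked_below_prime: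
  assumes S: "serre_condition R k"
    and p: "minimal_prime R p" "p \<subseteq> P" and p': "minimal_prime R p'" "p' \<subseteq> P"
  shows "\<exists>ps. ps \<noteq> [] \<and> hd ps = p \<and> last ps = p' \<and> (\<forall>q\<in>set ps. minimal_prime R q \<and> q \<subseteq> P) \<and>
    (\<forall>i. Suc i < length ps \<longrightarrow> (\<exists>Qs. min (ereal (real k)) (height R P) \<le> ereal (real (length Qs)) \<and>
       set Qs \<subseteq> prime_spec R \<and> sorted_wrt (\<subset>) Qs \<and>
       (\<forall>Q\<in>set Qs. ps ! i \<subseteq> Q \<and> ps ! Suc i \<subseteq> Q \<and> Q \<subseteq> P)))"
proof -
  let ?L = "localization R P" and ?t = "min (ereal (real k)) (height R P)"
  obtain N where "noetherian_local_ring ?L N" using noetherian_local_localization by blast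
  then interpret LL: noetherian_local_ring ?L N .
  have "min (ereal (real k)) (krull_dim ?L) \<le> depth ?L"
    using S P by (simp add: serre_condition_def prime_spec_def)
  then have "?t \<le> depth ?L" using height_le_krull_dim_localization
    by (meson min.mono order.refl order_trans)
  moreover have "?t \<le> ereal (real k)" by simp
  ultimately obtain xs where xs: "L.regular_seq_mod {\<zero>\<^bsub>?L\<^esub>} xs" "set xs \<subseteq> N" "?t \<le> ereal (real (length xs))"
    by (rule LL.depth_geD)
  obtain qs where qs: "qs \<noteq> []" "hd qs = extension P p" "last qs = extension P p'"
    "\<forall>q\<in>set qs. minimal_prime ?L q"
    and link: "\<forall>i. Suc i < length qs \<longrightarrow> (\<exists>Qs. length xs \<le> length Qs \<and> set Qs \<subseteq> prime_spec ?L \<and>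
       sorted_wrt (\<subset>) Qs \<and> (\<forall>Q\<in>set Qs. qs ! i \<subseteq> Q \<and> qs ! Suc i \<subseteq> Q))"
    using LL.minimal_primes_linked[OF xs(1,2) minimal_prime_extension[OF p] minimal_prime_extension[OF p']]
    by (elim exE conjE)
  define ps where "ps = map (contraction P) qs"
  have c: "contraction P (extension P p) = p" "contraction P (extension P p') = p'"
    by (intro prime_extension(2) minimal_prime_prime p p')+
  show ?thesis
  proof (rule exI[of _ ps], intro conjI allI impI ballI)
    show "ps \<noteq> []" "hd ps = p" "last ps = p'" using qs(1-3) c by (simp_all add: ps_def hd_map last_map)
    fix q assume "q \<in> set ps"
    then obtain q' where q': "q' \<in> set qs" "q = contraction P q'" by (auto simp: ps_def)
    show "minimal_prime R q" using minimal_prime_contraction qs(4) q' by simp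
    show "q \<subseteq> P" using prime_contraction(2) LL.minimal_prime_prime qs(4) q' by simp
  next
    fix i assume i: "Suc i < length ps"
    then have "Suc i < length qs" by (simp add: ps_def)
    then obtain Qs where Qs: "length xs \<le> length Qs" "set Qs \<subseteq> prime_spec ?L" "sorted_wrt (\<subset>) Qs"
      "\<forall>Q\<in>set Qs. qs ! i \<subseteq> Q \<and> qs ! Suc i \<subseteq> Q" using link by blast
    have psi: "ps ! i = contraction P (qs ! i)" "ps ! Suc i = contraction P (qs ! Suc i)"
      using i by (auto simp: ps_def)
    show "\<exists>Qs. ?t \<le> ereal (real (length Qs)) \<and> set Qs \<subseteq> prime_spec R \<and> sorted_wrt (\<subset>) Qs \<and>
       (\<forall>Q\<in>set Qs. ps ! i \<subseteq> Q \<and> ps ! Suc i \<subseteq> Q \<and> Q \<subseteq> P)"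
    proof (intro exI[of _ "map (contraction P) Qs"] conjI)
      show "?t \<le> ereal (real (length (map (contraction P) Qs)))"
        using xs(3) Qs(1) by (simp only: length_map) (meson ereal_less_eq(3) of_nat_le_iff order_trans)
      show "set (map (contraction P) Qs) \<subseteq> prime_spec R" using prime_contraction(1) Qs(2) by auto
      show "sorted_wrt (\<subset>) (map (contraction P) Qs)" unfolding sorted_wrt_map
        by (rule sorted_wrt_mono_rel[OF _ Qs(3)], rule contraction_strict_mono) (use Qs(2) in auto)
      show "\<forall>Q\<in>set (map (contraction P) Qs). ps ! i \<subseteq> Q \<and> ps ! Suc i \<subseteq> Q \<and> Q \<subseteq> P"
      proof
        fix Q assume "Q \<in> set (map (contraction P) Qs)"
        then obtain q where q: "q \<in> set Qs" "Q = contraction P q" by auto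
        have "Q \<subseteq> P" unfolding q(2) by (rule prime_contraction(2)[OF subsetD[OF Qs(2) q(1)]])
        moreover have "ps ! i \<subseteq> Q \<and> ps ! Suc i \<subseteq> Q"
          unfolding psi q(2) using bspec[OF Qs(4) q(1)] by (auto simp: contraction_def)
        ultimately show "ps ! i \<subseteq> Q \<and> ps ! Suc i \<subseteq> Q \<and> Q \<subseteq> P" by blast
      qed
    qed
  qed
qed

end

end

section \<open>Connectedness in codimension one\<close>

lemma crossing_index:
  assumes "ps \<noteq> []" "hd ps \<in> S" "last ps \<notin> S"
  shows "\<exists>i. Suc i < length ps \<and> ps ! i \<in> S \<and> ps ! Suc i \<notin> S"
proof (rule ccontr)
  assume n: "\<not> ?thesis"
  have "ps ! i \<in> S" if "i < length ps" for i
    using that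
  proof (induction i)
    case 0
    then show ?case using assms(1,2) by (simp add: hd_conv_nth)
  next
    case (Suc i)
    then show ?case using n by auto
  qed
  then show False using assms(1,3) by (simp add: last_conv_nth)
qed

lemma prime_chain_insert:
  assumes Ps: "prime_chain R Ps" and i: "Suc i < length Ps"
    and Q: "Q \<in> prime_spec R" "Ps ! i \<subset> Q" "Q \<subset> Ps ! Suc i"
  defines "Qs \<equiv> take (Suc i) Ps @ Q # drop (Suc i) Ps"
  shows "prime_chain R Qs" "hd Qs = hd Ps" "last Qs = last Ps" "length Qs = Suc (length Ps)"
proof -
  have so: "sorted_wrt (\<subset>) Ps" and S: "set Ps \<subseteq> prime_spec R" using Ps by (auto simp: prime_chain_def)
  have mono: "Ps ! j \<subseteq> Ps ! k" if "j \<le> k" "k < length Ps" for j k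
    using sorted_wrt_nth_less[OF so, of j k] that by (cases "j = k") auto
  have lo: "X \<subset> Q" if X: "X \<in> set (take (Suc i) Ps)" for X
  proof -
    obtain j where "j < Suc i" "X = Ps ! j" using X i by (auto simp: in_set_conv_nth)
    then show ?thesis using mono[of j i] i Q(2) by auto
  qed
  have hi: "Q \<subset> X" if X: "X \<in> set (drop (Suc i) Ps)" for X
  proof -
    obtain j where "j < length (drop (Suc i) Ps)" "drop (Suc i) Ps ! j = X"
      using X unfolding in_set_conv_nth by blast
    then have "Suc i + j < length Ps" "X = Ps ! (Suc i + j)" using i by auto
    then show ?thesis using mono[of "Suc i" "Suc i + j"] Q(3) by auto
  qed
  have "sorted_wrt (\<subset>) (take (Suc i) Ps @ drop (Suc i) Ps)" using so by simp
  then have "sorted_wrt (\<subset>) Qs" unfolding Qs_def sorted_wrt_append using lo hi by auto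
  moreover have "set Qs \<subseteq> prime_spec R"
    using S Q(1) set_take_subset[of "Suc i" Ps] set_drop_subset[of "Suc i" Ps] by (auto simp: Qs_def)
  ultimately show "prime_chain R Qs" by (simp add: prime_chain_def Qs_def)
  show "hd Qs = hd Ps" using i by (cases Ps) (auto simp: Qs_def)
  show "last Qs = last Ps" using i by (auto simp: Qs_def)
  show "length Qs = Suc (length Ps)" using i by (simp add: Qs_def)
qed

text \<open>A chain of maximal length is saturated, as otherwise a prime could be inserted. Hence the common
length of the saturated chains bounds the length of every chain.\<close>

lemma catenary_chain_length:
  assumes cat: "catenary R" and P: "P \<in> prime_spec R" and Q: "Q \<in> prime_spec R" and PQ: "P \<subseteq> Q"
  obtains n where "\<exists>Ps. saturated_prime_chain R Ps \<and> hd Ps = P \<and> last Ps = Q \<and> length Ps = n"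
    "\<forall>Ps. saturated_prime_chain R Ps \<and> hd Ps = P \<and> last Ps = Q \<longrightarrow> length Ps = n"
    "\<forall>Ps. prime_chain R Ps \<and> hd Ps = P \<and> last Ps = Q \<longrightarrow> length Ps \<le> n"
proof -
  define chain where "chain Ps \<longleftrightarrow> prime_chain R Ps \<and> hd Ps = P \<and> last Ps = Q" for Ps
  obtain N where N: "\<And>Ps. chain Ps \<Longrightarrow> length Ps \<le> N"
    and eq: "\<And>Ps Ps'. saturated_prime_chain R Ps \<and> hd Ps = P \<and> last Ps = Q \<and>
        saturated_prime_chain R Ps' \<and> hd Ps' = P \<and> last Ps' = Q \<Longrightarrow> length Ps = length Ps'"
    using cat P Q PQ unfolding catenary_def chain_def by meson
  have "chain (if P = Q then [P] else [P, Q])"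
    using P Q PQ by (auto simp: chain_def prime_chain_def)
  then obtain Ps where Ps: "chain Ps" and max: "\<And>Qs. chain Qs \<Longrightarrow> length Qs \<le> length Ps"
    using ex_has_greatest_nat[of chain _ length "Suc N"] N by (metis less_Suc_eq_le)
  have sat: "saturated_prime_chain R Ps"
    unfolding saturated_prime_chain_def
  proof (intro conjI allI impI notI)
    show "prime_chain R Ps" using Ps by (simp add: chain_def)
    fix i assume i: "Suc i < length Ps" and "\<exists>X\<in>prime_spec R. Ps ! i \<subset> X \<and> X \<subset> Ps ! Suc i"
    then obtain X where X: "X \<in> prime_spec R" "Ps ! i \<subset> X" "X \<subset> Ps ! Suc i" by blast
    note ins = prime_chain_insert[OF \<open>prime_chain R Ps\<close> i X]
    have "chain (take (Suc i) Ps @ X # drop (Suc i) Ps)" using ins(1-3) Ps by (simp add: chain_def)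
    from max[OF this] ins(4) show False by simp
  qed
  show thesis
  proof (rule that[of "length Ps"])
    show "\<exists>Qs. saturated_prime_chain R Qs \<and> hd Qs = P \<and> last Qs = Q \<and> length Qs = length Ps"
      using sat Ps by (auto simp: chain_def)
    show "\<forall>Qs. saturated_prime_chain R Qs \<and> hd Qs = P \<and> last Qs = Q \<longrightarrow> length Qs = length Ps"
      using eq sat Ps by (metis chain_def)
    show "\<forall>Qs. prime_chain R Qs \<and> hd Qs = P \<and> last Qs = Q \<longrightarrow> length Qs \<le> length Ps"
      using max by (simp add: chain_def)
  qed
qed

context noetherian_local_ring
begin

text \<open>The last conclusion says that \<open>Q\<close> has height at most one. Choose \<open>Q\<close> minimal among the primes that
contain a minimal prime of each class. If \<open>Q\<close> had height at least two, a sequence of minimal primes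
from \<open>q\<close> to \<open>q'\<close> inside \<open>Q\<close> would cross between the classes at some link, and a link consists of at
least two primes inside \<open>Q\<close>, the smaller of which contradicts the minimality of \<open>Q\<close>.\<close>

lemma codim_one_crossing:
  assumes S: "serre_condition R k" "2 \<le> k"
    and a: "minimal_prime R a" "a \<in> \<A>" and b: "minimal_prime R b" "b \<notin> \<A>"
  obtains q q' Q where "minimal_prime R q" "q \<in> \<A>" "minimal_prime R q'" "q' \<notin> \<A>"
    "Q \<in> prime_spec R" "q \<subset> Q" "q' \<subset> Q"
    "\<forall>X\<in>prime_spec R. \<forall>Y\<in>prime_spec R. X \<subset> Y \<longrightarrow> \<not> Y \<subset> Q"
proof -
  \<comment> \<open>sums of one prime of each class: finitely many, so some \<open>Q\<close> above one of them is minimal\<close>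
  define \<I> where "\<I> = {q <+>\<^bsub>R\<^esub> q' | q q'. minimal_prime R q \<and> q \<in> \<A> \<and> minimal_prime R q' \<and> q' \<notin> \<A>}"
  have "\<I> \<subseteq> (\<lambda>(q, q'). q <+>\<^bsub>R\<^esub> q') ` ({q. minimal_prime R q} \<times> {q. minimal_prime R q})"
    by (auto simp: \<I>_def)
  then have fin: "finite \<I>"
    by (rule finite_subset) (intro finite_imageI finite_cartesian_product finite_minimal_primes)
  have idI: "ideal J R" if "J \<in> \<I>" for J
    using that add_ideals prime_ideal[OF minimal_prime_prime] by (auto simp: \<I>_def)
  have sum_sub: "q <+>\<^bsub>R\<^esub> q' \<subseteq> Q \<longleftrightarrow> q \<subseteq> Q \<and> q' \<subseteq> Q"
    if "minimal_prime R q" "minimal_prime R q'" "Q \<in> prime_spec R" for q q' Q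
  proof -
    have id: "ideal q R" "ideal q' R" using that prime_ideal[OF minimal_prime_prime] by auto
    have "Idl (q \<union> q') \<subseteq> Q \<longleftrightarrow> q \<union> q' \<subseteq> Q"
      using ideal_subset[OF id(1)] ideal_subset[OF id(2)] by (intro Idl_subset_prime that(3)) blast
    then show ?thesis unfolding union_genideal[OF id] by simp
  qed
  have abI: "a <+>\<^bsub>R\<^esub> b \<in> \<I>" using a b by (auto simp: \<I>_def)
  have abM: "a <+>\<^bsub>R\<^esub> b \<subseteq> M"
    using sum_sub[OF a(1) b(1) M_prime] prime_subset_M minimal_prime_prime a(1) b(1) by simp
  obtain Q J where Q: "Q \<in> prime_spec R" "J \<in> \<I>" "J \<subseteq> Q"
    and min: "\<forall>P' J. P' \<in> prime_spec R \<longrightarrow> J \<in> \<I> \<longrightarrow> J \<subseteq> P' \<longrightarrow> P' \<subseteq> Q \<longrightarrow> P' = Q"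
    by (rule minimal_prime_over_family[OF fin idI M_prime abI abM]) (assumption | rule that | blast)+
  obtain q q' where q: "minimal_prime R q" "q \<in> \<A>" "minimal_prime R q'" "q' \<notin> \<A>" "J = q <+>\<^bsub>R\<^esub> q'"
    using Q(2) unfolding \<I>_def by blast
  have qQ: "q \<subseteq> Q" "q' \<subseteq> Q" using sum_sub[OF q(1,3) Q(1)] Q(3) q(5) by auto
  have "q \<noteq> q'" using q by blast
  then have strict: "q \<subset> Q" "q' \<subset> Q"
    using qQ minimal_primeD[OF q(1) minimal_prime_prime[OF q(3)]]
      minimal_primeD[OF q(3) minimal_prime_prime[OF q(1)]] by auto
  have "False" if X: "X \<in> prime_spec R" and Y: "Y \<in> prime_spec R" and XY: "X \<subset> Y" "Y \<subset> Q" for X Y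
  proof -
    have "prime_chain R [X, Y, Q] \<and> last [X, Y, Q] = Q"
      using X Y Q(1) XY by (auto simp: prime_chain_def)
    then have "ereal (real (length [X, Y, Q] - 1)) \<le> height R Q"
      unfolding height_def by (intro Sup_upper) blast
    then have ht: "2 \<le> min (ereal (real k)) (height R Q)" using S(2) by simp
    obtain ps where ps: "ps \<noteq> []" "hd ps = q" "last ps = q'" "\<forall>q\<in>set ps. minimal_prime R q \<and> q \<subseteq> Q"
      and link: "\<forall>i. Suc i < length ps \<longrightarrow> (\<exists>Qs. min (ereal (real k)) (height R Q) \<le> ereal (real (length Qs)) \<and>
       set Qs \<subseteq> prime_spec R \<and> sorted_wrt (\<subset>) Qs \<and>
       (\<forall>X\<in>set Qs. ps ! i \<subseteq> X \<and> ps ! Suc i \<subseteq> X \<and> X \<subseteq> Q))"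
      using minimal_primes_linked_below_prime[OF Q(1)[unfolded prime_spec_iff] S(1) q(1) qQ(1) q(3) qQ(2)]
      by (elim exE conjE)
    obtain i where i: "Suc i < length ps" "ps ! i \<in> \<A>" "ps ! Suc i \<notin> \<A>"
      using crossing_index[of ps \<A>] ps(1-3) q(2,4) by auto
    obtain Qs where Qs: "min (ereal (real k)) (height R Q) \<le> ereal (real (length Qs))"
      "set Qs \<subseteq> prime_spec R" "sorted_wrt (\<subset>) Qs"
      "\<forall>X\<in>set Qs. ps ! i \<subseteq> X \<and> ps ! Suc i \<subseteq> X \<and> X \<subseteq> Q" using link i(1) by blast
    have "ereal 2 \<le> ereal (real (length Qs))" using order_trans[OF ht Qs(1)] by simp
    then have "2 \<le> length Qs" by simp
    then obtain Q0 Q1 Qs' where Qs': "Qs = Q0 # Q1 # Qs'" by (cases Qs; cases "tl Qs") auto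
    have m: "minimal_prime R (ps ! i)" "minimal_prime R (ps ! Suc i)" using ps(4) i(1) by auto
    have Q0: "Q0 \<in> prime_spec R" "ps ! i \<subseteq> Q0" "ps ! Suc i \<subseteq> Q0" "Q0 \<subset> Q1" "Q1 \<subseteq> Q"
      using Qs(2-4) Qs' by auto
    have "ps ! i <+>\<^bsub>R\<^esub> ps ! Suc i \<in> \<I>" using m i(2,3) by (auto simp: \<I>_def)
    moreover have "ps ! i <+>\<^bsub>R\<^esub> ps ! Suc i \<subseteq> Q0" using sum_sub[OF m Q0(1)] Q0(2,3) by simp
    ultimately have "Q0 = Q" using min Q0 by blast
    then show False using Q0(4,5) by blast
  qed
  then show thesis using that[OF q(1-4) Q(1) strict] by blast
qed

text \<open>Here \<open>n\<close> is \<open>dim R + 1\<close>, since lengths count primes and not inclusions. A minimal prime \<open>q\<close> below a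
prime \<open>Q\<close> of height one starts a saturated chain through \<open>Q\<close>, so its dimension is one more than that
of \<open>Q\<close>. If the minimal primes had different dimensions, the class of those with one given dimension
and its complement would have a common \<open>Q\<close> of height one above them.\<close>

lemma equidimensional:
  assumes cat: "catenary R" and S: "serre_condition R k" "2 \<le> k"
  obtains n where "\<And>p. minimal_prime R p \<Longrightarrow>
      \<exists>Ps. prime_chain R Ps \<and> hd Ps = p \<and> last Ps = M \<and> length Ps = n"
    "\<And>Ps. prime_chain R Ps \<Longrightarrow> length Ps \<le> n"
    "\<And>q Q. minimal_prime R q \<Longrightarrow> Q \<in> prime_spec R \<Longrightarrow> q \<subset> Q \<Longrightarrow>
      \<forall>X\<in>prime_spec R. \<forall>Y\<in>prime_spec R. X \<subset> Y \<longrightarrow> \<not> Y \<subset> Q \<Longrightarrow>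
      \<exists>Ps. prime_chain R Ps \<and> hd Ps = Q \<and> last Ps = M \<and> Suc (length Ps) = n"
proof -
  define ok where "ok P n \<longleftrightarrow> (\<exists>Ps. saturated_prime_chain R Ps \<and> hd Ps = P \<and> last Ps = M \<and> length Ps = n) \<and>
    (\<forall>Ps. saturated_prime_chain R Ps \<and> hd Ps = P \<and> last Ps = M \<longrightarrow> length Ps = n) \<and>
    (\<forall>Ps. prime_chain R Ps \<and> hd Ps = P \<and> last Ps = M \<longrightarrow> length Ps \<le> n)" for P n
  have "\<exists>n. ok P n" if P: "P \<in> prime_spec R" for P
    by (rule catenary_chain_length[OF cat P M_prime prime_subset_M[OF P]]) (auto simp: ok_def)
  then obtain l where l: "\<And>P. P \<in> prime_spec R \<Longrightarrow> ok P (l P)" by metis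
  have step: "l q = Suc (l Q)"
    if q: "minimal_prime R q" and Q: "Q \<in> prime_spec R" and qQ: "q \<subset> Q"
      and ht: "\<forall>X\<in>prime_spec R. \<forall>Y\<in>prime_spec R. X \<subset> Y \<longrightarrow> \<not> Y \<subset> Q" for q Q
  proof -
    note qS = minimal_prime_prime[OF q]
    obtain Ps where Ps: "saturated_prime_chain R Ps" "hd Ps = Q" "last Ps = M" "length Ps = l Q"
      using l[OF Q] unfolding ok_def by blast
    have ne: "Ps \<noteq> []" and so: "sorted_wrt (\<subset>) Ps" and PS: "set Ps \<subseteq> prime_spec R"
      using Ps(1) by (auto simp: saturated_prime_chain_def prime_chain_def)
    have "saturated_prime_chain R (q # Ps)"
      unfolding saturated_prime_chain_def
    proof (intro conjI allI impI)
      have "q \<subset> X" if "X \<in> set Ps" for X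
        using that so Ps(2) qQ by (cases Ps) auto
      then show "prime_chain R (q # Ps)" using so PS qS by (auto simp: prime_chain_def)
      fix i assume i: "Suc i < length (q # Ps)"
      show "\<not> (\<exists>X\<in>prime_spec R. (q # Ps) ! i \<subset> X \<and> X \<subset> (q # Ps) ! Suc i)"
      proof (cases i)
        case 0
        then show ?thesis using ht qS Ps(2) ne by (auto simp: hd_conv_nth)
      next
        case (Suc j)
        then show ?thesis using Ps(1) i by (auto simp: saturated_prime_chain_def)
      qed
    qed
    then have "length (q # Ps) = l q" using l[OF qS] Ps(3) ne unfolding ok_def by auto
    then show ?thesis using Ps(4) by simp
  qed
  obtain p where p: "minimal_prime R p" using minimal_prime_below[OF M_prime] .
  have const: "l p' = l p" if p': "minimal_prime R p'" for p'
  proof (rule ccontr)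
    assume ne: "l p' \<noteq> l p"
    obtain q q' Q where q: "minimal_prime R q" "q \<in> {q. l q = l p}" "minimal_prime R q'" "q' \<notin> {q. l q = l p}"
      "Q \<in> prime_spec R" "q \<subset> Q" "q' \<subset> Q"
      "\<forall>X\<in>prime_spec R. \<forall>Y\<in>prime_spec R. X \<subset> Y \<longrightarrow> \<not> Y \<subset> Q"
      by (rule codim_one_crossing[OF S p _ p', of "{q. l q = l p}"]) (use ne in \<open>auto intro: that\<close>)
    have "l q = Suc (l Q)" "l q' = Suc (l Q)"
      by (rule step[OF q(1,5,6,8)], rule step[OF q(3,5,7,8)])
    then show False using q(2,4) by simp
  qed
  show thesis
  proof (rule that[of "l p"])
    show "\<exists>Ps. prime_chain R Ps \<and> hd Ps = p' \<and> last Ps = M \<and> length Ps = l p" if "minimal_prime R p'" for p'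
      using l[OF minimal_prime_prime[OF that]] const[OF that]
      unfolding ok_def saturated_prime_chain_def by metis
    show "\<exists>Ps. prime_chain R Ps \<and> hd Ps = Q \<and> last Ps = M \<and> Suc (length Ps) = l p"
      if "minimal_prime R q" "Q \<in> prime_spec R" "q \<subset> Q"
        "\<forall>X\<in>prime_spec R. \<forall>Y\<in>prime_spec R. X \<subset> Y \<longrightarrow> \<not> Y \<subset> Q" for q Q
      using l[OF that(2)] step[OF that] const[OF that(1)]
      unfolding ok_def saturated_prime_chain_def by metis
    fix Ps assume Ps: "prime_chain R Ps"
    then have ne: "Ps \<noteq> []" and so: "sorted_wrt (\<subset>) Ps" and PS: "set Ps \<subseteq> prime_spec R"
      by (auto simp: prime_chain_def)
    obtain p' where p': "minimal_prime R p'" "p' \<subseteq> hd Ps"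
      using minimal_prime_below[of "hd Ps"] PS ne hd_in_set by blast
      \<comment> \<open>extend the chain down to a minimal prime and up to \<open>M\<close>\<close>
  define Ps1 where "Ps1 = (if hd Ps = p' then Ps else p' # Ps)"
    have hdle: "hd Ps \<subseteq> X" if "X \<in> set Ps" for X using that so by (cases Ps) auto
    have 1: "prime_chain R Ps1" "hd Ps1 = p'" "length Ps \<le> length Ps1" "last Ps1 = last Ps"
      using Ps p' ne so PS minimal_prime_prime[OF p'(1)] hdle
      by (auto simp: Ps1_def prime_chain_def)
    define Ps2 where "Ps2 = (if last Ps1 = M then Ps1 else Ps1 @ [M])"
    have ne1: "Ps1 \<noteq> []" and so1: "sorted_wrt (\<subset>) Ps1" and PS1: "set Ps1 \<subseteq> prime_spec R"
      using 1(1) by (auto simp: prime_chain_def)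
    have lastle: "X \<subseteq> last Ps1" if "X \<in> set Ps1" for X
    proof -
      have "sorted_wrt (\<subset>) (butlast Ps1 @ [last Ps1])" using so1 ne1 by simp
      moreover have "X \<in> set (butlast Ps1 @ [last Ps1])" using that ne1 by simp
      ultimately show ?thesis unfolding sorted_wrt_append by auto
    qed
    have lM: "last Ps1 \<subseteq> M" using PS1 ne1 by (intro prime_subset_M) auto
    have strictM: "X \<subset> M" if "X \<in> set Ps1" "last Ps1 \<noteq> M" for X
      using lastle[OF that(1)] lM that(2) by blast
    have 2: "prime_chain R Ps2" "hd Ps2 = p'" "length Ps1 \<le> length Ps2" "last Ps2 = M"
      using 1 ne1 so1 PS1 M_prime strictM by (auto simp: Ps2_def prime_chain_def sorted_wrt_append)
    have "length Ps2 \<le> l p'" using l[OF minimal_prime_prime[OF p'(1)]] 2 unfolding ok_def by blast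
    then show "length Ps \<le> l p" using 1(3) 2(3) const[OF p'(1)] by simp
  qed
qed

text \<open>Let \<open>V(C)\<close> disconnect the spectrum. If it contains a minimal prime, its dimension is that of \<open>R\<close>.
Otherwise every minimal prime belongs to exactly one of the two pieces, and a prime of height one
that lies above minimal primes from both pieces belongs to \<open>V(C)\<close>.\<close>

theorem serre_imp_connected_in_codim_one:
  assumes cat: "catenary R" and S: "serre_condition R k" "2 \<le> k"
  shows "connected_in_codim R 1"
proof -
  obtain n where full: "\<And>p. minimal_prime R p \<Longrightarrow>
      \<exists>Ps. prime_chain R Ps \<and> hd Ps = p \<and> last Ps = M \<and> length Ps = n"
    and bound: "\<And>Ps. prime_chain R Ps \<Longrightarrow> length Ps \<le> n"
    and above: "\<And>q Q. minimal_prime R q \<Longrightarrow> Q \<in> prime_spec R \<Longrightarrow> q \<subset> Q \<Longrightarrow>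
      \<forall>X\<in>prime_spec R. \<forall>Y\<in>prime_spec R. X \<subset> Y \<longrightarrow> \<not> Y \<subset> Q \<Longrightarrow>
      \<exists>Ps. prime_chain R Ps \<and> hd Ps = Q \<and> last Ps = M \<and> Suc (length Ps) = n"
    by (rule equidimensional[OF cat S]) (assumption | rule that)+
  have n1: "1 \<le> n" using bound[of "[M]"] M_prime by (simp add: prime_chain_def)
  have dim: "krull_dim R \<le> ereal (real n - 1)"
    unfolding krull_dim_def
  proof (rule Sup_least)
    fix y assume y: "y \<in> insert (- 1) {ereal (real (length Ps - 1)) | Ps. prime_chain R Ps}"
    show "y \<le> ereal (real n - 1)"
    proof (cases "y = - 1")
      case True
      then show ?thesis using n1 by (simp add: one_ereal_def)
    next
      case False
      then obtain Ps where Ps: "prime_chain R Ps" "y = ereal (real (length Ps - 1))" using y by blast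
      then have "length Ps \<le> n" "Ps \<noteq> []" using bound by (auto simp: prime_chain_def)
      then show ?thesis using Ps(2) by (cases Ps) auto
    qed
  qed
  have chain_over: "ereal (real (length Ps)) - 1 \<le> top_dim (subtopology (zariski R) {P \<in> prime_spec R. C \<subseteq> P})"
    if "prime_chain R Ps" "C \<subseteq> hd Ps" "C \<subseteq> carrier R" for C Ps
  proof (rule top_dim_ge_prime_chain[OF that(3)])
    show "set Ps \<subseteq> prime_spec R" "sorted_wrt (\<subset>) Ps" using that(1) by (auto simp: prime_chain_def)
    then show "\<forall>P\<in>set Ps. C \<subseteq> P" using that(2) by (cases Ps) auto
  qed
  have "ereal (real n - 2) \<le> connectivity_dim (zariski R)"
    unfolding connectivity_dim_def
  proof (rule Inf_greatest, safe)
    fix Z assume Z: "closedin (zariski R) Z"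
      and d: "disconnected_space (subtopology (zariski R) (topspace (zariski R) - Z))"
    obtain C where C: "C \<subseteq> carrier R" "Z = {P \<in> prime_spec R. C \<subseteq> P}"
      using Z unfolding closedin_zariski by (elim exE conjE)
    have suff: "ereal (real n - 2) \<le> top_dim (subtopology (zariski R) Z)"
      if "prime_chain R Ps" "C \<subseteq> hd Ps" "n \<le> Suc (length Ps)" for Ps
    proof -
      have "real n - 2 \<le> real (length Ps) - 1" using that(3) by linarith
      then have "ereal (real n - 2) \<le> ereal (real (length Ps)) - 1" by (simp add: one_ereal_def)
      then show ?thesis using chain_over[OF that(1,2) C(1)] unfolding C(2) by (rule order_trans)
    qed
    show "ereal (real n - 2) \<le> top_dim (subtopology (zariski R) Z)"
    proof (cases "\<exists>p. minimal_prime R p \<and> C \<subseteq> p")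
      case True
      then obtain p where p: "minimal_prime R p" "C \<subseteq> p" by blast
      obtain Ps where "prime_chain R Ps" "hd Ps = p" "length Ps = n" using full[OF p(1)] by blast
      then show ?thesis using p(2) by (intro suff[of Ps]) auto
    next
      case False
      obtain p where p: "minimal_prime R p" using minimal_prime_below[OF M_prime] .
      have P0: "p \<in> prime_spec R" "\<not> C \<subseteq> p" using False p minimal_prime_prime by auto
      obtain A B PA PB where AB: "A \<subseteq> carrier R" "B \<subseteq> carrier R"
        "PA \<in> prime_spec R" "\<not> A \<subseteq> PA" "PB \<in> prime_spec R" "\<not> B \<subseteq> PB"
        and cover: "\<forall>P\<in>prime_spec R. A \<subseteq> P \<or> B \<subseteq> P"
        and V: "\<forall>P\<in>prime_spec R. A \<subseteq> P \<and> B \<subseteq> P \<longrightarrow> C \<subseteq> P"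
        by (rule separation_of_complement[OF C(1) d[unfolded C(2)] P0]) (rule that)
      obtain a where a: "minimal_prime R a" "a \<subseteq> PA" using minimal_prime_below[OF AB(3)] .
      obtain b where b: "minimal_prime R b" "b \<subseteq> PB" using minimal_prime_below[OF AB(5)] .
      have aA: "\<not> A \<subseteq> a" using a(2) AB(4) by blast
      have "\<not> B \<subseteq> b" using b(2) AB(6) by blast
      then have bA: "A \<subseteq> b" using cover minimal_prime_prime[OF b(1)] by blast
      obtain q q' Q where q: "minimal_prime R q" "q \<in> {q. \<not> A \<subseteq> q}" "minimal_prime R q'" "q' \<notin> {q. \<not> A \<subseteq> q}"
        "Q \<in> prime_spec R" "q \<subset> Q" "q' \<subset> Q"
        "\<forall>X\<in>prime_spec R. \<forall>Y\<in>prime_spec R. X \<subset> Y \<longrightarrow> \<not> Y \<subset> Q"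
        by (rule codim_one_crossing[OF S a(1) _ b(1), of "{q. \<not> A \<subseteq> q}"]) (use aA bA in \<open>auto intro: that\<close>)
      have "A \<subseteq> Q" using q(4,7) by blast
      moreover have "B \<subseteq> Q" using cover minimal_prime_prime[OF q(1)] q(2,6) by blast
      ultimately have CQ: "C \<subseteq> Q" using V q(5) by blast
      obtain Ps where "prime_chain R Ps" "hd Ps = Q" "Suc (length Ps) = n" using above[OF q(1,5,6,8)] by blast
      then show ?thesis using CQ by (intro suff[of Ps]) auto
    qed
  qed
  moreover have "krull_dim R - ereal (real 1) \<le> ereal (real n - 2)"
    using dim by (cases "krull_dim R") auto
  ultimately show ?thesis unfolding connected_in_codim_def by (rule order_trans[rotated])
qed

end

section \<open>Connectivity of the spectrum\<close>

theorem proposition2p11: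
  fixes R :: "('a, 'b) ring_scheme" and M :: "'a set"
  assumes "noetherian_ring R" and "local_ring R M" and "catenary R"
  shows "connectivity_dim (zariski R) \<ge> depth R - 1 \<and>
    (\<forall>k::nat. k \<ge> 2 \<and> serre_condition R k \<longrightarrow>
       connected_in_codim R 1 \<and>
       (\<forall>p p' P. minimal_prime R p \<and> minimal_prime R p' \<and> primeideal P R \<and> p <+>\<^bsub>R\<^esub> p' \<subseteq> P \<longrightarrow>
          (\<exists>ps. ps \<noteq> [] \<and> hd ps = p \<and> last ps = p' \<and>
             (\<forall>q \<in> set ps. minimal_prime R q \<and> q \<subseteq> P) \<and>
             (\<forall>i. Suc i < length ps \<longrightarrow>
                krull_dim (R Quot (ps ! i <+>\<^bsub>R\<^esub> ps ! Suc i))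
                  \<ge> min (ereal (real k)) (height R P) - 1))))"
proof -
  interpret noetherian_local_ring R M
    using assms(1,2) unfolding local_ring_def
    by (simp add: noetherian_local_ring_def noetherian_local_ring_axioms_def noetherian_cring_def)
  have seq: "\<exists>ps. ps \<noteq> [] \<and> hd ps = p \<and> last ps = p' \<and>
             (\<forall>q \<in> set ps. minimal_prime R q \<and> q \<subseteq> P) \<and>
             (\<forall>i. Suc i < length ps \<longrightarrow>
                krull_dim (R Quot (ps ! i <+>\<^bsub>R\<^esub> ps ! Suc i))
                  \<ge> min (ereal (real k)) (height R P) - 1)"
    if S: "serre_condition R k" and p: "minimal_prime R p" and p': "minimal_prime R p'"
      and P: "primeideal P R" and pp: "p <+>\<^bsub>R\<^esub> p' \<subseteq> P" for k p p' P
  proof -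
    have id: "ideal q R" if "minimal_prime R q" for q using prime_ideal[OF minimal_prime_prime[OF that]] .
    have "p \<union> p' \<subseteq> Idl\<^bsub>R\<^esub> (p \<union> p')" using ideal_subset[OF id] p p' by (intro genideal_self) auto
    then have sub: "p \<subseteq> P" "p' \<subseteq> P" using pp unfolding union_genideal[OF id[OF p] id[OF p']] by auto
    obtain ps where ps: "ps \<noteq> []" "hd ps = p" "last ps = p'" "\<forall>q\<in>set ps. minimal_prime R q \<and> q \<subseteq> P"
      and link: "\<forall>i. Suc i < length ps \<longrightarrow> (\<exists>Qs. min (ereal (real k)) (height R P) \<le> ereal (real (length Qs)) \<and>
       set Qs \<subseteq> prime_spec R \<and> sorted_wrt (\<subset>) Qs \<and>
       (\<forall>X\<in>set Qs. ps ! i \<subseteq> X \<and> ps ! Suc i \<subseteq> X \<and> X \<subseteq> P))"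
      using minimal_primes_linked_below_prime[OF P S p sub(1) p' sub(2)] by (elim exE conjE)
    have "min (ereal (real k)) (height R P) - 1 \<le> krull_dim (R Quot (ps ! i <+>\<^bsub>R\<^esub> ps ! Suc i))"
      if i: "Suc i < length ps" for i
    proof -
      obtain Qs where Qs: "min (ereal (real k)) (height R P) \<le> ereal (real (length Qs))"
        "set Qs \<subseteq> prime_spec R" "sorted_wrt (\<subset>) Qs"
        "\<forall>X\<in>set Qs. ps ! i \<subseteq> X \<and> ps ! Suc i \<subseteq> X \<and> X \<subseteq> P" using link i by blast
      have m: "ideal (ps ! i) R" "ideal (ps ! Suc i) R" using ps(4) i by (auto intro!: id)
      have "\<forall>X\<in>set Qs. ps ! i <+>\<^bsub>R\<^esub> ps ! Suc i \<subseteq> X"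
        unfolding union_genideal[OF m, symmetric]
        using Qs(2,4) prime_ideal by (intro ballI genideal_minimal) blast+
      from krull_dim_quotient_ge[OF add_ideals[OF m] Qs(2,3) this]
      show ?thesis using Qs(1) by (meson ereal_minus_mono order.refl order_trans)
    qed
    then show ?thesis using ps by (intro exI[of _ ps]) auto
  qed
  show ?thesis
    using connectivity_dim_ge_depth serre_imp_connected_in_codim_one[OF assms(3)] seq by blast
qed

end
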